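(* Let $\mathfrak A$ be a Banach algebra, and let $\phi$ be a continuous $\mathfrak A$-valued measure of finite variation on an interval $I$ with $\int|\phi|<2$. Then $\log \exp_{\mathrm R}(\phi)$ exists, $\sum_{n=1}^\infty |\mu_{n,\mathrm R}(\phi)|<+\infty$, $\sum_{n=1}^\infty \max_{\lambda\in[0,1]}|\mu^{(\lambda)}_{n,\mathrm R}(\phi)|<+\infty$, and $$\log \exp_{\mathrm R}(\phi)=\int_{\lambda=0}^1\sum_{k=1}^\infty \mu^{(\lambda)}_{k,\mathrm R}(\phi)\,\mathrm d\lambda=\sum_{k=1}^\infty\mu_{k,\mathrm R}(\phi).$$ Moreover, the spectral radius of $\log\exp_{\mathrm R}(\phi)$ is at most $2\arcsin\frac r2$, where $r=\int|\phi|$.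
   Context: Banach algebras are unital, real or complex. For a real Banach algebra, spectra are taken in the complexification $\mathbb C\mathfrak A$ with norm $|x|=\inf\{\sum_i|t_i|\,|x_i|: x=\sum_i t_ix_i,\ x_i\in\mathfrak A,\ t_i\in\mathbb C\}$. An $\mathfrak A$-valued measure on a bounded interval $I$ is a $\sigma$-additive $\mathfrak A$-valued function $\phi$ on the subintervals of $I$ (degenerate ones included). Its variation is $|\phi|(J)=\sup\{\sum_s|\phi(J_s)|: J_s \text{ finitely many disjoint subintervals of }J\}$, and $\int|\phi|=|\phi|(I)$; finite variation means $\int|\phi|<\infty$; continuous means $\phi(\{x\})=0$ for all $x\in I$. Integrals of multilinear expressions are taken with respect to product measures. The time-ordered exponential is $\exp_{\mathrm R}(\phi)=1+\sum_{k\ge1}\int_{t_1\le\dots\le t_k\in I}\phi(t_1)\cdots\phi(t_k)$. For $\sigma\in\Sigma_k$ (permutation of $\{1,\dots,k\}$), $\mathrm{asc}(\sigma)$ and $\mathrm{des}(\sigma)$ are the numbers of indices $i$ with $\sigma(i)<\sigma(i+1)$, resp. $\sigma(i)>\sigma(i+1)$. Put $\mu_k^{(\lambda)}(X_1,\dots,X_k)=\sum_{\sigma\in\Sigma_k}\lambda^{\mathrm{asc}(\sigma)}(\lambda-1)^{\mathrm{des}(\sigma)}X_{\sigma(1)}\cdots X_{\sigma(k)}$ and $\mu_k(X_1,\dots,X_k)=\sum_{\sigma\in\Sigma_k}(-1)^{\mathrm{des}(\sigma)}\frac{\mathrm{asc}(\sigma)!\,\mathrm{des}(\sigma)!}{k!}X_{\sigma(1)}\cdots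 X_{\sigma(k)}$ (the latter is the part of $\log(\exp(X_1)\cdots\exp(X_k))$ in which every variable has multiplicity exactly $1$). Then $\mu_{k,\mathrm R}(\phi)=\int_{t_1\le\dots\le t_k\in I}\mu_k(\phi(t_1),\dots,\phi(t_k))$ and $\mu^{(\lambda)}_{k,\mathrm R}(\phi)=\int_{t_1\le\dots\le t_k\in I}\mu^{(\lambda)}_k(\phi(t_1),\dots,\phi(t_k))$. The series $\sum_k\mu_{k,\mathrm R}(\phi)$ is the Magnus expansion of $\phi$. $\log A$ exists (by definition) iff the spectrum of $A$ is disjoint from $(-\infty,0]$, and then $\log A=\int_0^1 (A-1)(\lambda+(1-\lambda)A)^{-1}\,\mathrm d\lambda$. *)

theory Defs
  imports "HOL-Analysis.Analysis" "HOL-Combinatorics.Permutations"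
begin

definition invertible_elem :: "'a::monoid_mult \<Rightarrow> bool" where
  "invertible_elem x \<longleftrightarrow> (\<exists>y. x * y = 1 \<and> y * x = 1)"

definition alg_inverse :: "'a::monoid_mult \<Rightarrow> 'a" where
  "alg_inverse x = (THE y. x * y = 1 \<and> y * x = 1)"

text \<open>\<open>Cx a b\<close> is the element \<open>a + \<i> b\<close> of the complexification.  Only its algebra
  structure is set up: the spectrum does not depend on the choice of norm.\<close>

datatype 'a complexification = Cx (cx_re: 'a) (cx_im: 'a)

instantiation complexification :: (ring_1) ring_1
begin

definition "0 = Cx 0 0"
definition "1 = Cx 1 0"
definition "x + y = Cx (cx_re x + cx_re y) (cx_im x + cx_im y)"
definition "x - y = Cx (cx_re x - cx_re y) (cx_im x - cx_im y)"
definition "- x = Cx (- cx_re x) (- cx_im x)"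
definition "x * y = Cx (cx_re x * cx_re y - cx_im x * cx_im y)
                       (cx_re x * cx_im y + cx_im x * cx_re y)"

instance
  by standard
    (auto simp: zero_complexification_def one_complexification_def plus_complexification_def
      minus_complexification_def uminus_complexification_def times_complexification_def
      algebra_simps)

end

definition cx_scale ::
    "complex \<Rightarrow> 'a::real_algebra_1 complexification \<Rightarrow> 'a complexification" where
  "cx_scale z x = Cx (Re z *\<^sub>R cx_re x - Im z *\<^sub>R cx_im x) (Re z *\<^sub>R cx_im x + Im z *\<^sub>R cx_re x)"

text \<open>There is no library class of complex Banach algebras.  A complex Banach algebra is a real
  one together with a compatible multiplication by complex scalars, carried by
  \<open>Complex_Scalars\<close>.\<close>

datatype 'a scalars = Real_Scalars | Complex_Scalars "complex \<Rightarrow> 'a \<Rightarrow> 'a"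

fun scalar_structure :: "'a::{real_normed_algebra_1,banach} scalars \<Rightarrow> bool" where
  "scalar_structure Real_Scalars \<longleftrightarrow> True"
| "scalar_structure (Complex_Scalars s) \<longleftrightarrow>
     vector_space s \<and>
     (\<forall>r x. s (complex_of_real r) x = r *\<^sub>R x) \<and>
     (\<forall>z x y. s z x * y = s z (x * y)) \<and>
     (\<forall>z x y. x * s z y = s z (x * y)) \<and>
     (\<forall>z x. norm (s z x) = cmod z * norm x)"

definition spectrum_wrt :: "(complex \<Rightarrow> 'a::ring_1 \<Rightarrow> 'a) \<Rightarrow> 'a \<Rightarrow> complex set" where
  "spectrum_wrt s a = {z. \<not> invertible_elem (a - s z 1)}"

fun alg_spectrum :: "'a::{real_normed_algebra_1,banach} scalars \<Rightarrow> 'a \<Rightarrow> complex set" where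
  "alg_spectrum Real_Scalars a = spectrum_wrt cx_scale (Cx a 0)"
| "alg_spectrum (Complex_Scalars s) a = spectrum_wrt s a"

definition alg_spectral_radius :: "'a::{real_normed_algebra_1,banach} scalars \<Rightarrow> 'a \<Rightarrow> ennreal" where
  "alg_spectral_radius S a = (SUP z \<in> alg_spectrum S a. ennreal (cmod z))"

definition log_exists :: "'a::{real_normed_algebra_1,banach} scalars \<Rightarrow> 'a \<Rightarrow> bool" where
  "log_exists S a \<longleftrightarrow> alg_spectrum S a \<inter> complex_of_real ` {..0} = {}"

text \<open>The value is meaningful when \<open>log_exists\<close> holds.  In the real case the inverse is taken in
  the algebra itself: an inverse in the complexification of a real element is real.\<close>

definition alg_log :: "'a::{real_normed_algebra_1,banach} \<Rightarrow> 'a" where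
  "alg_log a = integral {0..1}
     (\<lambda>l::real. (a - 1) * alg_inverse (l *\<^sub>R 1 + (1 - l) *\<^sub>R a))"

definition subintervals :: "real set \<Rightarrow> real set set" where
  "subintervals I = {J. is_interval J \<and> J \<subseteq> I}"

text \<open>The empty set counts as an interval, so sequences also cover finite families.\<close>

definition vector_measure_on :: "real set \<Rightarrow> (real set \<Rightarrow> 'a::real_normed_vector) \<Rightarrow> bool" where
  "vector_measure_on I \<phi> \<longleftrightarrow>
     (\<forall>J :: nat \<Rightarrow> real set.
        range J \<subseteq> subintervals I \<longrightarrow> disjoint_family J \<longrightarrow> (\<Union>n. J n) \<in> subintervals I \<longrightarrow>
        (\<lambda>n. \<phi> (J n)) sums \<phi> (\<Union>n. J n))"

definition variation :: "(real set \<Rightarrow> 'a::real_normed_vector) \<Rightarrow> real set \<Rightarrow> ennreal" where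
  "variation \<phi> J =
     (SUP P \<in> {P. finite P \<and> P \<subseteq> subintervals J \<and> disjoint P}. \<Sum>K\<in>P. ennreal (norm (\<phi> K)))"

definition continuous_measure_on :: "real set \<Rightarrow> (real set \<Rightarrow> 'a::real_normed_vector) \<Rightarrow> bool" where
  "continuous_measure_on I \<phi> \<longleftrightarrow> (\<forall>x\<in>I. \<phi> {x} = 0)"

text \<open>\<open>F\<close> is a multilinear expression in \<open>X 1, \<dots>, X k\<close>.  \<open>product_measure I \<phi> k F M\<close> says
  that \<open>M\<close> is the measure \<open>F(\<phi>(t\<^sub>1), \<dots>, \<phi>(t\<^sub>k))\<close> on the Borel sets of \<open>I\<^sup>k\<close>: it is
  \<open>\<sigma>\<close>-additive, with the prescribed values on products of intervals.\<close>

definition product_measure ::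
    "real set \<Rightarrow> (real set \<Rightarrow> 'a::real_normed_vector) \<Rightarrow> nat \<Rightarrow> ((nat \<Rightarrow> 'a) \<Rightarrow> 'a) \<Rightarrow>
     ((nat \<Rightarrow> real) set \<Rightarrow> 'a) \<Rightarrow> bool" where
  "product_measure I \<phi> k F M \<longleftrightarrow>
     (\<forall>A :: nat \<Rightarrow> (nat \<Rightarrow> real) set.
        range A \<subseteq> sets (PiM {1..k} (\<lambda>_. restrict_space borel I)) \<longrightarrow> disjoint_family A \<longrightarrow>
        (\<lambda>n. M (A n)) sums M (\<Union>n. A n)) \<and>
     (\<forall>J. (\<forall>i\<in>{1..k}. J i \<in> subintervals I) \<longrightarrow> M (PiE {1..k} J) = F (\<lambda>i. \<phi> (J i)))"

definition ordered_simplex :: "real set \<Rightarrow> nat \<Rightarrow> (nat \<Rightarrow> real) set" where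
  "ordered_simplex I k = {t \<in> {1..k} \<rightarrow>\<^sub>E I. \<forall>i\<in>{1..<k}. t i \<le> t (Suc i)}"

definition ordered_integral ::
    "real set \<Rightarrow> (real set \<Rightarrow> 'a::real_normed_vector) \<Rightarrow> nat \<Rightarrow> ((nat \<Rightarrow> 'a) \<Rightarrow> 'a) \<Rightarrow> 'a" where
  "ordered_integral I \<phi> k F = (THE v. \<exists>M. product_measure I \<phi> k F M \<and> v = M (ordered_simplex I k))"

definition exp_R :: "real set \<Rightarrow> (real set \<Rightarrow> 'a::{real_normed_algebra_1,banach}) \<Rightarrow> 'a" where
  "exp_R I \<phi> = 1 + (\<Sum>n. ordered_integral I \<phi> (Suc n) (\<lambda>X. prod_list (map X [1..<Suc (Suc n)])))"

definition asc :: "nat \<Rightarrow> (nat \<Rightarrow> nat) \<Rightarrow> nat" where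
  "asc k \<sigma> = card {i \<in> {1..<k}. \<sigma> i < \<sigma> (Suc i)}"

definition des :: "nat \<Rightarrow> (nat \<Rightarrow> nat) \<Rightarrow> nat" where
  "des k \<sigma> = card {i \<in> {1..<k}. \<sigma> i > \<sigma> (Suc i)}"

definition mu_param :: "real \<Rightarrow> nat \<Rightarrow> (nat \<Rightarrow> 'a::real_algebra_1) \<Rightarrow> 'a" where
  "mu_param l k X = (\<Sum>\<sigma> | \<sigma> permutes {1..k}.
     (l ^ asc k \<sigma> * (l - 1) ^ des k \<sigma>) *\<^sub>R prod_list (map (\<lambda>i. X (\<sigma> i)) [1..<Suc k]))"

definition mu :: "nat \<Rightarrow> (nat \<Rightarrow> 'a::real_algebra_1) \<Rightarrow> 'a" where
  "mu k X = (\<Sum>\<sigma> | \<sigma> permutes {1..k}.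
     ((- 1) ^ des k \<sigma> * (fact (asc k \<sigma>) * fact (des k \<sigma>) / fact k)) *\<^sub>R
       prod_list (map (\<lambda>i. X (\<sigma> i)) [1..<Suc k]))"

definition mu_param_R ::
    "real \<Rightarrow> real set \<Rightarrow> (real set \<Rightarrow> 'a::real_normed_algebra_1) \<Rightarrow> nat \<Rightarrow> 'a" where
  "mu_param_R l I \<phi> k = ordered_integral I \<phi> k (mu_param l k)"

definition mu_R :: "real set \<Rightarrow> (real set \<Rightarrow> 'a::real_normed_algebra_1) \<Rightarrow> nat \<Rightarrow> 'a" where
  "mu_R I \<phi> k = ordered_integral I \<phi> k (mu k)"

definition is_maximum_on :: "('b \<Rightarrow> real) \<Rightarrow> 'b set \<Rightarrow> real \<Rightarrow> bool" where
  "is_maximum_on f S m \<longleftrightarrow> (\<exists>x\<in>S. f x = m) \<and> (\<forall>x\<in>S. f x \<le> m)"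

end

theory Submission
  imports Defs "HOL-Computational_Algebra.Formal_Power_Series"
begin

text \<open>
  For \<open>\<lambda>\<close> in the complex plane let \<open>Q\<^sub>k(\<lambda>)\<close> be the integral of \<open>\<phi>(t\<^sub>1) \<dots> \<phi>(t\<^sub>k)\<close> over the whole
  cube, weighted by \<open>\<lambda>\<close> for every ascent \<open>t\<^sub>i < t\<^sub>i\<^sub>+\<^sub>1\<close> and by \<open>\<lambda> - 1\<close> for every descent; reordering
  the variables shows that it equals \<open>\<mu>\<^sub>k\<^sub>,\<^sub>R\<close> with parameter \<open>\<lambda>\<close>.  As the weight is the indicator
  of an ascent minus \<open>1 - \<lambda>\<close>, the ordered integrals \<open>P\<^sub>k\<close> satisfy \<open>Q = P - (1 - \<lambda>) P Q\<close>, which makes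
  \<open>1 - (1 - \<lambda>) Q\<close> the inverse of \<open>\<lambda> + (1 - \<lambda>) exp\<^sub>R(\<phi>)\<close> as soon as the series of the \<open>Q\<^sub>k\<close> converges.

  Convergence is governed by the integral operator with kernel \<open>\<bar>\<lambda>\<bar>\<close> above and \<open>\<bar>1 - \<lambda>\<bar>\<close> below the
  diagonal; an exponential test function bounds it by \<open>r/2\<close> uniformly for \<open>\<lambda>\<close> in \<open>[0, 1]\<close>, and by
  less than 1 when \<open>\<lambda> = exp \<zeta> / (exp \<zeta> - 1)\<close> and \<open>r < 2 sin (\<bar>\<zeta>\<bar> / 2)\<close>, \<open>\<bar>\<zeta>\<bar> < \<pi>\<close>.  So \<open>exp\<^sub>R(\<phi>) - exp \<zeta>\<close> is invertible
  there, hence so is \<open>log exp\<^sub>R(\<phi>) - \<zeta>\<close>, and this persists for \<open>t \<phi>\<close>, \<open>0 \<le> t \<le> 1\<close>.  No spectrum crosses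
  the circle of radius \<open>\<bar>\<zeta>\<bar>\<close> along this path, so the spectrum stays inside it.

  Product measures are constructed, and all integrals evaluated, by replacing \<open>\<phi>\<close> with
  measures that have a constant density with respect to the (atomless) variation on each cell of a
  grid.
\<close>


subsection \<open>The complexification as a Banach algebra\<close>

text \<open>The number \<open>\<lambda> = exp \<zeta> / (exp \<zeta> - 1)\<close> solves
  \<open>\<lambda> / (\<lambda> - 1) = exp \<zeta>\<close>, so that
  \<open>\<lambda> + (1 - \<lambda>) A\<close> is a scalar multiple of
  \<open>A - exp \<zeta>\<close>, and \<open>cmod \<lambda> / cmod (1 - \<lambda>)\<close> is
  \<open>exp (Re \<zeta>)\<close>. The kernel then has an exact exponential eigenfunction, and
  comparing its eigenvalue with \<open>r / (2 sin (cmod \<zeta> / 2))\<close> is an inequality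
  between sin and sinh that holds factor by factor in their infinite products. On [0, 1] the exact
  exponent \<open>ln (\<lambda> / (1 - \<lambda>))\<close> is unbounded; the exponent
  \<open>4 \<lambda> - 2\<close> replaces it and gives the rate r/2 with a constant uniform in
  \<lambda>. Two obstacles shape the rest. Ordered integrals are defined by a unique description, so
  even their linearity rests on existence and uniqueness of product measures. And a discrete kernel
  has to decide what a repetition counts as; since there are no atoms, all cells can be given mass
  at most r/N, and tuples with a repetition disappear in the limit.\<close>

lemmas cx_simps = zero_complexification_def one_complexification_def plus_complexification_def
  minus_complexification_def uminus_complexification_def times_complexification_def

lemma cx_sel [simp]:
  "cx_re 0 = 0" "cx_im 0 = 0" "cx_re 1 = 1" "cx_im 1 = 0"
  "cx_re (x + y) = cx_re x + cx_re y" "cx_im (x + y) = cx_im x + cx_im y"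
  "cx_re (x - y) = cx_re x - cx_re y" "cx_im (x - y) = cx_im x - cx_im y"
  "cx_re (- x) = - cx_re x" "cx_im (- x) = - cx_im x"
  "cx_re (x * y) = cx_re x * cx_re y - cx_im x * cx_im y"
  "cx_im (x * y) = cx_re x * cx_im y + cx_im x * cx_re y"
  by (simp_all add: cx_simps)

lemma cx_eq_iff: "x = y \<longleftrightarrow> cx_re x = cx_re y \<and> cx_im x = cx_im y"
  by (cases x; cases y) auto

instantiation complexification :: (real_algebra_1) real_algebra_1
begin

definition "scaleR r x = Cx (r *\<^sub>R cx_re x) (r *\<^sub>R cx_im x)"

instance
  by standard (auto simp: scaleR_complexification_def cx_eq_iff algebra_simps)

end

lemma cx_scaleR_sel [simp]: "cx_re (r *\<^sub>R x) = r *\<^sub>R cx_re x" "cx_im (r *\<^sub>R x) = r *\<^sub>R cx_im x"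
  by (simp_all add: scaleR_complexification_def)

text \<open>This norm is equivalent to the projective one of the paper, submultiplicative and unital,
  but only real-homogeneous; the spectrum does not see the difference.\<close>

instantiation complexification :: (real_normed_algebra_1) real_normed_algebra_1
begin

definition "norm x = norm (cx_re x) + norm (cx_im x)"
definition "sgn x = inverse (norm x) *\<^sub>R (x :: 'a complexification)"
definition "dist x y = norm (x - y :: 'a complexification)"
definition [code del]:
  "(uniformity :: ('a complexification \<times> 'a complexification) filter) =
     (INF e\<in>{0 <..}. principal {(x, y). dist x y < e})"
definition [code del]:
  "open (U :: 'a complexification set) \<longleftrightarrow>
     (\<forall>x\<in>U. eventually (\<lambda>(x', y). x' = x \<longrightarrow> y \<in> U) uniformity)"

instance
proof
  fix x y :: "'a complexification" and r :: real
  show "norm (x + y) \<le> norm x + norm y"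
    unfolding norm_complexification_def
    using norm_triangle_ineq[of "cx_re x" "cx_re y"] norm_triangle_ineq[of "cx_im x" "cx_im y"]
    by simp
  show "norm (r *\<^sub>R x) = \<bar>r\<bar> * norm x"
    by (simp add: norm_complexification_def algebra_simps)
  show "(norm x = 0) = (x = 0)"
    by (simp add: norm_complexification_def cx_eq_iff add_nonneg_eq_0_iff)
  have "norm (x * y) \<le> norm (cx_re x) * norm (cx_re y) + norm (cx_im x) * norm (cx_im y)
      + (norm (cx_re x) * norm (cx_im y) + norm (cx_im x) * norm (cx_re y))"
    unfolding norm_complexification_def cx_sel
    by (intro add_mono order_trans[OF norm_triangle_ineq] order_trans[OF norm_triangle_ineq4]
        norm_mult_ineq)
  also have "\<dots> = norm x * norm y"
    by (simp add: norm_complexification_def algebra_simps)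
  finally show "norm (x * y) \<le> norm x * norm y" .
qed (auto simp: norm_complexification_def sgn_complexification_def dist_complexification_def
    uniformity_complexification_def open_complexification_def)

end

lemma bounded_linear_cx_re: "bounded_linear (cx_re :: 'a::real_normed_algebra_1 complexification \<Rightarrow> 'a)"
  by (rule bounded_linear_intro[of _ 1]) (auto simp: norm_complexification_def)

lemma bounded_linear_cx_im: "bounded_linear (cx_im :: 'a::real_normed_algebra_1 complexification \<Rightarrow> 'a)"
  by (rule bounded_linear_intro[of _ 1]) (auto simp: norm_complexification_def)

definition of_re :: "'a::ring_1 \<Rightarrow> 'a complexification" where "of_re a = Cx a 0"

text \<open>Complex scalars act as multiplication by central elements, so the ring laws suffice and
  no complex vector space structure is set up on the complexification.\<close>

definition of_cx :: "complex \<Rightarrow> 'a::real_algebra_1 complexification" where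
  "of_cx z = cx_scale z 1"

lemma of_re_sel [simp]: "cx_re (of_re a) = a" "cx_im (of_re a) = 0"
  by (simp_all add: of_re_def)

lemma of_cx_sel [simp]: "cx_re (of_cx z) = Re z *\<^sub>R 1" "cx_im (of_cx z) = Im z *\<^sub>R 1"
  by (simp_all add: of_cx_def cx_scale_def)

lemma bounded_linear_of_re: "bounded_linear (of_re :: 'a::real_normed_algebra_1 \<Rightarrow> _)"
  by (rule bounded_linear_intro[of _ 1]) (auto simp: norm_complexification_def cx_eq_iff)

lemma bounded_linear_of_cx:
  "bounded_linear (of_cx :: complex \<Rightarrow> 'a::real_normed_algebra_1 complexification)"
proof (rule bounded_linear_intro[of _ 2])
  fix z :: complex
  show "norm (of_cx z :: 'a complexification) \<le> norm z * 2"
    using abs_Re_le_cmod[of z] abs_Im_le_cmod[of z] by (simp add: norm_complexification_def)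
qed (auto simp: cx_eq_iff algebra_simps)

lemma of_re_simps:
  "of_re 0 = 0" "of_re 1 = 1" "of_re (a + b) = of_re a + of_re b" "of_re (a - b) = of_re a - of_re b"
  "of_re (a * b) = of_re a * of_re b" "of_re (- a) = - of_re a"
  by (simp_all add: cx_eq_iff)

lemma of_re_scaleR: "of_re (r *\<^sub>R a) = r *\<^sub>R of_re a"
  by (simp add: cx_eq_iff)

lemma of_re_sum: "of_re (sum f A) = (\<Sum>x\<in>A. of_re (f x))"
  by (induction A rule: infinite_finite_induct) (auto simp: of_re_simps)

lemma of_re_power: "of_re (a ^ n) = of_re a ^ n"
  by (induction n) (auto simp: of_re_simps)

lemma norm_of_re [simp]: "norm (of_re a) = norm a"
  by (simp add: norm_complexification_def)

lemma of_cx_simps: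
  "of_cx 0 = 0" "of_cx 1 = 1" "of_cx (a + b) = of_cx a + of_cx b" "of_cx (a - b) = of_cx a - of_cx b"
  "of_cx (a * b) = of_cx a * of_cx b" "of_cx (- a) = - of_cx a"
  by (simp_all add: cx_eq_iff algebra_simps)

lemma of_cx_of_real: "of_cx (of_real r) = r *\<^sub>R 1"
  by (simp add: cx_eq_iff)

lemma of_cx_sum: "of_cx (sum f A) = (\<Sum>x\<in>A. of_cx (f x))"
  by (induction A rule: infinite_finite_induct) (auto simp: of_cx_simps)

lemma of_cx_power: "of_cx (a ^ n) = of_cx a ^ n"
  by (induction n) (auto simp: of_cx_simps)

lemma of_cx_commute: "x * of_cx z = of_cx z * x"
  by (simp add: cx_eq_iff)

lemma of_cx_mult_power: "(of_cx u * x) ^ n = of_cx (u ^ n) * x ^ n"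
proof (induction n)
  case (Suc n)
  have "(of_cx u * x) ^ Suc n = of_cx u * (x * of_cx (u ^ n)) * x ^ n"
    by (simp add: Suc mult.assoc)
  then show ?case by (simp only: of_cx_commute[of x] of_cx_simps power_Suc mult.assoc)
qed (simp add: of_cx_simps)

lemma norm_of_cx_le: "norm (of_cx z :: 'a::real_normed_algebra_1 complexification) \<le> 2 * cmod z"
  using abs_Re_le_cmod[of z] abs_Im_le_cmod[of z] by (simp add: norm_complexification_def)

instance complexification :: ("{real_normed_algebra_1,banach}") banach
proof
  fix X :: "nat \<Rightarrow> 'a complexification"
  assume X: "Cauchy X"
  have "Cauchy (\<lambda>n. cx_re (X n))" "Cauchy (\<lambda>n. cx_im (X n))"
    using X by (auto intro!: bounded_linear.Cauchy[OF bounded_linear_cx_re]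
        bounded_linear.Cauchy[OF bounded_linear_cx_im])
  then obtain a b where ab: "(\<lambda>n. cx_re (X n)) \<longlonglongrightarrow> a" "(\<lambda>n. cx_im (X n)) \<longlonglongrightarrow> b"
    by (meson Cauchy_convergent convergent_def)
  have "(\<lambda>n. norm (cx_re (X n) - a) + norm (cx_im (X n) - b)) \<longlonglongrightarrow> 0 + 0"
    using ab by (intro tendsto_add tendsto_norm_zero) (auto simp: LIM_zero)
  then have "(\<lambda>n. norm (X n - Cx a b)) \<longlonglongrightarrow> 0"
    by (simp add: norm_complexification_def)
  then show "convergent X"
    by (auto simp: convergent_def intro!: exI[of _ "Cx a b"] intro: LIM_zero_cancel tendsto_norm_zero_cancel)
qed

lemma of_re_exp: "of_re (exp a) = exp (of_re (a::'a::{real_normed_algebra_1,banach}))"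
  unfolding exp_def
  by (subst bounded_linear.suminf[OF bounded_linear_of_re])
    (auto simp: of_re_scaleR of_re_power summable_exp_generic)

lemma of_cx_exp: "of_cx (exp z) = exp (of_cx z :: 'a::{real_normed_algebra_1,banach} complexification)"
proof -
  have "of_cx (r *\<^sub>R z) = r *\<^sub>R (of_cx z :: 'a complexification)" for r z
    by (simp add: cx_eq_iff)
  then show ?thesis
    unfolding exp_def
    by (subst bounded_linear.suminf[OF bounded_linear_of_cx])
      (auto simp: of_cx_power summable_exp_generic)
qed

subsection \<open>Invertible elements\<close>

text \<open>With z inverse to the product, y z is a right and z y a left inverse of x, so they
  coincide. This extracts 1 - u from \<open>1 - u ^ N\<close>, and x from
  \<open>exp x - 1\<close>.\<close>

lemma invertible_elem_mult_commuting:
  fixes x y :: "'a::monoid_mult"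
  assumes "x * y = y * x" "invertible_elem (x * y)"
  shows "invertible_elem x"
proof -
  obtain z where z: "x * y * z = 1" "z * (x * y) = 1"
    using assms(2) by (auto simp: invertible_elem_def)
  have "x * (y * z) = 1" "(z * y) * x = 1"
    using z(1) z(2)[unfolded assms(1)] by (simp_all only: mult.assoc)
  moreover from this have "y * z = z * y"
    by (metis mult.assoc mult_1_left mult_1_right)
  ultimately show ?thesis
    by (auto simp: invertible_elem_def)
qed

lemma invertible_elem_mult:
  assumes "invertible_elem x" "invertible_elem y"
  shows "invertible_elem (x * y)"
proof -
  obtain a b where "x * a = 1" "a * x = 1" "y * b = 1" "b * y = 1"
    using assms by (auto simp: invertible_elem_def)
  then have "x * y * (b * a) = 1" "b * a * (x * y) = 1"
    by (metis mult.assoc mult_1_right)+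
  then show ?thesis by (auto simp: invertible_elem_def)
qed

lemma alg_inverse_eqI:
  assumes "x * y = 1" "y * x = 1"
  shows "alg_inverse x = y"
  unfolding alg_inverse_def using assms by (intro the_equality) (auto, metis mult.assoc mult_1_left mult_1_right)

lemma alg_inverse:
  assumes "invertible_elem x"
  shows "x * alg_inverse x = 1" "alg_inverse x * x = 1"
  using assms alg_inverse_eqI[of x] by (auto simp: invertible_elem_def)

lemma invertible_of_cx:
  assumes "z \<noteq> 0"
  shows "invertible_elem (of_cx z)"
  using assms unfolding invertible_elem_def
  by (intro exI[of _ "of_cx (1 / z)"]) (simp add: of_cx_simps(2,5)[symmetric])

lemma invertible_of_cx_mult_iff:
  assumes "z \<noteq> 0"
  shows "invertible_elem (of_cx z * x) \<longleftrightarrow> invertible_elem x"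
proof
  assume "invertible_elem (of_cx z * x)"
  then have "invertible_elem (x * of_cx z)" by (simp add: of_cx_commute)
  then show "invertible_elem x"
    by (rule invertible_elem_mult_commuting[rotated]) (simp add: of_cx_commute)
qed (use assms in \<open>auto intro: invertible_elem_mult invertible_of_cx\<close>)

lemma invertible_of_re: "invertible_elem a \<Longrightarrow> invertible_elem (of_re a)"
  unfolding invertible_elem_def by (metis of_re_simps(2,5))

lemma invertible_one_minus:
  fixes x :: "'a::{real_normed_algebra_1,banach}"
  assumes "norm x < 1"
  shows "invertible_elem (1 - x)"
proof -
  have s: "summable (\<lambda>n. x ^ n)" using assms by (rule complete_algebra_summable_geometric)
  have "(\<Sum>n. x ^ n) - x * (\<Sum>n. x ^ n) = 1" "(\<Sum>n. x ^ n) - (\<Sum>n. x ^ n) * x = 1"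
    using suminf_split_head[OF s] suminf_mult[OF s, of x] suminf_mult2[OF s, of x]
    by (simp_all add: power_commutes)
  then show ?thesis
    unfolding invertible_elem_def by (intro exI[of _ "\<Sum>n. x ^ n"]) (simp add: algebra_simps)
qed

text \<open>Let \<open>x'\<close> be close to x, let \<open>y * x' = 1\<close>, and let z be inverse
  to x. Then \<open>y = z - y * (x' - x) * z\<close>, and absorbing the last term gives
  \<open>norm y \<le> 2 * norm z\<close>. So inverses cannot blow up along a convergent
  sequence.\<close>

lemma norm_inverse_bound_compact:
  fixes S :: "'a::real_normed_algebra_1 set"
  assumes "compact S" "\<And>x. x \<in> S \<Longrightarrow> invertible_elem x"
  obtains C where "C > 0" "\<And>x y. x \<in> S \<Longrightarrow> y * x = 1 \<Longrightarrow> norm y \<le> C"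
proof (cases "\<exists>C. \<forall>x\<in>S. \<forall>y. y * x = 1 \<longrightarrow> norm y \<le> C")
  case True
  then obtain C where C: "\<And>x y. x \<in> S \<Longrightarrow> y * x = 1 \<Longrightarrow> norm y \<le> C" by blast
  show ?thesis by (rule that[of "max C 1"]) (use C in \<open>auto simp: le_max_iff_disj\<close>)
next
  case False
  then have "\<forall>n::nat. \<exists>x y. x \<in> S \<and> y * x = 1 \<and> norm y > real n" by (meson not_le)
  then obtain X Y where XY: "\<And>n. X n \<in> S" "\<And>n. Y n * X n = 1" "\<And>n. norm (Y n) > real n"
    by metis
  obtain x f where x: "x \<in> S" "strict_mono f" "(X \<circ> f) \<longlonglongrightarrow> x"
    using assms(1) XY(1) unfolding compact_def by blast
  obtain z where z: "x * z = 1" using assms(2)[OF x(1)] by (auto simp: invertible_elem_def)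
  have "(\<lambda>n. norm (X (f n) - x) * norm z) \<longlonglongrightarrow> 0 * norm z"
    using x(3) by (intro tendsto_intros tendsto_norm_zero) (auto simp: o_def LIM_zero)
  then have "\<forall>\<^sub>F n in sequentially. norm (X (f n) - x) * norm z < 1/2"
    by (rule order_tendstoD) simp
  moreover have "\<forall>\<^sub>F n in sequentially. real n > 2 * norm z"
    using filterlim_real_sequentially by (auto simp: filterlim_at_top_dense)
  ultimately have "\<forall>\<^sub>F n in sequentially. norm (X (f n) - x) * norm z < 1/2 \<and> real n > 2 * norm z"
    by eventually_elim auto
  then obtain n where n: "norm (X (f n) - x) * norm z < 1/2" "real n > 2 * norm z"
    by (auto simp: eventually_sequentially)
  let ?y = "Y (f n)"
  have "?y = ?y * (x * z)" using z by simp
  also have "\<dots> = ?y * (X (f n) * z) - ?y * ((X (f n) - x) * z)" by (simp add: algebra_simps)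
  also have "?y * (X (f n) * z) = z" using XY(2)[of "f n"] by (simp add: mult.assoc[symmetric])
  finally have "norm ?y \<le> norm z + norm (?y * ((X (f n) - x) * z))"
    by (metis norm_triangle_ineq4)
  also have "norm (?y * ((X (f n) - x) * z)) \<le> norm ?y * (norm (X (f n) - x) * norm z)"
    by (meson mult_left_mono norm_ge_zero norm_mult_ineq order_trans)
  also have "\<dots> \<le> norm ?y * (1/2)" using n(1) by (intro mult_left_mono) auto
  finally have "norm ?y \<le> 2 * norm z" by simp
  moreover have "real n \<le> real (f n)" using seq_suble[OF x(2), of n] by simp
  ultimately have False using XY(3)[of "f n"] n(2) by linarith
  then show ?thesis ..
qed



subsection \<open>Spectra along a path\<close>

lemma geometric_sum_noncomm: "(\<Sum>i<n. u ^ i) * (1 - u) = 1 - u ^ n" "(1 - u) * (\<Sum>i<n. u ^ i) = 1 - u ^ n"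
  for u :: "'a::ring_1"
proof (induction n)
  case (Suc n)
  { case 1 show ?case using Suc(1) by (simp add: distrib_right) (simp add: right_diff_distrib power_commutes) }
  { case 2 show ?case using Suc(2) by (simp add: distrib_left) (simp add: left_diff_distrib) }
qed simp_all

lemma sum_unit_roots_power:
  assumes "0 < i" "i < N"
  shows "(\<Sum>j<N. exp (2 * of_real pi * \<i> * of_nat j / of_nat N) ^ i) = (0::complex)"
proof -
  let ?w = "exp (2 * of_real pi * \<i> * of_nat i / of_nat N) :: complex"
  have "(\<Sum>j<N. exp (2 * of_real pi * \<i> * of_nat j / of_nat N) ^ i) = (\<Sum>j<N. ?w ^ j)"
    by (simp add: exp_of_nat_mult[symmetric] algebra_simps)
  moreover have "?w \<noteq> 1"
    using assms by (subst complex_root_unity_eq_1) (auto dest: dvd_imp_le)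
  moreover have "?w ^ N = 1"
    using assms by (subst complex_root_unity) auto
  ultimately show ?thesis
    by (simp add: geometric_sum)
qed

text \<open>As \<open>w j ^ N = 1\<close>, multiplying \<open>R j\<close> by
  \<open>1 - x ^ N\<close> leaves the geometric sum of \<open>w j * x\<close>; summing over the
  roots of unity kills every power except the zeroth. The two one-sided forms are kept apart because
  they are later used on opposite sides of a product.\<close>

lemma resolvent_average:
  fixes x :: "'a::real_normed_algebra_1 complexification"
  assumes "N > 0"
  defines "w \<equiv> \<lambda>j::nat. exp (2 * of_real pi * \<i> * of_nat j / of_nat N) :: complex"
  shows "(\<And>j. j < N \<Longrightarrow> (1 - of_cx (w j) * x) * R j = 1) \<Longrightarrow>
           (1 - x ^ N) * ((1 / real N) *\<^sub>R (\<Sum>j<N. R j)) = 1" (is "PROP ?A")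
    and "(\<And>j. j < N \<Longrightarrow> R j * (1 - of_cx (w j) * x) = 1) \<Longrightarrow>
           ((1 / real N) *\<^sub>R (\<Sum>j<N. R j)) * (1 - x ^ N) = 1" (is "PROP ?B")
proof -
  have wN: "w j ^ N = 1" for j
    unfolding w_def using assms(1) by (subst complex_root_unity) auto
  have "(\<Sum>j<N. \<Sum>i<N. (of_cx (w j) * x) ^ i) = (\<Sum>i<N. of_cx (\<Sum>j<N. w j ^ i) * x ^ i)"
    unfolding of_cx_mult_power of_cx_sum sum_distrib_right by (rule sum.swap)
  also have "\<dots> = (\<Sum>i<N. if i = 0 then of_cx (of_nat N) else 0)"
    using sum_unit_roots_power[of _ N] by (intro sum.cong) (auto simp: w_def of_cx_simps)
  also have "\<dots> = real N *\<^sub>R 1"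
    using assms(1) of_cx_of_real[of "real N"] by simp
  finally have s: "(\<Sum>j<N. \<Sum>i<N. (of_cx (w j) * x) ^ i) = real N *\<^sub>R 1" .
  show "PROP ?A"
  proof -
    assume R: "\<And>j. j < N \<Longrightarrow> (1 - of_cx (w j) * x) * R j = 1"
    have "(1 - x ^ N) * R j = (\<Sum>i<N. (of_cx (w j) * x) ^ i)" if "j < N" for j
    proof -
      have "(1 - x ^ N) = (\<Sum>i<N. (of_cx (w j) * x) ^ i) * (1 - of_cx (w j) * x)"
        by (simp add: geometric_sum_noncomm of_cx_mult_power[of _ _ N] wN of_cx_simps)
      then show ?thesis using R[OF that] by (simp add: mult.assoc)
    qed
    then have "(1 - x ^ N) * (\<Sum>j<N. R j) = real N *\<^sub>R 1"
      by (simp add: sum_distrib_left s)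
    then show ?thesis using assms(1) by simp
  qed
  show "PROP ?B"
  proof -
    assume R: "\<And>j. j < N \<Longrightarrow> R j * (1 - of_cx (w j) * x) = 1"
    have "R j * (1 - x ^ N) = (\<Sum>i<N. (of_cx (w j) * x) ^ i)" if "j < N" for j
    proof -
      have "(1 - x ^ N) = (1 - of_cx (w j) * x) * (\<Sum>i<N. (of_cx (w j) * x) ^ i)"
        by (simp add: geometric_sum_noncomm of_cx_mult_power[of _ _ N] wN of_cx_simps)
      then show ?thesis using R[OF that] by (simp add: mult.assoc[symmetric])
    qed
    then have "(\<Sum>j<N. R j) * (1 - x ^ N) = real N *\<^sub>R 1"
      by (simp add: sum_distrib_right s)
    then show ?thesis using assms(1) by simp
  qed
qed

text \<open>Rickart's averaging argument: the averages of the resolvent over the N-th roots of 1 and of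
  -1 are \<open>(1 - x\<^sup>N)\<^sup>-\<^sup>1\<close> and \<open>(1 + x\<^sup>N)\<^sup>-\<^sup>1\<close>, and they are close to each other for
  large N; hence the norm of \<open>x\<^sup>N\<close> is never exactly 1/4.\<close>

lemma power_norm_gap:
  fixes x :: "'a::real_normed_algebra_1 complexification"
  assumes N: "N > 0" and inv: "\<And>u. cmod u = 1 \<Longrightarrow> invertible_elem (1 - of_cx u * x)"
    and C: "\<And>u y. cmod u = 1 \<Longrightarrow> y * (1 - of_cx u * x) = 1 \<Longrightarrow> norm y \<le> C"
    and X: "norm x \<le> X" and big: "8 * pi * C\<^sup>2 * X \<le> real N"
  shows "norm (x ^ N) \<noteq> 1 / 4"
proof
  assume y: "norm (x ^ N) = 1 / 4"
  define w where "w = (\<lambda>j::nat. exp (2 * of_real pi * \<i> * of_nat j / of_nat N) :: complex)"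
  define e where "e = exp (\<i> * of_real (pi / real N))"
  define R where "R u = (SOME y. y * (1 - of_cx u * x) = 1 \<and> (1 - of_cx u * x) * y = 1)" for u
  have R: "R u * (1 - of_cx u * x) = 1" "(1 - of_cx u * x) * R u = 1" if "cmod u = 1" for u
  proof -
    have "\<exists>y. y * (1 - of_cx u * x) = 1 \<and> (1 - of_cx u * x) * y = 1"
      using inv[OF that] by (auto simp: invertible_elem_def)
    from someI_ex[OF this] show "R u * (1 - of_cx u * x) = 1" "(1 - of_cx u * x) * R u = 1"
      unfolding R_def by auto
  qed
  have nw: "cmod (w j) = 1" for j
    by (simp add: w_def norm_exp_eq_Re)
  have ne: "cmod e = 1" by (simp add: e_def)
  have eN: "e ^ N = -1"
  proof -
    have e: "e = cis (pi / real N)" unfolding e_def by (rule cis_conv_exp[symmetric])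
    have pi: "real N * (pi / real N) = pi" using N by simp
    show ?thesis unfolding e Complex.DeMoivre pi by (rule cis_pi)
  qed
  have e1: "cmod (1 - e) \<le> pi / N"
  proof -
    have "cmod (1 - e) = 2 * \<bar>sin (pi / real N / 2)\<bar>"
      unfolding e_def by (subst norm_minus_commute) (rule dist_exp_i_1)
    also have "\<dots> \<le> 2 * \<bar>pi / real N / 2\<bar>"
      by (intro mult_left_mono abs_sin_x_le_abs_x) auto
    finally show ?thesis by simp
  qed
  define a where "a = (1 / real N) *\<^sub>R (\<Sum>j<N. R (w j))"
  define b where "b = (1 / real N) *\<^sub>R (\<Sum>j<N. R (w j * e))"
  have a: "(1 - x ^ N) * a = 1"
    unfolding a_def using R[OF nw] by (intro resolvent_average(1)) (auto simp: w_def N)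
  have "b * (1 - (of_cx e * x) ^ N) = 1"
    unfolding b_def
  proof (intro resolvent_average(2) N)
    fix j
    have "R (w j * e) * (1 - of_cx (w j * e) * x) = 1"
      by (rule R) (simp add: norm_mult nw ne)
    then show "R (w j * e) * (1 - of_cx (exp (2 * of_real pi * \<i> * of_nat j / of_nat N)) * (of_cx e * x)) = 1"
      by (simp add: w_def of_cx_simps mult.assoc)
  qed
  then have b: "b * (1 + x ^ N) = 1"
    by (simp add: of_cx_mult_power eN of_cx_simps)
  have "norm (R 1) \<le> C" by (rule C[of 1]) (simp_all add: R)
  then have C0: "0 \<le> C" using norm_ge_zero order_trans by blast
  \<comment> \<open>The resolvent identity. The factor 2 is the loss in
    \<open>norm_of_cx_le\<close>; the constant 8 pi in the hypothesis makes the average of these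
    bounds at most 1/4.\<close>
  have d: "norm (R (w j) - R (w j * e)) \<le> C\<^sup>2 * (2 * (pi / N)) * X" for j
  proof -
    have n: "cmod (w j) = 1" "cmod (w j * e) = 1" by (simp_all add: nw ne norm_mult)
    have "R (w j) - R (w j * e)
        = R (w j) * (of_cx (w j - w j * e) * x) * R (w j * e)"
    proof -
      have "of_cx (w j - w j * e) * x = (1 - of_cx (w j * e) * x) - (1 - of_cx (w j) * x)"
        by (simp add: of_cx_simps algebra_simps)
      then have "R (w j) * (of_cx (w j - w j * e) * x) * R (w j * e)
         = R (w j) * ((1 - of_cx (w j * e) * x) * R (w j * e))
           - R (w j) * (1 - of_cx (w j) * x) * R (w j * e)"
        by (simp add: left_diff_distrib right_diff_distrib mult.assoc)
      then show ?thesis using R[OF n(1)] R[OF n(2)] by simp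
    qed
    also have "norm \<dots> \<le> norm (R (w j)) * (norm (of_cx (w j - w j * e) :: 'a complexification) * norm x) * norm (R (w j * e))"
      by (intro order_trans[OF norm_mult_ineq] mult_mono norm_mult_ineq mult_nonneg_nonneg) auto
    also have "\<dots> \<le> C * ((2 * (pi / N)) * X) * C"
    proof (intro mult_mono X mult_nonneg_nonneg C0)
      show "norm (R (w j)) \<le> C" "norm (R (w j * e)) \<le> C"
        by (rule C[OF n(1) R(1)[OF n(1)]], rule C[OF n(2) R(1)[OF n(2)]])
      have "cmod (w j - w j * e) = cmod (1 - e)"
        using norm_mult[of "w j" "1 - e"] by (simp add: nw right_diff_distrib)
      then show "norm (of_cx (w j - w j * e) :: 'a complexification) \<le> 2 * (pi / N)"
        using norm_of_cx_le[of "w j - w j * e", where 'a='a] e1 by simp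
      show "0 \<le> X" using X norm_ge_zero order_trans by blast
    qed simp_all
    finally show ?thesis by (simp add: power2_eq_square algebra_simps)
  qed
  have "norm (a - b) = norm (\<Sum>j<N. R (w j) - R (w j * e)) / N"
    unfolding a_def b_def scaleR_diff_right[symmetric] sum_subtractf[symmetric] by simp
  also have "\<dots> \<le> (\<Sum>j<N. norm (R (w j) - R (w j * e))) / N"
    by (intro divide_right_mono norm_sum) auto
  also have "\<dots> \<le> (\<Sum>j<N. C\<^sup>2 * (2 * (pi / N)) * X) / N"
    by (intro divide_right_mono sum_mono d) auto
  also have "\<dots> = C\<^sup>2 * (2 * (pi / N)) * X" using N by simp
  also have "\<dots> \<le> 1 / 4"
    using big N by (simp add: field_simps)
  finally have ab: "norm (a - b) \<le> 1 / 4" .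
  \<comment> \<open>The right inverse a and the left inverse b stand on the sides where they cancel.
    If \<open>x ^ N\<close> had norm 1/4, the left side would have norm 1/2 and the right side at
    most 25/64.\<close>
  have "2 *\<^sub>R (x ^ N) = (1 + x ^ N) - (1 - x ^ N)" by (simp add: scaleR_2)
  also have "\<dots> = ((1 - x ^ N) * a) * (1 + x ^ N) - (1 - x ^ N) * (b * (1 + x ^ N))"
    by (simp add: a b)
  also have "\<dots> = (1 - x ^ N) * (a - b) * (1 + x ^ N)"
    by (simp add: left_diff_distrib right_diff_distrib mult.assoc)
  finally have eq: "2 *\<^sub>R (x ^ N) = (1 - x ^ N) * (a - b) * (1 + x ^ N)" .
  have "2 * norm (x ^ N) = norm (2 *\<^sub>R (x ^ N))" by simp
  also have "\<dots> \<le> norm ((1 - x ^ N) * (a - b)) * norm (1 + x ^ N)"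
    unfolding eq by (rule norm_mult_ineq)
  also have "\<dots> \<le> (norm (1 - x ^ N) * norm (a - b)) * norm (1 + x ^ N)"
    by (intro mult_right_mono norm_mult_ineq norm_ge_zero)
  also have "\<dots> \<le> (5/4) * (1/4) * (5/4)"
    using norm_triangle_ineq4[of 1 "x ^ N"] norm_triangle_ineq[of 1 "x ^ N"] y ab
    by (intro mult_mono) auto
  finally show False using y by simp
qed

text \<open>After division by \<rho>, compactness allows one N for the whole path. The norm of
  \<open>x t ^ N\<close> is continuous, starts at 0 and avoids 1/4, so it ends below 1/4. Then
  \<open>1 - (u x) ^ N\<close> is invertible whenever \<open>cmod u \<le> 1\<close>, and so is its
  factor \<open>1 - u x\<close>.\<close>

lemma spectrum_disc_along_path:
  fixes y :: "real \<Rightarrow> 'a::{real_normed_algebra_1,banach} complexification"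
  assumes cont: "continuous_on {0..1} y" and y0: "y 0 = 0" and rho: "\<rho> > 0"
    and inv: "\<And>t \<zeta>. t \<in> {0..1} \<Longrightarrow> cmod \<zeta> = \<rho> \<Longrightarrow> invertible_elem (y t - of_cx \<zeta>)"
    and z: "cmod \<zeta> \<ge> \<rho>"
  shows "invertible_elem (y 1 - of_cx \<zeta>)"
proof -
  define x where "x t = of_cx (of_real (1 / \<rho>)) * y t" for t
  have invx: "invertible_elem (1 - of_cx u * x t)" if "t \<in> {0..1}" "cmod u = 1" for t u
  proof -
    have u: "u \<noteq> 0" using that by auto
    have "- u / of_real \<rho> * (of_real \<rho> / u) = -1" using rho u by simp
    then have "1 - of_cx u * x t = of_cx (- u / of_real \<rho>) * (y t - of_cx (of_real \<rho> / u))"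
      unfolding right_diff_distrib of_cx_simps(5)[symmetric]
      by (simp add: x_def of_cx_simps(5)[symmetric] of_cx_simps(6,2) mult.assoc[symmetric])
    moreover have "invertible_elem (y t - of_cx (of_real \<rho> / u))"
      using that rho by (intro inv) (auto simp: norm_divide)
    ultimately show ?thesis
      using u rho by (simp add: invertible_of_cx_mult_iff)
  qed
  have contx: "continuous_on {0..1} x"
    unfolding x_def by (intro continuous_intros cont)
  define S where "S = (\<lambda>(t, u). 1 - of_cx u * x t) ` ({0..1} \<times> sphere 0 1)"
  have "compact S"
    unfolding S_def case_prod_beta
    by (intro compact_continuous_image compact_Times continuous_intros
        continuous_on_compose2[OF contx] bounded_linear.continuous_on[OF bounded_linear_of_cx]) auto
  moreover have "invertible_elem s" if "s \<in> S" for s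
    using that invx by (auto simp: S_def)
  ultimately obtain C where C: "C > 0" "\<And>s y. s \<in> S \<Longrightarrow> y * s = 1 \<Longrightarrow> norm y \<le> C"
    using norm_inverse_bound_compact by blast
  have "bounded (x ` {0..1})"
    by (intro compact_imp_bounded compact_continuous_image contx) auto
  then obtain X where "\<forall>s\<in>x ` {0..1}. norm s \<le> X"
    unfolding bounded_iff by blast
  then have X: "\<And>t. t \<in> {0..1} \<Longrightarrow> norm (x t) \<le> X" by blast
  \<comment> \<open>C and X bound the inverses and the norms for all t at once, so N does not depend
    on t.\<close>
  obtain N where N: "real N > max (8 * pi * C\<^sup>2 * X) 0"
    using reals_Archimedean2 by blast
  have N0: "N > 0" using N by simp
  have gap: "norm (x t ^ N) \<noteq> 1 / 4" if t: "t \<in> {0..1}" for t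
  proof (rule power_norm_gap[OF N0 invx[OF t] _ X[OF t]])
    show "norm y \<le> C" if "cmod u = 1" "y * (1 - of_cx u * x t) = 1" for u y
    proof (rule C(2))
      show "1 - of_cx u * x t \<in> S"
        unfolding S_def using t that(1) by (intro image_eqI[of _ _ "(t, u)"]) auto
    qed (rule that(2))
  qed (use N in auto)
  have small: "norm (x 1 ^ N) < 1 / 4"
  proof (rule ccontr)
    assume "\<not> norm (x 1 ^ N) < 1 / 4"
    moreover have "x 0 ^ N = 0" using N0 by (simp add: x_def y0 power_0_left)
    moreover have "continuous_on {0..1} (\<lambda>t. norm (x t ^ N))"
      by (intro continuous_intros contx)
    ultimately have "\<exists>t\<ge>0. t \<le> 1 \<and> norm (x t ^ N) = 1 / 4"
      using IVT'[of "\<lambda>t. norm (x t ^ N)" 0 "1/4" 1] by simp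
    then show False using gap by auto
  qed
  have z0: "\<zeta> \<noteq> 0" using z rho by auto
  define u where "u = of_real \<rho> / \<zeta>"
  have u1: "cmod u \<le> 1" using z rho z0 by (simp add: u_def norm_divide)
  \<comment> \<open>A scalar of modulus at most 1 may double this norm; twice 1/4 is still below
    1.\<close>
  have "norm ((of_cx u * x 1) ^ N) \<le> norm (of_cx (u ^ N) :: 'a complexification) * norm (x 1 ^ N)"
    unfolding of_cx_mult_power by (rule norm_mult_ineq)
  also have "\<dots> \<le> 2 * (1/4)"
  proof (intro mult_mono)
    have "cmod (u ^ N) \<le> 1" using u1 by (simp add: norm_power power_le_one)
    then show "norm (of_cx (u ^ N) :: 'a complexification) \<le> 2"
      using norm_of_cx_le[of "u ^ N", where 'a='a] by linarith
  qed (use small in auto)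
  finally have "invertible_elem (1 - (of_cx u * x 1) ^ N)"
    by (intro invertible_one_minus) simp
  then have i: "invertible_elem (1 - of_cx u * x 1)"
    by (intro invertible_elem_mult_commuting[of "1 - of_cx u * x 1" "\<Sum>i<N. (of_cx u * x 1) ^ i"])
      (simp_all add: geometric_sum_noncomm)
  have "- \<zeta> * (u * (1 / of_real \<rho>)) = -1" using rho z0 by (simp add: u_def)
  then have "y 1 - of_cx \<zeta> = of_cx (- \<zeta>) * (1 - of_cx u * x 1)"
  proof -
    have "of_cx (- \<zeta>) * (1 - of_cx u * x 1) = of_cx (- \<zeta>) - of_cx (- \<zeta> * (u * (1 / of_real \<rho>))) * y 1"
      by (simp only: right_diff_distrib x_def mult_1_right of_cx_simps(5) mult.assoc of_real_1 of_real_divide)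
    then show ?thesis unfolding \<open>- \<zeta> * (u * (1 / of_real \<rho>)) = -1\<close> by (simp add: of_cx_simps)
  qed
  then show ?thesis
    using i z0 by (simp add: invertible_of_cx_mult_iff)
qed

text \<open>The power series of \<open>exp x - 1\<close> splits off the factor x, with a cofactor
  that commutes with it.\<close>

lemma invertible_elem_of_exp:
  fixes x :: "'a::{real_normed_algebra_1,banach}"
  assumes "invertible_elem (exp x - 1)"
  shows "invertible_elem x"
proof -
  let ?g = "\<lambda>n. inverse (fact (Suc n)) *\<^sub>R x ^ n"
  have s: "summable ?g"
  proof (rule summable_comparison_test'[OF summable_norm_exp[of x], of 0])
    fix n
    show "norm (?g n) \<le> norm (inverse (fact n) *\<^sub>R x ^ n)"
      unfolding norm_scaleR
      by (intro mult_right_mono) (auto simp del: fact_Suc intro!: le_imp_inverse_le fact_mono)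
  qed
  have "(\<lambda>n. inverse (fact (Suc n)) *\<^sub>R x ^ Suc n) sums (exp x - 1)"
    using exp_converges[of x] by (subst sums_Suc_iff) simp
  moreover have "(\<lambda>n. inverse (fact (Suc n)) *\<^sub>R x ^ Suc n) = (\<lambda>n. x * ?g n)" by auto
  moreover have "(\<lambda>n. inverse (fact (Suc n)) *\<^sub>R x ^ Suc n) = (\<lambda>n. ?g n * x)"
    by (auto simp: power_commutes)
  ultimately have "(\<lambda>n. x * ?g n) sums (exp x - 1)" "(\<lambda>n. ?g n * x) sums (exp x - 1)"
    by simp_all
  then have "exp x - 1 = x * suminf ?g" "exp x - 1 = suminf ?g * x"
    using sums_mult[OF summable_sums[OF s], of x] sums_mult2[OF summable_sums[OF s], of x]
    by (auto intro: sums_unique2)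
  then show ?thesis using assms
    by (intro invertible_elem_mult_commuting[of x "suminf ?g"]) auto
qed

text \<open>\<open>exp (L - \<zeta>) - 1\<close> is a nonzero scalar multiple of
  \<open>A - exp \<zeta>\<close>, and it has \<open>L - \<zeta>\<close> as a factor. This is the
  half of the spectral mapping theorem for exp that confines the spectrum of a logarithm.\<close>

lemma invertible_log_shift:
  fixes L A :: "'a::{real_normed_algebra_1,banach}"
  assumes "exp L = A" "invertible_elem (of_re A - of_cx (exp \<zeta>))"
  shows "invertible_elem (of_re L - of_cx \<zeta>)"
proof (rule invertible_elem_of_exp)
  have "exp (of_re L - of_cx \<zeta>) = exp (of_re L + of_cx (- \<zeta>))"
    by (simp add: of_cx_simps)
  also have "\<dots> = exp (of_re L) * exp (of_cx (- \<zeta>))"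
    by (rule exp_add_commuting[OF of_cx_commute])
  also have "\<dots> = of_cx (exp (- \<zeta>)) * of_re A"
    by (simp only: of_re_exp[symmetric] of_cx_exp[symmetric] assms(1) of_cx_commute[of "of_re A"])
  finally have "exp (of_re L - of_cx \<zeta>) - 1 = of_cx (exp (- \<zeta>)) * of_re A - of_cx (exp (- \<zeta>) * exp \<zeta>)"
    by (simp only: exp_minus of_cx_simps(2) left_inverse[OF exp_not_eq_zero])
  also have "\<dots> = of_cx (exp (- \<zeta>)) * (of_re A - of_cx (exp \<zeta>))"
    by (simp only: of_cx_simps(5) right_diff_distrib)
  finally have eq: "exp (of_re L - of_cx \<zeta>) - 1 = of_cx (exp (- \<zeta>)) * (of_re A - of_cx (exp \<zeta>))" .
  show "invertible_elem (exp (of_re L - of_cx \<zeta>) - 1)"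
    unfolding eq by (rule invertible_of_cx_mult_iff[THEN iffD2, OF exp_not_eq_zero assms(2)])
qed

subsection \<open>The logarithm integral\<close>

lemma norm_exp_minus_one_minus_le:
  fixes x :: "'a::{real_normed_algebra_1,banach}"
  assumes "norm x \<le> 1"
  shows "norm (exp x - 1 - x) \<le> (norm x)\<^sup>2"
proof -
  let ?f = "\<lambda>n. inverse (fact (n + 2)) *\<^sub>R norm x ^ (n + 2)"
  have s: "summable ?f"
    using summable_exp_generic[of "norm x"] by (subst summable_iff_shift)
  have "norm (exp x - 1 - x) = norm (\<Sum>n. inverse (fact (n + 2)) *\<^sub>R x ^ (n + 2))"
    by (subst exp_first_two_terms) (simp add: numeral_2_eq_2)
  also have "\<dots> \<le> (\<Sum>n. ?f n)"
    by (rule norm_suminf_le[OF _ s]) (auto simp del: power_Suc intro!: mult_left_mono norm_power_ineq)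
  also have "\<dots> = exp (norm x) - 1 - norm x"
    by (subst exp_first_two_terms) (simp add: numeral_2_eq_2)
  also have "\<dots> \<le> (norm x)\<^sup>2"
    using exp_bound[of "norm x"] assms by simp
  finally show ?thesis .
qed

lemma has_derivative_exp_at_0:
  "((exp :: 'a::{real_normed_algebra_1,banach} \<Rightarrow> 'a) has_derivative (\<lambda>h. h)) (at 0)"
proof (rule has_derivativeI_sandwich[of 1 _ _ _ _ "\<lambda>y. norm y"])
  show "((\<lambda>y::'a. norm y) \<longlongrightarrow> 0) (at 0)"
    by (rule tendsto_eq_intros refl | simp)+
  fix y :: 'a
  assume "y \<noteq> 0" "dist y 0 < 1"
  then show "norm (exp y - exp 0 - (y - 0)) / norm (y - 0) \<le> norm y"
    using norm_exp_minus_one_minus_le[of y] by (simp add: divide_le_eq power2_eq_square)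
qed (auto intro: bounded_linear_ident)

lemma integral_commute:
  fixes f :: "real \<Rightarrow> 'a::{real_normed_algebra_1,banach}"
  assumes "f integrable_on S" "\<And>u. u \<in> S \<Longrightarrow> c * f u = f u * c"
  shows "c * integral S f = integral S f * c"
proof -
  have bl: "bounded_linear (\<lambda>x. c * x - x * c)"
    by (intro bounded_linear_sub bounded_linear_mult_right bounded_linear_mult_left)
  have "integral S ((\<lambda>x. c * x - x * c) \<circ> f) = c * integral S f - integral S f * c"
    by (rule integral_linear[OF assms(1) bl])
  moreover have "integral S ((\<lambda>x. c * x - x * c) \<circ> f) = integral S (\<lambda>_. 0)"
    by (intro integral_cong) (simp add: assms(2))
  ultimately show ?thesis by simp
qed

text \<open>With L s the integral up to s, the product \<open>exp (- L s) * (1 + s P)\<close> has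
  derivative 0, because \<open>f s * (1 + s P) = P\<close> and all the elements involved commute.
  Its value at 0 is 1.\<close>

lemma exp_integral_resolvent:
  fixes P :: "'a::{real_normed_algebra_1,banach}" and R :: "real \<Rightarrow> 'a"
  assumes R: "\<And>u. u \<in> {0..1} \<Longrightarrow> (1 + u *\<^sub>R P) * R u = 1" "\<And>u. u \<in> {0..1} \<Longrightarrow> R u * (1 + u *\<^sub>R P) = 1"
  shows "continuous_on {0..1} R" "exp (integral {0..1} (\<lambda>u. P * R u)) = 1 + P"
proof -
  \<comment> \<open>The resolvent identity; together with the uniform bound C from compactness it
    makes R Lipschitz.\<close>
  have diff: "R u - R v = R u * ((v - u) *\<^sub>R P) * R v" if "u \<in> {0..1}" "v \<in> {0..1}" for u v
  proof -
    have "R u * ((v - u) *\<^sub>R P) * R v = R u * ((1 + v *\<^sub>R P) - (1 + u *\<^sub>R P)) * R v"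
      by (simp add: algebra_simps)
    also have "\<dots> = R u * ((1 + v *\<^sub>R P) * R v) - R u * (1 + u *\<^sub>R P) * R v"
      unfolding left_diff_distrib right_diff_distrib by (simp add: mult.assoc)
    finally show ?thesis using R that by simp
  qed
  define S where "S = (\<lambda>u. 1 + u *\<^sub>R P) ` {0..1::real}"
  have "compact S" unfolding S_def by (intro compact_continuous_image continuous_intros) auto
  moreover have "invertible_elem s" if "s \<in> S" for s
    using that R unfolding S_def invertible_elem_def by blast
  ultimately obtain C where C: "C > 0" "\<And>s y. s \<in> S \<Longrightarrow> y * s = 1 \<Longrightarrow> norm y \<le> C"
    using norm_inverse_bound_compact by blast
  have RC: "norm (R u) \<le> C" if "u \<in> {0..1}" for u
    by (rule C(2)[of "1 + u *\<^sub>R P"]) (use that R(2) in \<open>auto simp: S_def\<close>)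
  show contR: "continuous_on {0..1} R"
    unfolding continuous_on_def
  proof
    fix v :: real assume v: "v \<in> {0..1}"
    have "norm (R u - R v) \<le> C * (\<bar>v - u\<bar> * norm P) * C" if "u \<in> {0..1}" for u
    proof -
      have "norm (R u - R v) \<le> norm (R u) * norm ((v - u) *\<^sub>R P) * norm (R v)"
        unfolding diff[OF that v]
        by (intro order_trans[OF norm_mult_ineq] mult_right_mono norm_mult_ineq) auto
      also have "\<dots> \<le> C * (\<bar>v - u\<bar> * norm P) * C"
        using RC that v C(1) by (intro mult_mono) auto
      finally show ?thesis .
    qed
    then have "\<forall>\<^sub>F u in at v within {0..1}. norm (R u - R v) \<le> C * (\<bar>v - u\<bar> * norm P) * C"
      by (auto simp: eventually_at_filter)
    moreover have "((\<lambda>u. C * (\<bar>v - u\<bar> * norm P) * C) \<longlongrightarrow> 0) (at v within {0..1})"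
      by (rule tendsto_eq_intros refl | simp)+
    ultimately have "((\<lambda>u. R u - R v) \<longlongrightarrow> 0) (at v within {0..1})"
      by (rule Lim_null_comparison)
    then show "(R \<longlongrightarrow> R v) (at v within {0..1})" by (rule LIM_zero_cancel)
  qed
  define f where "f u = P * R u" for u
  have contf: "continuous_on {0..1} f" unfolding f_def by (intro continuous_intros contR)
  have PR: "P * R u = R u * P" if "u \<in> {0..1}" for u
  proof -
    have "R u * ((1 + u *\<^sub>R P) * P) * R u = R u * (P * (1 + u *\<^sub>R P)) * R u"
      by (simp add: algebra_simps)
    then have "(R u * (1 + u *\<^sub>R P)) * (P * R u) = (R u * P) * ((1 + u *\<^sub>R P) * R u)"
      by (simp only: mult.assoc)
    then show ?thesis using R that by simp
  qed
  have RR: "R u * R v = R v * R u" if "u \<in> {0..1}" "v \<in> {0..1}" for u v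
  proof -
    have "R v * ((1 + u *\<^sub>R P) * (1 + v *\<^sub>R P)) * R v = R v * ((1 + v *\<^sub>R P) * (1 + u *\<^sub>R P)) * R v"
      by (simp add: algebra_simps)
    then have "R v * (1 + u *\<^sub>R P) * ((1 + v *\<^sub>R P) * R v) = (R v * (1 + v *\<^sub>R P)) * ((1 + u *\<^sub>R P) * R v)"
      by (simp only: mult.assoc)
    then have "R v * (1 + u *\<^sub>R P) = (1 + u *\<^sub>R P) * R v" using R that by simp
    then have "R u * (R v * (1 + u *\<^sub>R P)) * R u = R u * ((1 + u *\<^sub>R P) * R v) * R u" by simp
    then have "R u * R v * ((1 + u *\<^sub>R P) * R u) = (R u * (1 + u *\<^sub>R P)) * (R v * R u)"
      by (simp only: mult.assoc)
    then show ?thesis using R that by simp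
  qed
  have ff: "f u * f v = f v * f u" if "u \<in> {0..1}" "v \<in> {0..1}" for u v
  proof -
    have "f u * f v = P * (R u * P) * R v" by (simp only: f_def mult.assoc)
    also have "\<dots> = P * (P * R u) * R v" by (simp only: PR[OF that(1)])
    also have "\<dots> = P * P * (R u * R v)" by (simp only: mult.assoc)
    also have "\<dots> = P * P * (R v * R u)" by (simp only: RR[OF that])
    also have "\<dots> = P * (P * R v) * R u" by (simp only: mult.assoc)
    also have "\<dots> = P * (R v * P) * R u" by (simp only: PR[OF that(2)])
    also have "\<dots> = f v * f u" by (simp only: f_def mult.assoc)
    finally show ?thesis .
  qed
  define L where "L s = integral {0..s} f" for s
  have intf: "f integrable_on {0..s}" if "s \<in> {0..1}" for s
    using that by (intro integrable_continuous_real continuous_on_subset[OF contf]) auto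
  have fL: "f u * L s = L s * f u" if "u \<in> {0..1}" "s \<in> {0..1}" for u s
    unfolding L_def using that by (intro integral_commute intf ff) auto
  have LL: "L t * L s = L s * L t" if "t \<in> {0..1}" "s \<in> {0..1}" for t s
    unfolding L_def[of s] using that fL[of _ t] by (intro integral_commute intf) auto
  have dL: "(L has_vector_derivative f s) (at s within {0..1})" if "s \<in> {0..1}" for s
    unfolding L_def using integral_has_vector_derivative[OF contf that] .
  define E where "E s = exp (- L s) * (1 + s *\<^sub>R P)" for s
  have dE: "(E has_vector_derivative 0) (at s within {0..1})" if s: "s \<in> {0..1}" for s
  proof -
    \<comment> \<open>In a noncommutative algebra exp has a simple derivative at 0. The exponent is
      therefore shifted to vanish at t = s, and the constant factor \<open>exp (- L s)\<close> is
      restored afterwards, L s and L t being commuting.\<close>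
    have "((\<lambda>t. L s - L t) has_vector_derivative (0 - f s)) (at s within {0..1})"
      by (intro derivative_intros dL s)
    then have d: "((\<lambda>t. L s - L t) has_derivative (\<lambda>h. h *\<^sub>R (0 - f s))) (at s within {0..1})"
      by (simp only: has_vector_derivative_def)
    have "(exp has_derivative (\<lambda>h. h)) (at (L s - L s) within (\<lambda>t. L s - L t) ` {0..1})"
      using has_derivative_exp_at_0 has_derivative_at_withinI by simp
    from diff_chain_within[OF d this]
    have "((\<lambda>t. exp (L s - L t)) has_vector_derivative (- f s)) (at s within {0..1})"
      by (simp add: has_vector_derivative_def o_def)
    moreover have "((\<lambda>t. 1 + t *\<^sub>R P) has_vector_derivative P) (at s within {0..1})"
      by (auto intro!: derivative_eq_intros)
    ultimately have "((\<lambda>t. exp (L s - L t) * (1 + t *\<^sub>R P)) has_vector_derivative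
        (exp (L s - L s) * P + (- f s) * (1 + s *\<^sub>R P))) (at s within {0..1})"
      by (rule has_vector_derivative_mult)
    moreover have "f s * (1 + s *\<^sub>R P) = P"
      using R(2)[OF s] by (simp add: f_def mult.assoc)
    ultimately have "((\<lambda>t. exp (L s - L t) * (1 + t *\<^sub>R P)) has_vector_derivative 0) (at s within {0..1})"
      by simp
    then have "((\<lambda>t. exp (- L s) * (exp (L s - L t) * (1 + t *\<^sub>R P))) has_vector_derivative (exp (- L s) * 0))
        (at s within {0..1})"
      by (intro derivative_intros)
    moreover have "exp (- L s) * (exp (L s - L t) * (1 + t *\<^sub>R P)) = E t" if t: "t \<in> {0..1}" for t
    proof -
      have "- L s * (L s - L t) = (L s - L t) * - L s"
        using LL[OF s t] by (simp add: algebra_simps)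
      then have "exp (- L s) * exp (L s - L t) = exp (- L t)"
        by (simp add: exp_add_commuting[symmetric])
      then show ?thesis by (simp add: E_def mult.assoc[symmetric])
    qed
    ultimately show ?thesis
      using has_vector_derivative_transform[OF s, of E "\<lambda>t. exp (- L s) * (exp (L s - L t) * (1 + t *\<^sub>R P))" 0]
      by simp
  qed
  have "E 1 = E 0"
  proof -
    obtain c where "\<And>s. s \<in> {0..1} \<Longrightarrow> E s = c"
      using has_vector_derivative_zero_constant[OF _ dE] by auto
    then show ?thesis by simp
  qed
  then have "exp (- L 1) * (1 + P) = 1" by (simp add: E_def L_def)
  then have "exp (L 1) * exp (- L 1) * (1 + P) = exp (L 1)" by (simp add: mult.assoc)
  then show "exp (integral {0..1} (\<lambda>u. P * R u)) = 1 + P"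
    by (simp add: exp_minus_inverse L_def f_def[abs_def])
qed



subsection \<open>A lower bound for the kernel eigenvalue on a circle\<close>

text \<open>The product formula of the sine at the imaginary point i x; taking imaginary parts
  removes the factor i.\<close>

lemma sinh_product_formula_real:
  "(\<lambda>n. pi * x * (\<Prod>k=1..n. 1 + x\<^sup>2 / (real k)\<^sup>2)) \<longlonglongrightarrow> sinh (pi * x)"
proof -
  have "(\<Prod>k=1..n. 1 - (\<i> * of_real x)\<^sup>2 / (of_nat k)\<^sup>2) = complex_of_real (\<Prod>k=1..n. 1 + x\<^sup>2 / (real k)\<^sup>2)" for n
    by (simp add: power_mult_distrib)
  moreover have "sin (of_real pi * (\<i> * of_real x)) = \<i> * complex_of_real (sinh (pi * x))"
    by (rule complex_eqI) (simp_all add: Re_sin Im_sin sinh_def)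
  ultimately have "(\<lambda>n. of_real pi * (\<i> * of_real x) * complex_of_real (\<Prod>k=1..n. 1 + x\<^sup>2 / (real k)\<^sup>2))
      \<longlonglongrightarrow> \<i> * complex_of_real (sinh (pi * x))"
    using sin_product_formula_complex[of "\<i> * of_real x"] by simp
  then have "(\<lambda>n. \<i> * complex_of_real (pi * x * (\<Prod>k=1..n. 1 + x\<^sup>2 / (real k)\<^sup>2)))
      \<longlonglongrightarrow> \<i> * complex_of_real (sinh (pi * x))"
    by (simp only: of_real_mult mult_ac)
  from tendsto_Im[OF this] show ?thesis by (simp only: Im_i_times Re_complex_of_real)
qed

text \<open>Holds factor by factor in the infinite products: for \<open>q = 1 / k^2\<close> one has
  \<open>(1 - p^2 q)(1 + x^2 q) = 1 - y^2 q - p^2 x^2 q^2\<close>. The condition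
  \<open>p \<le> 1\<close> keeps the factors nonnegative.\<close>

lemma sin_sinh_product_le:
  assumes "x \<ge> 0" "y \<ge> 0" "p \<ge> 0" "p\<^sup>2 = x\<^sup>2 + y\<^sup>2" "p \<le> 1"
  shows "y * sin (pi * p) * sinh (pi * x) \<le> pi * x * p * sin (pi * y)"
proof (rule LIMSEQ_le)
  show "(\<lambda>n. y * (pi * p * (\<Prod>k=1..n. 1 - p\<^sup>2 / (real k)\<^sup>2)) * (pi * x * (\<Prod>k=1..n. 1 + x\<^sup>2 / (real k)\<^sup>2)))
      \<longlonglongrightarrow> y * sin (pi * p) * sinh (pi * x)"
    by (intro tendsto_intros sinh_product_formula_real sin_product_formula_real)
  show "(\<lambda>n. pi * x * p * (pi * y * (\<Prod>k=1..n. 1 - y\<^sup>2 / (real k)\<^sup>2)))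
      \<longlonglongrightarrow> pi * x * p * sin (pi * y)"
    by (intro tendsto_intros sin_product_formula_real)
  have "(\<Prod>k=1..n. 1 - p\<^sup>2 / (real k)\<^sup>2) * (\<Prod>k=1..n. 1 + x\<^sup>2 / (real k)\<^sup>2) \<le> (\<Prod>k=1..n. 1 - y\<^sup>2 / (real k)\<^sup>2)" for n
    unfolding prod.distrib[symmetric]
  proof (intro prod_mono conjI)
    fix k assume k: "k \<in> {1..n}"
    define q where "q = 1 / (real k)\<^sup>2"
    have q: "0 \<le> q" "q \<le> 1" using k by (auto simp: q_def)
    have "p\<^sup>2 \<le> 1" using assms(3,5) by (rule power_le_one)
    then have "p\<^sup>2 * q \<le> 1" using q by (metis mult_le_one zero_le_power2)
    then show "0 \<le> (1 - p\<^sup>2 / (real k)\<^sup>2) * (1 + x\<^sup>2 / (real k)\<^sup>2)"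
      by (intro mult_nonneg_nonneg) (auto simp: q_def)
    have "(1 - p\<^sup>2 * q) * (1 + x\<^sup>2 * q) = 1 - y\<^sup>2 * q - p\<^sup>2 * x\<^sup>2 * q\<^sup>2"
      using assms(4) by (simp add: power2_eq_square algebra_simps)
    also have "\<dots> \<le> 1 - y\<^sup>2 * q" by simp
    finally show "(1 - p\<^sup>2 / (real k)\<^sup>2) * (1 + x\<^sup>2 / (real k)\<^sup>2) \<le> 1 - y\<^sup>2 / (real k)\<^sup>2"
      by (simp add: q_def)
  qed
  then have "(pi * y * p * pi * x) * ((\<Prod>k=1..n. 1 - p\<^sup>2 / (real k)\<^sup>2) * (\<Prod>k=1..n. 1 + x\<^sup>2 / (real k)\<^sup>2))
      \<le> (pi * y * p * pi * x) * (\<Prod>k=1..n. 1 - y\<^sup>2 / (real k)\<^sup>2)" for n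
    using assms by (intro mult_left_mono) auto
  then show "\<exists>N. \<forall>n\<ge>N. y * (pi * p * (\<Prod>k=1..n. 1 - p\<^sup>2 / (real k)\<^sup>2)) * (pi * x * (\<Prod>k=1..n. 1 + x\<^sup>2 / (real k)\<^sup>2))
      \<le> pi * x * p * (pi * y * (\<Prod>k=1..n. 1 - y\<^sup>2 / (real k)\<^sup>2))"
    by (simp add: mult_ac)
qed

text \<open>With p the square root, write the left side as
  \<open>(\<alpha>^2 + \<beta>^2) (sin p)^2 / p^2\<close>. The first summand is at most
  \<open>\<alpha>^2\<close> since \<open>sin p\<close> is bounded by p; the second is controlled by
  the product inequality, rescaled by pi.\<close>

lemma sin_squared_le:
  assumes "\<alpha> \<noteq> 0" "sqrt (\<alpha>\<^sup>2 + \<beta>\<^sup>2) \<le> pi"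
  shows "(sin (sqrt (\<alpha>\<^sup>2 + \<beta>\<^sup>2)))\<^sup>2 \<le> \<alpha>\<^sup>2 * (1 + (sin \<beta>)\<^sup>2 / (sinh \<alpha>)\<^sup>2)"
proof -
  define a b p where "a = \<bar>\<alpha>\<bar>" and "b = \<bar>\<beta>\<bar>" and "p = sqrt (\<alpha>\<^sup>2 + \<beta>\<^sup>2)"
  have p2: "p\<^sup>2 = a\<^sup>2 + b\<^sup>2" and p0: "p > 0" and a: "a > 0" and b: "b \<ge> 0"
    using assms by (auto simp: p_def a_def b_def sum_power2_gt_zero_iff)
  have "b / pi * sin (pi * (p / pi)) * sinh (pi * (a / pi)) \<le> pi * (a / pi) * (p / pi) * sin (pi * (b / pi))"
    using assms p0 a b p2
    by (intro sin_sinh_product_le) (auto simp: power_divide p_def[symmetric] add_divide_distrib[symmetric])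
  then have "b * sin p * sinh a \<le> a * p * sin b" by (simp add: field_simps)
  moreover have sa: "sinh a > 0" using a by simp
  ultimately have "b * sin p / p \<le> a * sin b / sinh a" using p0 by (simp add: field_simps)
  moreover have "0 \<le> b * sin p / p"
    using assms p0 b by (auto simp: p_def[symmetric] intro!: divide_nonneg_pos mult_nonneg_nonneg sin_ge_zero)
  ultimately have "(b * sin p / p)\<^sup>2 \<le> (a * sin b / sinh a)\<^sup>2" by (rule power_mono)
  then have 1: "b\<^sup>2 * (sin p)\<^sup>2 / p\<^sup>2 \<le> a\<^sup>2 * ((sin b)\<^sup>2 / (sinh a)\<^sup>2)"
    by (simp add: power_divide power_mult_distrib)
  have "\<bar>sin p\<bar> \<le> p" using abs_sin_x_le_abs_x[of p] p0 by simp
  then have "(sin p)\<^sup>2 \<le> p\<^sup>2" by (metis abs_ge_zero power2_abs power_mono)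
  then have "(sin p)\<^sup>2 / p\<^sup>2 \<le> 1" using p0 by simp
  then have "a\<^sup>2 * ((sin p)\<^sup>2 / p\<^sup>2) \<le> a\<^sup>2 * 1" by (intro mult_left_mono) auto
  then have "(a\<^sup>2 + b\<^sup>2) * ((sin p)\<^sup>2 / p\<^sup>2) \<le> a\<^sup>2 * (1 + (sin b)\<^sup>2 / (sinh a)\<^sup>2)"
    using add_mono[OF _ 1, of "a\<^sup>2 * ((sin p)\<^sup>2 / p\<^sup>2)" "a\<^sup>2"] by (simp add: distrib_right distrib_left)
      (simp add: add_divide_distrib)
  moreover have "(a\<^sup>2 + b\<^sup>2) * ((sin p)\<^sup>2 / p\<^sup>2) = (sin p)\<^sup>2"
    using p0 by (simp add: p2[symmetric])
  moreover have "(sin b)\<^sup>2 = (sin \<beta>)\<^sup>2" "(sinh a)\<^sup>2 = (sinh \<alpha>)\<^sup>2" "a\<^sup>2 = \<alpha>\<^sup>2"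
    by (auto simp: a_def b_def abs_if)
  ultimately show ?thesis by (simp add: p_def)
qed

lemma cmod_exp_minus_one_squared:
  "(cmod (exp \<zeta> - 1))\<^sup>2 = (exp (Re \<zeta>) - 1)\<^sup>2 + 4 * exp (Re \<zeta>) * (sin (Im \<zeta> / 2))\<^sup>2"
proof -
  have c: "cos (Im \<zeta>) = 1 - 2 * (sin (Im \<zeta> / 2))\<^sup>2"
    using cos_double_sin[of "Im \<zeta> / 2"] by simp
  have expand: "(e * c - 1)\<^sup>2 + (e * s)\<^sup>2 = e\<^sup>2 * (s\<^sup>2 + c\<^sup>2) - 2 * e * c + 1" for e c s :: real
    by (simp add: power2_eq_square algebra_simps)
  have "(cmod (exp \<zeta> - 1))\<^sup>2 = (exp (Re \<zeta>) * cos (Im \<zeta>) - 1)\<^sup>2 + (exp (Re \<zeta>) * sin (Im \<zeta>))\<^sup>2"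
    by (simp add: cmod_power2 Re_exp Im_exp)
  also have "\<dots> = (exp (Re \<zeta>))\<^sup>2 - 2 * exp (Re \<zeta>) * cos (Im \<zeta>) + 1"
    unfolding expand by simp
  also have "\<dots> = (exp (Re \<zeta>) - 1)\<^sup>2 + 4 * exp (Re \<zeta>) * (sin (Im \<zeta> / 2))\<^sup>2"
    unfolding c by (simp add: power2_eq_square algebra_simps)
  finally show ?thesis .
qed

text \<open>The right side is the reciprocal of the kernel eigenvalue per unit of mass at
  \<open>exp \<zeta> / (exp \<zeta> - 1)\<close>. The inequality is \<open>sin_squared_le\<close> at
  the half argument, using \<open>(sinh (a/2))^2 = (exp a - 1)^2 / (4 exp a)\<close>.\<close>

lemma two_sin_le:
  assumes "Re \<zeta> \<noteq> 0" "cmod \<zeta> \<le> pi"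
  shows "2 * sin (cmod \<zeta> / 2) \<le> Re \<zeta> * cmod (exp \<zeta> - 1) / (exp (Re \<zeta>) - 1)"
proof (rule power2_le_imp_le)
  define a b where "a = Re \<zeta>" and "b = Im \<zeta>"
  have e: "exp a - 1 \<noteq> 0" using assms by (simp add: a_def)
  show "0 \<le> Re \<zeta> * cmod (exp \<zeta> - 1) / (exp (Re \<zeta>) - 1)"
    using assms(1) by (cases "Re \<zeta> > 0") (auto simp: zero_le_divide_iff intro: mult_nonpos_nonneg)
  have "(exp (a / 2) * (2 * sinh (a / 2))) = exp a - 1"
    by (simp add: sinh_def right_diff_distrib mult_exp_exp field_simps)
  then have sh: "(sinh (a / 2))\<^sup>2 = (exp a - 1)\<^sup>2 / (4 * exp a)"
  proof -
    have "(exp a - 1)\<^sup>2 = (exp (a / 2))\<^sup>2 * (4 * (sinh (a / 2))\<^sup>2)"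
      unfolding \<open>exp (a / 2) * _ = _\<close>[symmetric] by (simp add: power_mult_distrib)
    also have "(exp (a / 2))\<^sup>2 = exp a" by (simp add: power2_eq_square mult_exp_exp)
    finally show ?thesis by simp
  qed
  have "cmod \<zeta> / 2 = sqrt ((a / 2)\<^sup>2 + (b / 2)\<^sup>2)"
    by (simp add: cmod_def a_def b_def power_divide add_divide_distrib[symmetric] real_sqrt_divide)
  then have "(2 * sin (cmod \<zeta> / 2))\<^sup>2 = 4 * (sin (sqrt ((a / 2)\<^sup>2 + (b / 2)\<^sup>2)))\<^sup>2"
    by (simp add: power_mult_distrib)
  also have "\<dots> \<le> 4 * ((a / 2)\<^sup>2 * (1 + (sin (b / 2))\<^sup>2 / (sinh (a / 2))\<^sup>2))"
  proof -
    have "cmod \<zeta> / 2 \<le> pi" using assms(2) pi_gt_zero norm_ge_zero[of \<zeta>] by linarith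
    then show ?thesis
      using assms(1) \<open>cmod \<zeta> / 2 = _\<close> by (intro mult_left_mono sin_squared_le) (simp_all add: a_def)
  qed
  also have "\<dots> = a\<^sup>2 * ((exp a - 1)\<^sup>2 + 4 * exp a * (sin (b / 2))\<^sup>2) / (exp a - 1)\<^sup>2"
    unfolding sh using e by (simp add: field_simps)
  also have "\<dots> = (Re \<zeta> * cmod (exp \<zeta> - 1) / (exp (Re \<zeta>) - 1))\<^sup>2"
    by (simp add: power_mult_distrib power_divide cmod_exp_minus_one_squared a_def b_def)
  finally show "(2 * sin (cmod \<zeta> / 2))\<^sup>2 \<le> (Re \<zeta> * cmod (exp \<zeta> - 1) / (exp (Re \<zeta>) - 1))\<^sup>2" .
qed



subsection \<open>The resolvent recurrence\<close>

lemma suminf_fps_mult: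
  fixes F G :: "'a::{real_normed_algebra_1,banach} fps"
  assumes "summable (\<lambda>n. norm (fps_nth F n))" "summable (\<lambda>n. norm (fps_nth G n))"
  shows "(\<Sum>n. fps_nth F n) * (\<Sum>n. fps_nth G n) = (\<Sum>n. fps_nth (F * G) n)"
  unfolding Cauchy_product[OF assms] fps_mult_nth atMost_atLeast0 ..

lemma suminf_fps_add:
  fixes F G :: "'a::{real_normed_algebra_1,banach} fps"
  assumes "summable (\<lambda>n. norm (fps_nth F n))" "summable (\<lambda>n. norm (fps_nth G n))"
  shows "(\<Sum>n. fps_nth (F + G) n) = (\<Sum>n. fps_nth F n) + (\<Sum>n. fps_nth G n)"
  using suminf_add[OF summable_norm_cancel[OF assms(1)] summable_norm_cancel[OF assms(2)]] by simp

lemma suminf_fps_one: "(\<Sum>n. fps_nth (1 :: 'a::{real_normed_algebra_1,banach} fps) n) = 1"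
  and summable_fps_one: "summable (\<lambda>n. norm (fps_nth (1 :: 'a::{real_normed_algebra_1,banach} fps) n))"
proof -
  show "(\<Sum>n. fps_nth (1 :: 'a fps) n) = 1"
    by (subst suminf_finite[of "{0}"]) auto
  show "summable (\<lambda>n. norm (fps_nth (1 :: 'a fps) n))"
    by (rule summable_finite[of "{0}"]) auto
qed

text \<open>As formal power series the recurrence reads P G = Q with F = 1 + c P and G = 1 - c Q,
  whence F G = G + c Q = 1. Absolute convergence allows evaluation at 1 through Cauchy
  products.\<close>

lemma resolvent_series:
  fixes p q :: "nat \<Rightarrow> 'a::{real_normed_algebra_1,banach}"
  assumes p0: "p 0 = 0" and comm: "\<And>x. x * c = c * x"
    and rec: "\<And>k. q k = p k - c * (\<Sum>j\<le>k. p j * q (k - j))"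
    and sp: "summable (\<lambda>k. norm (p k))" and sq: "summable (\<lambda>k. norm (q k))"
  shows "(1 + c * (\<Sum>k. p k)) * (1 - c * (\<Sum>k. q k)) = 1"
    and "(1 - c * (\<Sum>k. q k)) * (1 + c * (\<Sum>k. p k)) = 1"
    and "(\<Sum>k. p k) * (1 - c * (\<Sum>k. q k)) = (\<Sum>k. q k)"
proof -
  define P where "P = Abs_fps p"
  define Q where "Q = Abs_fps q"
  define F where "F = 1 + fps_const c * P"
  define G where "G = 1 + fps_const (- c) * Q"
  have PQ: "fps_nth P = p" "fps_nth Q = q" by (simp_all add: P_def Q_def fun_eq_iff)
  have PG: "P * G = Q"
  proof (rule fps_ext)
    fix n
    have "fps_nth (P * G) n = p n + (\<Sum>i=0..n. p i * (- c * q (n - i)))"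
      unfolding G_def distrib_left mult_1_right fps_add_nth fps_mult_nth[of P "fps_const (- c) * Q"]
        fps_mult_left_const_nth by (simp add: P_def Q_def)
    also have "\<dots> = p n - c * (\<Sum>i=0..n. p i * q (n - i))"
      unfolding sum_distrib_left sum_negf[symmetric] diff_conv_add_uminus
      by (intro arg_cong2[where f=plus] sum.cong refl)
        (simp only: mult_minus_left mult_minus_right mult.assoc[symmetric] comm)
    finally show "fps_nth (P * G) n = fps_nth Q n"
      using rec[of n] by (simp add: Q_def atMost_atLeast0)
  qed
  have "F * G = G + fps_const c * (P * G)" by (simp add: F_def distrib_right mult.assoc)
  also have "\<dots> = 1"
    unfolding PG by (rule fps_ext) (simp only: G_def fps_add_nth fps_mult_left_const_nth, simp)
  finally have FG: "F * G = 1" .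
  \<comment> \<open>The constant coefficient 1 provides a formal left inverse of F, so the right
    inverse G is two-sided.\<close>
  have F0: "1 * fps_nth F 0 = 1" by (simp add: F_def P_def p0)
  have "fps_left_inverse F 1 * F = 1" by (rule fps_left_inverse[OF F0])
  then have GF: "G * F = 1"
    using FG by (metis mult.assoc mult_1_left mult_1_right)
  have sP: "summable (\<lambda>n. norm (fps_nth P n))" and sQ: "summable (\<lambda>n. norm (fps_nth Q n))"
    using sp sq by (simp_all add: P_def Q_def)
  have sc: "summable (\<lambda>n. norm (fps_nth (fps_const d * H) n))" if "summable (\<lambda>n. norm (fps_nth H n))" for d and H :: "'a fps"
  proof (rule summable_comparison_test'[OF summable_mult[OF that, of "norm d"], of 0])
    fix n show "norm (norm (fps_nth (fps_const d * H) n)) \<le> norm d * norm (fps_nth H n)"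
      by (simp add: norm_mult_ineq)
  qed
  have cs: "(\<Sum>n. fps_nth (fps_const d * H) n) = d * (\<Sum>n. fps_nth H n)" if "summable (\<lambda>n. norm (fps_nth H n))" for d and H :: "'a fps"
    using suminf_mult[OF summable_norm_cancel[OF that], of d] by simp
  have sadd: "summable (\<lambda>n. norm (fps_nth (1 + H) n))" if "summable (\<lambda>n. norm (fps_nth H n))" for H :: "'a fps"
  proof (rule summable_comparison_test'[OF summable_add[OF summable_fps_one that], of 0])
    fix n show "norm (norm (fps_nth (1 + H) n)) \<le> norm (fps_nth (1::'a fps) n) + norm (fps_nth H n)"
      unfolding fps_add_nth real_norm_def abs_norm_cancel by (rule norm_triangle_ineq)
  qed
  have sF: "summable (\<lambda>n. norm (fps_nth F n))" and sG: "summable (\<lambda>n. norm (fps_nth G n))"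
    unfolding F_def G_def by (intro sadd sc sP sQ)+
  have vF: "(\<Sum>n. fps_nth F n) = 1 + c * (\<Sum>k. p k)"
    unfolding F_def suminf_fps_add[OF summable_fps_one sc[OF sP]] suminf_fps_one cs[OF sP] by (simp add: PQ)
  have vG: "(\<Sum>n. fps_nth G n) = 1 - c * (\<Sum>k. q k)"
    unfolding G_def suminf_fps_add[OF summable_fps_one sc[OF sQ]] suminf_fps_one cs[OF sQ] by (simp add: PQ)
  show "(1 + c * (\<Sum>k. p k)) * (1 - c * (\<Sum>k. q k)) = 1"
    unfolding vF[symmetric] vG[symmetric] suminf_fps_mult[OF sF sG] FG by (rule suminf_fps_one)
  show "(1 - c * (\<Sum>k. q k)) * (1 + c * (\<Sum>k. p k)) = 1"
    unfolding vF[symmetric] vG[symmetric] suminf_fps_mult[OF sG sF] GF by (rule suminf_fps_one)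
  show "(\<Sum>k. p k) * (1 - c * (\<Sum>k. q k)) = (\<Sum>k. q k)"
    using suminf_fps_mult[OF sP sG] unfolding vG PG by (simp add: PQ)
qed

section \<open>From the resolvent series to the logarithm and its spectrum\<close>

lemma has_integral_reflect_unit:
  fixes f :: "real \<Rightarrow> 'a::banach"
  assumes "(f has_integral i) {0..1}"
  shows "((\<lambda>x. f (1 - x)) has_integral i) {0..1}"
proof -
  have "((\<lambda>x. f ((-1) *\<^sub>R x + 1)) has_integral (1 / \<bar>-1\<bar> ^ DIM(real)) *\<^sub>R i)
      ((\<lambda>x. (1 / (-1)) *\<^sub>R x + - ((1 / (-1)) *\<^sub>R 1)) ` cbox 0 1)"
    using assms by (intro has_integral_affinity) auto
  moreover have "(\<lambda>x::real. (1 / (-1)) *\<^sub>R x + - ((1 / (-1)) *\<^sub>R 1)) ` cbox 0 1 = {0..1}"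
  proof -
    have "(\<lambda>x::real. (1 / (-1)) *\<^sub>R x + - ((1 / (-1)) *\<^sub>R 1)) = (\<lambda>x. 1 - x)" by auto
    then show ?thesis by (simp add: image_diff_atLeastAtMost)
  qed
  ultimately show ?thesis by simp
qed

text \<open>The interface between the integrals and the Banach algebra argument: p are the ordered
  integrals, q and Q the coefficients for real and complex parameter, m the Magnus terms. It is kept
  abstract so that it can be instantiated again with all coefficients of degree k multiplied by
  \<open>t ^ k\<close>.\<close>

locale magnus_series =
  fixes p m :: "nat \<Rightarrow> 'a::{real_normed_algebra_1,banach}"
    and Q :: "complex \<Rightarrow> nat \<Rightarrow> 'a complexification"
    and q :: "real \<Rightarrow> nat \<Rightarrow> 'a" and r C :: real
  assumes p0: "p 0 = 0"
    and Qrec: "\<And>z k. Q z k = of_re (p k) - of_cx (1 - z) * (\<Sum>j\<le>k. of_re (p j) * Q z (k - j))"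
    and Qq: "\<And>l k. l \<in> {0..1} \<Longrightarrow> Q (of_real l) k = of_re (q l k)"
    and r: "0 \<le> r" "r < 2"
    and qbound: "\<And>l k. l \<in> {0..1} \<Longrightarrow> norm (q l k) \<le> C * (r / 2) ^ k"
    and Qbound: "\<And>\<zeta>. 0 < cmod \<zeta> \<Longrightarrow> cmod \<zeta> < pi \<Longrightarrow> r < 2 * sin (cmod \<zeta> / 2) \<Longrightarrow>
      \<exists>D s. 0 \<le> s \<and> s < 1 \<and> (\<forall>k. norm (Q (exp \<zeta> / (exp \<zeta> - 1)) k) \<le> D * s ^ k)"
    and mint: "\<And>k. ((\<lambda>l. q l k) has_integral m k) {0..1}"
begin

definition "A = 1 + (\<Sum>k. p k)"

text \<open>At parameter 1 the correction term of the recurrence vanishes. Hence p inherits the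
  bounds on q.\<close>

lemma p_eq: "p k = q 1 k"
proof -
  have "of_re (p k) = of_re (q 1 k)"
    using Qrec[of 1 k] Qq[of 1 k] by (simp add: of_cx_simps)
  then show ?thesis by (metis of_re_sel(1))
qed

lemma C_nonneg: "0 \<le> C"
  using order_trans[OF norm_ge_zero qbound[of 1 0]] by simp

lemma summable_geo: "summable (\<lambda>k. C * (r / 2) ^ k)"
  using r by (intro summable_mult summable_geometric) auto

lemma summable_q: "l \<in> {0..1} \<Longrightarrow> summable (\<lambda>k. norm (q l k))"
  using qbound by (intro summable_comparison_test'[OF summable_geo, of 0]) auto

lemma summable_p: "summable (\<lambda>k. norm (p k))"
  unfolding p_eq by (rule summable_q) simp

lemma q0: "l \<in> {0..1} \<Longrightarrow> q l 0 = 0"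
proof -
  assume l: "l \<in> {0..1}"
  have "of_re (q l 0) = (0 :: 'a complexification)"
    using Qrec[of "of_real l" 0] Qq[OF l, of 0] by (simp add: p0 of_re_simps)
  then show ?thesis by (metis of_re_sel(1) cx_sel(1))
qed

lemma qrec:
  assumes "l \<in> {0..1}"
  shows "q l k = p k - ((1 - l) *\<^sub>R 1) * (\<Sum>j\<le>k. p j * q l (k - j))"
proof -
  have "of_re (q l k) = of_re (p k) - of_cx (of_real (1 - l)) * (\<Sum>j\<le>k. of_re (p j) * of_re (q l (k - j)))"
    using Qrec[of "of_real l" k] by (simp add: Qq[OF assms])
  also have "\<dots> = of_re (p k - ((1 - l) *\<^sub>R 1) * (\<Sum>j\<le>k. p j * q l (k - j)))"
    by (simp only: of_re_simps of_re_sum of_cx_of_real of_re_scaleR)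
  finally show ?thesis by (metis of_re_sel(1))
qed

lemma resolvent:
  assumes l: "l \<in> {0..1}"
  shows "(l *\<^sub>R 1 + (1 - l) *\<^sub>R A) * (1 - (1 - l) *\<^sub>R (\<Sum>k. q l k)) = 1"
    and "(1 - (1 - l) *\<^sub>R (\<Sum>k. q l k)) * (l *\<^sub>R 1 + (1 - l) *\<^sub>R A) = 1"
    and "(A - 1) * (1 - (1 - l) *\<^sub>R (\<Sum>k. q l k)) = (\<Sum>k. q l k)"
proof -
  have c: "x * ((1 - l) *\<^sub>R 1) = ((1 - l) *\<^sub>R 1) * x" for x :: 'a by simp
  note * = resolvent_series[OF p0 c qrec[OF l] summable_p summable_q[OF l]]
  have e: "l *\<^sub>R 1 + (1 - l) *\<^sub>R A = 1 + (1 - l) *\<^sub>R (\<Sum>k. p k)"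
    by (simp add: A_def algebra_simps)
  show "(l *\<^sub>R 1 + (1 - l) *\<^sub>R A) * (1 - (1 - l) *\<^sub>R (\<Sum>k. q l k)) = 1"
    "(1 - (1 - l) *\<^sub>R (\<Sum>k. q l k)) * (l *\<^sub>R 1 + (1 - l) *\<^sub>R A) = 1"
    "(A - 1) * (1 - (1 - l) *\<^sub>R (\<Sum>k. q l k)) = (\<Sum>k. q l k)"
    using * unfolding e by (simp_all add: A_def)
qed

lemma alg_inverse_resolvent:
  "l \<in> {0..1} \<Longrightarrow> alg_inverse (l *\<^sub>R 1 + (1 - l) *\<^sub>R A) = 1 - (1 - l) *\<^sub>R (\<Sum>k. q l k)"
  by (rule alg_inverse_eqI[OF resolvent(1,2)])

lemma integrand_eq:
  "l \<in> {0..1} \<Longrightarrow> (A - 1) * alg_inverse (l *\<^sub>R 1 + (1 - l) *\<^sub>R A) = (\<Sum>k. q l k)"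
  by (simp only: alg_inverse_resolvent resolvent(3))

lemma log_exists_A: "log_exists Real_Scalars A"
proof -
  have "invertible_elem (of_re A - of_cx (of_real x))" if x: "x \<le> 0" for x
  proof -
    \<comment> \<open>Solves \<open>l / (l - 1) = x\<close>, so that \<open>A - x\<close> is a
      positive multiple of \<open>l + (1 - l) A\<close>; it runs through [0, 1) as x runs through
      the nonpositive reals.\<close>
    define l where "l = x / (x - 1)"
    have l: "l \<in> {0..1}" and l1: "1 - l = 1 / (1 - x)"
      using x by (auto simp: l_def field_simps)
    have "(1 - x) *\<^sub>R (l *\<^sub>R 1 + (1 - l) *\<^sub>R A) = A - x *\<^sub>R 1"
    proof -
      have "(1 - x) * l = - x" "(1 - x) * (1 - l) = 1" using x by (auto simp: l1 l_def divide_simps algebra_simps)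
      then show ?thesis unfolding scaleR_add_right scaleR_scaleR by simp
    qed
    moreover have "invertible_elem ((1 - x) *\<^sub>R (l *\<^sub>R 1 + (1 - l) *\<^sub>R A))"
      unfolding invertible_elem_def
      using resolvent(1,2)[OF l] x
      by (intro exI[of _ "(1 / (1 - x)) *\<^sub>R (1 - (1 - l) *\<^sub>R (\<Sum>k. q l k))"]) simp
    ultimately have "invertible_elem (of_re (A - x *\<^sub>R 1))" by (simp add: invertible_of_re)
    then show ?thesis by (simp add: of_re_simps of_re_scaleR of_cx_of_real)
  qed
  then show ?thesis
    by (auto simp: log_exists_def spectrum_wrt_def of_re_def[symmetric] of_cx_def[symmetric])
qed

text \<open>Reflecting the parameter, u = 1 - l, turns \<open>l + (1 - l) A\<close> into
  \<open>1 + u (A - 1)\<close>, the form treated by \<open>exp_integral_resolvent\<close>.\<close>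

lemma resolvent_integral:
  shows "((\<lambda>u. (A - 1) * alg_inverse (1 + u *\<^sub>R (A - 1))) has_integral alg_log A) {0..1}"
    and "exp (alg_log A) = A"
proof -
  define R where "R u = alg_inverse (1 + u *\<^sub>R (A - 1))" for u
  have e: "1 + u *\<^sub>R (A - 1) = (1 - u) *\<^sub>R 1 + (1 - (1 - u)) *\<^sub>R A" for u
    by (simp add: algebra_simps)
  have Re: "R u = 1 - (1 - (1 - u)) *\<^sub>R (\<Sum>k. q (1 - u) k)" if "u \<in> {0..1}" for u
    unfolding R_def e using that by (intro alg_inverse_resolvent) auto
  have R: "(1 + u *\<^sub>R (A - 1)) * R u = 1" "R u * (1 + u *\<^sub>R (A - 1)) = 1" if "u \<in> {0..1}" for u
    unfolding Re[OF that] unfolding e using resolvent(1,2)[of "1 - u"] that by simp_all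
  note * = exp_integral_resolvent[OF R]
  have "continuous_on {0..1} (\<lambda>u. (A - 1) * R u)" using *(1) by (intro continuous_intros)
  then have i: "((\<lambda>u. (A - 1) * R u) has_integral integral {0..1} (\<lambda>u. (A - 1) * R u)) {0..1}"
    by (intro integrable_integral integrable_continuous_real)
  from has_integral_reflect_unit[OF this]
  have "((\<lambda>u. (A - 1) * alg_inverse (u *\<^sub>R 1 + (1 - u) *\<^sub>R A)) has_integral integral {0..1} (\<lambda>u. (A - 1) * R u)) {0..1}"
    unfolding R_def e by simp
  then have "alg_log A = integral {0..1} (\<lambda>u. (A - 1) * R u)"
    unfolding alg_log_def by (rule integral_unique)
  then show "((\<lambda>u. (A - 1) * alg_inverse (1 + u *\<^sub>R (A - 1))) has_integral alg_log A) {0..1}"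
    "exp (alg_log A) = A"
    using i *(2) by (simp_all add: R_def)
qed

lemma has_integral_series: "((\<lambda>l. \<Sum>k. q l k) has_integral alg_log A) {0..1}"
proof -
  have "((\<lambda>l. (A - 1) * alg_inverse (1 + (1 - l) *\<^sub>R (A - 1))) has_integral alg_log A) {0..1}"
    by (rule has_integral_reflect_unit[OF resolvent_integral(1)])
  moreover have "1 + (1 - l) *\<^sub>R (A - 1) = l *\<^sub>R 1 + (1 - l) *\<^sub>R A" for l
    by (simp add: algebra_simps)
  ultimately show ?thesis
    by (auto intro: has_integral_eq[rotated] simp: integrand_eq)
qed

lemma norm_m_le: "norm (m k) \<le> C * (r / 2) ^ k"
  using has_integral_bound_real[OF _ finite.emptyI mint[of k], of "C * (r / 2) ^ k"] qbound C_nonneg r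
  by simp

lemma m0: "m 0 = 0"
proof -
  have "((\<lambda>l. 0) has_integral m 0) {0..1::real}"
    by (rule has_integral_eq[OF _ mint[of 0]]) (simp add: q0)
  then show ?thesis by simp
qed

text \<open>The geometric bound on q is uniform in the parameter, so the tails of the series
  integrate to something that tends to 0.\<close>

lemma sums_m: "m sums alg_log A"
  unfolding sums_def
proof (rule LIM_zero_cancel, rule Lim_null_comparison)
  define T where "T n = (\<Sum>k. C * (r / 2) ^ (k + n))" for n
  show "T \<longlonglongrightarrow> 0"
    unfolding T_def by (rule suminf_exist_split2[OF summable_geo])
  show "\<forall>\<^sub>F n in sequentially. norm (sum m {..<n} - alg_log A) \<le> T n"
  proof (intro always_eventually allI)
    fix n
    have i: "((\<lambda>l. (\<Sum>k<n. q l k) - (\<Sum>k. q l k)) has_integral (sum m {..<n} - alg_log A)) {0..1}"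
      by (intro has_integral_diff has_integral_sum has_integral_series mint) auto
    have b: "norm ((\<Sum>k<n. q l k) - (\<Sum>k. q l k)) \<le> T n" if "l \<in> {0..1} - {}" for l
    proof -
      have l: "l \<in> {0..1}" using that by simp
      have s: "summable (\<lambda>k. q l k)" using summable_norm_cancel[OF summable_q[OF l]] .
      have "(\<Sum>k. q l k) = (\<Sum>k. q l (k + n)) + (\<Sum>k<n. q l k)"
        by (rule suminf_split_initial_segment[OF s])
      then have "norm ((\<Sum>k<n. q l k) - (\<Sum>k. q l k)) = norm (\<Sum>k. q l (k + n))" by simp
      also have "\<dots> \<le> T n"
        unfolding T_def
      proof (rule norm_suminf_le)
        show "norm (q l (k + n)) \<le> C * (r / 2) ^ (k + n)" for k by (rule qbound[OF l])
        show "summable (\<lambda>k. C * (r / 2) ^ (k + n))" using summable_geo by (subst summable_iff_shift)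
      qed
      finally show ?thesis .
    qed
    have T: "0 \<le> T n"
      unfolding T_def using C_nonneg r summable_geo
      by (intro suminf_nonneg) (auto simp: summable_iff_shift[of "\<lambda>k. C * (r / 2) ^ k"])
    show "norm (sum m {..<n} - alg_log A) \<le> T n"
      using has_integral_bound_real[OF T finite.emptyI i b] by simp
  qed
qed

text \<open>The coefficient of index k is homogeneous of degree k, so this is the passage from
  \<phi> to t \<phi>. Since \<open>t \<le> 1\<close>, the same r and C serve for every t.\<close>

lemma scaled:
  assumes t: "t \<in> {0..1}"
  shows "magnus_series (\<lambda>k. t ^ k *\<^sub>R p k) (\<lambda>k. t ^ k *\<^sub>R m k) (\<lambda>z k. t ^ k *\<^sub>R Q z k) (\<lambda>l k. t ^ k *\<^sub>R q l k) r C"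
proof
  fix z k
  have "(\<Sum>j\<le>k. of_re (t ^ j *\<^sub>R p j) * t ^ (k - j) *\<^sub>R Q z (k - j)) = t ^ k *\<^sub>R (\<Sum>j\<le>k. of_re (p j) * Q z (k - j))"
    unfolding scaleR_sum_right by (intro sum.cong refl) (simp add: of_re_scaleR power_add[symmetric])
  then show "t ^ k *\<^sub>R Q z k = of_re (t ^ k *\<^sub>R p k)
      - of_cx (1 - z) * (\<Sum>j\<le>k. of_re (t ^ j *\<^sub>R p j) * t ^ (k - j) *\<^sub>R Q z (k - j))"
    using Qrec[of z k] by (simp add: of_re_scaleR scaleR_diff_right[symmetric])
next
  have tk: "norm (t ^ k *\<^sub>R x) \<le> norm x" for k and x :: "'b::real_normed_vector"
    using t by (simp add: mult_left_le_one_le power_le_one)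
  show "norm (t ^ k *\<^sub>R q l k) \<le> C * (r / 2) ^ k" if "l \<in> {0..1}" for l k
    using tk[of k "q l k"] qbound[OF that, of k] by linarith
  fix \<zeta> :: complex assume "0 < cmod \<zeta>" "cmod \<zeta> < pi" "r < 2 * sin (cmod \<zeta> / 2)"
  from Qbound[OF this] obtain D s where D: "0 \<le> s" "s < 1" "\<And>k. norm (Q (exp \<zeta> / (exp \<zeta> - 1)) k) \<le> D * s ^ k"
    by blast
  have "norm (t ^ k *\<^sub>R Q (exp \<zeta> / (exp \<zeta> - 1)) k) \<le> D * s ^ k" for k
    by (rule order_trans[OF tk D(3)])
  then show "\<exists>D s. 0 \<le> s \<and> s < 1 \<and> (\<forall>k. norm (t ^ k *\<^sub>R Q (exp \<zeta> / (exp \<zeta> - 1)) k) \<le> D * s ^ k)"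
    using D(1,2) by blast
qed (use p0 Qq r in \<open>auto simp: of_re_scaleR intro!: has_integral_cmul mint\<close>)

text \<open>Here \<open>1 - z = - 1 / (exp \<zeta> - 1)\<close>, so the element
  \<open>1 + (1 - z) (A - 1)\<close> inverted by the series is a scalar multiple of
  \<open>A - exp \<zeta>\<close>.\<close>

lemma invertible_shift_A:
  assumes z: "0 < cmod \<zeta>" "cmod \<zeta> < pi" "r < 2 * sin (cmod \<zeta> / 2)"
  shows "invertible_elem (of_re A - of_cx (exp \<zeta>))"
proof -
  define z where "z = exp \<zeta> / (exp \<zeta> - 1)"
  obtain D s where D: "0 \<le> s" "s < 1" "\<And>k. norm (Q z k) \<le> D * s ^ k"
    using Qbound[OF assms] unfolding z_def by blast
  have sQ: "summable (\<lambda>k. norm (Q z k))"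
  proof (rule summable_comparison_test'[of "\<lambda>k. D * s ^ k" 0])
    show "summable (\<lambda>k. D * s ^ k)" using D by (intro summable_mult summable_geometric) auto
  qed (use D in simp)
  have ne: "exp \<zeta> \<noteq> 1"
  proof
    assume "exp \<zeta> = 1"
    then obtain n :: int where n: "Re \<zeta> = 0" "Im \<zeta> = of_int (2 * n) * pi" by (auto simp: exp_eq_1)
    have "\<bar>of_int (2 * n)\<bar> * pi < 1 * pi" using n(2) abs_Im_le_cmod[of \<zeta>] z(2) by (simp only: abs_mult abs_of_pos[OF pi_gt_zero] mult_1_left)
    then have "\<bar>of_int (2 * n) :: real\<bar> < 1" unfolding mult_less_cancel_right_pos[OF pi_gt_zero] .
    then have "n = 0" by linarith
    then show False using n z(1) by (simp add: complex_eq_iff)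
  qed
  have sp: "summable (\<lambda>k. norm (of_re (p k) :: 'a complexification))" using summable_p by simp
  have p0': "of_re (p 0) = (0 :: 'a complexification)" by (simp add: p0 of_re_simps)
  have c: "x * of_cx (1 - z) = of_cx (1 - z) * x" for x :: "'a complexification"
    by (rule of_cx_commute)
  have S: "(\<Sum>k. of_re (p k)) = of_re (A - 1)"
    unfolding A_def using bounded_linear.suminf[OF bounded_linear_of_re summable_norm_cancel[OF summable_p]] by simp
  have "invertible_elem (1 + of_cx (1 - z) * of_re (A - 1))"
    using resolvent_series(1,2)[OF p0' c Qrec sp sQ] unfolding S invertible_elem_def by blast
  moreover have "1 - z = - (1 / (exp \<zeta> - 1))"
    using ne by (simp add: z_def field_simps)
  moreover have "1 + of_cx (- (1 / (exp \<zeta> - 1))) * of_re (A - 1) = of_cx (- (1 / (exp \<zeta> - 1))) * (of_re A - of_cx (exp \<zeta>))"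
  proof -
    have "(1 :: 'a complexification) = of_cx (- (1 / (exp \<zeta> - 1)) * (1 - exp \<zeta>))"
    proof -
      have "exp \<zeta> - 1 \<noteq> 0" using ne by simp
      then have "- (1 / (exp \<zeta> - 1)) * (1 - exp \<zeta>) = 1" by (simp add: divide_simps)
      then show ?thesis by (simp only: of_cx_simps(2))
    qed
    also have "\<dots> = of_cx (- (1 / (exp \<zeta> - 1))) * (1 - of_cx (exp \<zeta>))"
      by (simp only: of_cx_simps)
    finally have "1 + of_cx (- (1 / (exp \<zeta> - 1))) * of_re (A - 1)
       = of_cx (- (1 / (exp \<zeta> - 1))) * ((1 - of_cx (exp \<zeta>)) + of_re (A - 1))"
      by (simp only: distrib_left)
    then show ?thesis by (simp only: of_re_simps) simp
  qed
  ultimately have "invertible_elem (of_cx (- (1 / (exp \<zeta> - 1))) * (of_re A - of_cx (exp \<zeta>)))"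
    by simp
  then show ?thesis
    by (subst (asm) invertible_of_cx_mult_iff) (use ne in auto)
qed

text \<open>A radius \<rho> strictly between the claimed bound and \<open>cmod z\<close>, and below
  pi, satisfies \<open>r < 2 * sin (\<rho> / 2)\<close>. The circle of radius \<rho> then carries no
  spectrum along the whole path.\<close>

lemma spectrum_log_A:
  assumes z: "2 * arcsin (r / 2) < cmod z"
  shows "invertible_elem (of_re (alg_log A) - of_cx z)"
proof -
  have r2: "-1 \<le> r / 2" "r / 2 < 1" using r by auto
  have "arcsin (r / 2) < arcsin 1" using r by (intro arcsin_less_arcsin) auto
  then have th: "2 * arcsin (r / 2) < pi" by simp
  have th0: "0 \<le> arcsin (r / 2)" using r arcsin_le_arcsin[of 0 "r / 2"] by simp
  obtain \<rho> where rho: "2 * arcsin (r / 2) < \<rho>" "\<rho> < min pi (cmod z)"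
    using dense[of "2 * arcsin (r / 2)" "min pi (cmod z)"] th z by auto
  have rho0: "0 < \<rho>" using rho th0 by simp
  have "sin (arcsin (r / 2)) < sin (\<rho> / 2)"
    using rho th0 by (intro sin_monotone_2pi) auto
  then have rs: "r < 2 * sin (\<rho> / 2)" using r2 by simp
  \<comment> \<open>The path of logarithms is given by the Magnus series, as a uniformly convergent
    series is visibly continuous and vanishes at t = 0.\<close>
  define y where "y t = of_re (\<Sum>k. t ^ k *\<^sub>R m k)" for t :: real
  have S: "(\<lambda>k. t ^ k *\<^sub>R m k) sums alg_log (magnus_series.A (\<lambda>k. t ^ k *\<^sub>R p k))" if "t \<in> {0..1}" for t
    by (rule magnus_series.sums_m[OF scaled[OF that]])
  have "uniform_limit {0..1} (\<lambda>n t. \<Sum>k<n. t ^ k *\<^sub>R m k) (\<lambda>t. \<Sum>k. t ^ k *\<^sub>R m k) sequentially"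
  proof (rule Weierstrass_m_test[OF _ summable_geo])
    fix n and t :: real assume t: "t \<in> {0..1}"
    have "norm (t ^ n *\<^sub>R m n) \<le> norm (m n)"
      using t by (simp add: mult_left_le_one_le power_le_one)
    then show "norm (t ^ n *\<^sub>R m n) \<le> C * (r / 2) ^ n" using norm_m_le[of n] by linarith
  qed
  then have "continuous_on {0..1} (\<lambda>t::real. \<Sum>k. t ^ k *\<^sub>R m k)"
    by (rule uniform_limit_theorem[rotated]) (auto intro!: always_eventually continuous_intros)
  then have "continuous_on {0..1} y"
    unfolding y_def by (rule bounded_linear.continuous_on[OF bounded_linear_of_re])
  moreover have "y 0 = 0"
  proof -
    have "(\<lambda>k. 0 ^ k *\<^sub>R m k) = (\<lambda>k. 0)" using m0 by (auto simp: power_0_left)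
    then show ?thesis by (simp add: y_def of_re_simps)
  qed
  moreover have "invertible_elem (y t - of_cx \<zeta>)" if t: "t \<in> {0..1}" and \<zeta>: "cmod \<zeta> = \<rho>" for t \<zeta>
  proof -
    have y: "y t = of_re (alg_log (magnus_series.A (\<lambda>k. t ^ k *\<^sub>R p k)))"
      unfolding y_def using S[OF t] by (simp add: sums_iff)
    have "invertible_elem (of_re (magnus_series.A (\<lambda>k. t ^ k *\<^sub>R p k)) - of_cx (exp \<zeta>))"
      using rho rho0 rs \<zeta> by (intro magnus_series.invertible_shift_A[OF scaled[OF t]]) auto
    then show ?thesis
      unfolding y by (rule invertible_log_shift[OF magnus_series.resolvent_integral(2)[OF scaled[OF t]]])
  qed
  ultimately have "invertible_elem (y 1 - of_cx z)"
    using rho rho0 by (intro spectrum_disc_along_path[of y \<rho> z]) auto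
  moreover have "y 1 = of_re (alg_log A)"
    using sums_m by (simp add: y_def sums_iff)
  ultimately show ?thesis by simp
qed

lemma spectral_radius_log_A:
  "alg_spectral_radius Real_Scalars (alg_log A) \<le> ennreal (2 * arcsin (r / 2))"
  unfolding alg_spectral_radius_def
proof (rule SUP_least)
  fix z assume "z \<in> alg_spectrum Real_Scalars (alg_log A)"
  then have "\<not> invertible_elem (of_re (alg_log A) - of_cx z)"
    by (simp add: spectrum_wrt_def of_re_def of_cx_def)
  then have "cmod z \<le> 2 * arcsin (r / 2)" using spectrum_log_A not_le by blast
  then show "ennreal (cmod z) \<le> ennreal (2 * arcsin (r / 2))" by (rule ennreal_leI)
qed

end

text \<open>If the algebra already has complex scalars, sending \<open>Cx a b\<close> to a + i b is
  a unital ring homomorphism from the complexification, and it preserves invertibility. The case of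
  real scalars therefore implies the complex one.\<close>

lemma alg_spectrum_subset_real:
  assumes "scalar_structure S"
  shows "alg_spectrum S a \<subseteq> alg_spectrum Real_Scalars a"
proof (cases S)
  case (Complex_Scalars s)
  interpret vector_space s using assms Complex_Scalars by simp
  have sr: "s (complex_of_real c) x = c *\<^sub>R x" and ml: "s z x * y = s z (x * y)" and mr: "x * s z y = s z (x * y)" for z x y c
    using assms Complex_Scalars by auto
  define h where "h x = cx_re x + s \<i> (cx_im x)" for x
  have h1: "h 1 = 1" by (simp add: h_def)
  have hm: "h (x * y) = h x * h y" for x y
  proof -
    have "s \<i> (s \<i> w) = - w" for w
      using sr[of "-1" w] by (simp add: scale_scale)
    then show ?thesis
      by (simp add: h_def distrib_left distrib_right ml mr scale_right_distrib)
  qed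
  have hz: "h (Cx a 0 - cx_scale z 1) = a - s z 1" for z
  proof -
    have "s z 1 = s (complex_of_real (Re z)) 1 + s (\<i> * complex_of_real (Im z)) 1"
      by (subst complex_eq[of z]) (simp only: scale_left_distrib)
    also have "\<dots> = Re z *\<^sub>R 1 + s \<i> (Im z *\<^sub>R 1)"
      unfolding sr scale_scale[symmetric] ..
    finally show ?thesis
      by (simp add: h_def cx_scale_def scale_minus_right)
  qed
  have "invertible_elem (a - s z 1)" if "invertible_elem (Cx a 0 - cx_scale z 1)" for z
    using that unfolding invertible_elem_def hz[symmetric] by (metis h1 hm)
  then show ?thesis using Complex_Scalars by (auto simp: spectrum_wrt_def)
qed simp



subsection \<open>Discrete kernel sums\<close>

text \<open>With \<open>x j\<close> the mass of the j-th cell, \<open>kernel_sum x N z k\<close> is the sum over all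
  \<open>(k + 1)\<close>-tuples of cells of the product of the masses, weighted by z per ascent and z - 1 per
  descent or repetition; for z = 1 only the strictly increasing tuples remain.\<close>

definition asc_kernel :: "complex \<Rightarrow> nat \<Rightarrow> nat \<Rightarrow> complex" where
  "asc_kernel z i j = (if i < j then z else z - 1)"

primrec kernel_sum_from ::
    "(nat \<Rightarrow> 'a::real_algebra_1) \<Rightarrow> nat \<Rightarrow> complex \<Rightarrow> nat \<Rightarrow> nat \<Rightarrow> 'a complexification" where
  "kernel_sum_from x N z 0 i = of_re (x i)"
| "kernel_sum_from x N z (Suc k) i =
     of_re (x i) * (\<Sum>j<N. of_cx (asc_kernel z i j) * kernel_sum_from x N z k j)"

definition kernel_sum :: "(nat \<Rightarrow> 'a::real_algebra_1) \<Rightarrow> nat \<Rightarrow> complex \<Rightarrow> nat \<Rightarrow> 'a complexification" where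
  "kernel_sum x N z k = (\<Sum>i<N. kernel_sum_from x N z k i)"

text \<open>The kernel at z is the kernel at 1 minus the constant 1 - z. Choosing the constant
  decouples neighbouring indices, so expanding at its first occurrence cuts the chain into an
  increasing piece and an unrestricted rest. Parameter k means k + 1 factors, hence the index
  \<open>k - Suc j\<close>.\<close>

lemma kernel_sum_from_recurrence:
  "kernel_sum_from x N z k i = kernel_sum_from x N 1 k i
     - of_cx (1 - z) * (\<Sum>j<k. kernel_sum_from x N 1 j i * kernel_sum x N z (k - Suc j))"
proof (induction k arbitrary: i)
  case (Suc k)
  let ?p = "kernel_sum_from x N 1" and ?q = "kernel_sum_from x N z" and ?Q = "kernel_sum x N z"
  let ?c = "of_cx (1 - z) :: 'a complexification"
  have kz: "asc_kernel z i j = asc_kernel 1 i j - (1 - z)" for j by (simp add: asc_kernel_def)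
  have cl: "of_re (x i) * (?c * y) = ?c * (of_re (x i) * y)" for y
    by (simp only: mult.assoc[symmetric] of_cx_commute)
  have ck: "of_cx w * (?c * y) = ?c * (of_cx w * y)" for w y
    by (simp only: mult.assoc[symmetric] of_cx_simps(5)[symmetric] mult.commute[of w])
  have "?q (Suc k) i = of_re (x i) * (\<Sum>j<N. of_cx (asc_kernel 1 i j) * ?q k j - ?c * ?q k j)"
    by (simp only: kernel_sum_from.simps kz of_cx_simps(4) left_diff_distrib)
  also have "\<dots> = of_re (x i) * (\<Sum>j<N. of_cx (asc_kernel 1 i j) * ?q k j) - ?c * (of_re (x i) * ?Q k)"
    by (simp only: sum_subtractf right_diff_distrib sum_distrib_left[symmetric] kernel_sum_def cl)
  also have "(\<Sum>j<N. of_cx (asc_kernel 1 i j) * ?q k j)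
      = (\<Sum>j<N. of_cx (asc_kernel 1 i j) * ?p k j)
        - ?c * (\<Sum>l<k. (\<Sum>j<N. of_cx (asc_kernel 1 i j) * ?p l j) * ?Q (k - Suc l))"
  proof -
    have "(\<Sum>j<N. of_cx (asc_kernel 1 i j) * ?q k j)
       = (\<Sum>j<N. of_cx (asc_kernel 1 i j) * ?p k j - ?c * (\<Sum>l<k. of_cx (asc_kernel 1 i j) * ?p l j * ?Q (k - Suc l)))"
      unfolding Suc.IH by (simp only: right_diff_distrib ck sum_distrib_left mult.assoc)
    also have "\<dots> = (\<Sum>j<N. of_cx (asc_kernel 1 i j) * ?p k j)
        - ?c * (\<Sum>j<N. \<Sum>l<k. of_cx (asc_kernel 1 i j) * ?p l j * ?Q (k - Suc l))"
      by (simp only: sum_subtractf sum_distrib_left[symmetric])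
    finally show ?thesis by (subst (asm) sum.swap) (simp only: sum_distrib_right)
  qed
  finally have f: "?q (Suc k) i = of_re (x i) * ((\<Sum>j<N. of_cx (asc_kernel 1 i j) * ?p k j)
        - ?c * (\<Sum>l<k. (\<Sum>j<N. of_cx (asc_kernel 1 i j) * ?p l j) * ?Q (k - Suc l))) - ?c * (of_re (x i) * ?Q k)" .
  have d: "of_re (x i) * (\<Sum>l<k. (\<Sum>j<N. of_cx (asc_kernel 1 i j) * ?p l j) * ?Q (k - Suc l))
       = (\<Sum>l<k. ?p (Suc l) i * ?Q (k - Suc l))"
    by (subst sum_distrib_left) (simp only: mult.assoc kernel_sum_from.simps)
  have "?q (Suc k) i = ?p (Suc k) i
      - ?c * (\<Sum>l<k. ?p (Suc l) i * ?Q (k - Suc l)) - ?c * (?p 0 i * ?Q k)"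
    unfolding f right_diff_distrib cl d by (simp only: kernel_sum_from.simps)
  also have "\<dots> = ?p (Suc k) i - ?c * (\<Sum>j<Suc k. ?p j i * ?Q (Suc k - Suc j))"
    unfolding sum.lessThan_Suc_shift by (simp only: distrib_left diff_Suc_Suc diff_diff_add[symmetric]) (simp add: algebra_simps)
  finally show ?case .
qed (simp add: kernel_sum_def)

lemma kernel_sum_recurrence:
  "kernel_sum x N z k = kernel_sum x N 1 k
     - of_cx (1 - z) * (\<Sum>j<k. kernel_sum x N 1 j * kernel_sum x N z (k - Suc j))"
proof -
  have "kernel_sum x N z k = kernel_sum x N 1 k
     - of_cx (1 - z) * (\<Sum>i<N. \<Sum>j<k. kernel_sum_from x N 1 j i * kernel_sum x N z (k - Suc j))"
    unfolding kernel_sum_def[of x N z k] kernel_sum_def[of x N 1 k]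
    by (subst ext[OF kernel_sum_from_recurrence[of x N z k]]) (simp only: sum_subtractf sum_distrib_left)
  then show ?thesis
    by (subst (asm) sum.swap) (simp only: kernel_sum_def[of x N 1] sum_distrib_right)
qed

text \<open>Limits of kernel sums for arbitrary complex z, computed from the ordered integrals p
  alone: convergence is first known at z = 1, and the recurrence transports it to the other
  z.\<close>

fun kernel_limit :: "(nat \<Rightarrow> 'a::real_algebra_1) \<Rightarrow> complex \<Rightarrow> nat \<Rightarrow> 'a complexification" where
  "kernel_limit p z k = of_re (p k) - of_cx (1 - z) * (\<Sum>j<k. of_re (p (k - j)) * kernel_limit p z j)"

declare kernel_limit.simps [simp del]

lemma kernel_limit_recurrence:
  assumes "p 0 = 0"
  shows "kernel_limit p z k = of_re (p k) - of_cx (1 - z) * (\<Sum>j\<le>k. of_re (p j) * kernel_limit p z (k - j))"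
proof -
  have "(\<Sum>j\<le>k. of_re (p j) * kernel_limit p z (k - j)) = (\<Sum>j\<le>k. of_re (p (k - j)) * kernel_limit p z j)"
    by (rule sum.reindex_bij_witness[of _ "\<lambda>j. k - j" "\<lambda>j. k - j"]) auto
  also have "\<dots> = (\<Sum>j<k. of_re (p (k - j)) * kernel_limit p z j)"
    using assms by (simp add: lessThan_Suc_atMost[symmetric] of_re_simps)
  finally show ?thesis by (simp add: kernel_limit.simps[of p z k])
qed

text \<open>Induction along the finite recurrence, each sum on its right side having fewer factors
  or parameter 1. The shift to \<open>Suc k\<close> translates between the parameter and the number
  of factors.\<close>

lemma kernel_sum_tendsto:
  fixes x :: "nat \<Rightarrow> nat \<Rightarrow> 'a::real_normed_algebra_1"
  assumes p0: "p 0 = 0"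
    and lim: "\<And>k. (\<lambda>N. kernel_sum (x N) N 1 k) \<longlonglongrightarrow> of_re (p (Suc k))"
  shows "(\<lambda>N. kernel_sum (x N) N z k) \<longlonglongrightarrow> kernel_limit p z (Suc k)"
proof (induction k rule: less_induct)
  case (less k)
  have L0: "kernel_limit p z 0 = 0" by (simp add: kernel_limit.simps[of p z 0] p0 of_re_simps)
  have "(\<lambda>N. kernel_sum (x N) N 1 k
     - of_cx (1 - z) * (\<Sum>j<k. kernel_sum (x N) N 1 j * kernel_sum (x N) N z (k - Suc j)))
    \<longlonglongrightarrow> of_re (p (Suc k)) - of_cx (1 - z) * (\<Sum>j<k. of_re (p (Suc j)) * kernel_limit p z (Suc (k - Suc j)))"
    by (intro tendsto_diff lim tendsto_mult tendsto_const tendsto_sum less.IH) simp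
  moreover have "(\<Sum>j<k. of_re (p (Suc j)) * kernel_limit p z (Suc (k - Suc j)))
     = (\<Sum>j<Suc k. of_re (p (Suc j)) * kernel_limit p z (Suc k - Suc j))"
    by (simp add: L0 Suc_diff_Suc)
  moreover have "kernel_limit p z (Suc k) = of_re (p (Suc k))
      - of_cx (1 - z) * (\<Sum>j<Suc k. of_re (p (Suc j)) * kernel_limit p z (Suc k - Suc j))"
    unfolding kernel_limit_recurrence[of p, OF p0, of z "Suc k"] lessThan_Suc_atMost[symmetric]
      sum.lessThan_Suc_shift[of _ "Suc k"] by (simp add: p0 of_re_simps(1))
  ultimately show ?case
    by (simp only: kernel_sum_recurrence[symmetric])
qed

subsection \<open>Norm bounds\<close>

text \<open>The iterates, applied to the constant function 1, of the discrete integral operator with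
  kernel \<alpha> above the diagonal and \<beta> on and below it.\<close>

primrec kernel_weight :: "real \<Rightarrow> real \<Rightarrow> nat \<Rightarrow> nat \<Rightarrow> nat \<Rightarrow> real" where
  "kernel_weight \<alpha> \<beta> N 0 i = 1"
| "kernel_weight \<alpha> \<beta> N (Suc k) i = (\<Sum>j<N. (if i < j then \<alpha> else \<beta>) * kernel_weight \<alpha> \<beta> N k j)"

text \<open>The scalar w is carried along because the norm of the complexification is not
  complex-homogeneous.\<close>

lemma norm_kernel_sum_from_le:
  fixes x :: "nat \<Rightarrow> 'a::real_normed_algebra_1"
  assumes "0 \<le> d" "\<And>j. j < N \<Longrightarrow> norm (x j) \<le> d" "i < N"
  shows "norm (cx_re (of_cx w * kernel_sum_from x N z k i))
    \<le> cmod w * (d ^ Suc k * kernel_weight (cmod z) (cmod (z - 1)) N k i)"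
  using assms(3)
proof (induction k arbitrary: i w)
  case 0
  have "norm (Re w *\<^sub>R x i) \<le> cmod w * d"
    unfolding norm_scaleR using assms 0 by (intro mult_mono) (auto simp: abs_Re_le_cmod)
  then show ?case by simp
next
  case (Suc k)
  let ?b = "kernel_weight (cmod z) (cmod (z - 1)) N"
  have "of_cx w * kernel_sum_from x N z (Suc k) i
      = of_re (x i) * (\<Sum>j<N. of_cx (w * asc_kernel z i j) * kernel_sum_from x N z k j)"
    by (simp only: kernel_sum_from.simps mult.assoc[symmetric] of_cx_commute[of "of_re (x i)", symmetric])
      (simp only: mult.assoc sum_distrib_left of_cx_simps(5))
  then have "cx_re (of_cx w * kernel_sum_from x N z (Suc k) i)
      = x i * (\<Sum>j<N. cx_re (of_cx (w * asc_kernel z i j) * kernel_sum_from x N z k j))"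
    by (simp add: bounded_linear.linear[OF bounded_linear_cx_re, THEN linear_sum])
  also have "norm \<dots> \<le> norm (x i) * (\<Sum>j<N. norm (cx_re (of_cx (w * asc_kernel z i j) * kernel_sum_from x N z k j)))"
    by (intro order_trans[OF norm_mult_ineq] mult_left_mono norm_sum norm_ge_zero)
  also have "\<dots> \<le> d * (\<Sum>j<N. cmod (w * asc_kernel z i j) * (d ^ Suc k * ?b k j))"
    using assms Suc.prems by (intro mult_mono sum_mono Suc.IH sum_nonneg) auto
  also have "\<dots> = cmod w * (d ^ Suc (Suc k) * ?b (Suc k) i)"
    unfolding kernel_weight.simps sum_distrib_left
    by (intro sum.cong refl) (simp add: norm_mult asc_kernel_def)
  finally show ?case .
qed

lemma norm_kernel_sum_le:
  fixes x :: "nat \<Rightarrow> 'a::real_normed_algebra_1"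
  assumes "0 \<le> d" "\<And>j. j < N \<Longrightarrow> norm (x j) \<le> d"
  shows "norm (kernel_sum x N z k) \<le> 2 * (\<Sum>i<N. d ^ Suc k * kernel_weight (cmod z) (cmod (z - 1)) N k i)"
proof -
  let ?b = "\<Sum>i<N. d ^ Suc k * kernel_weight (cmod z) (cmod (z - 1)) N k i"
  have "norm (cx_re (of_cx w * kernel_sum x N z k)) \<le> ?b" if "cmod w = 1" for w
  proof -
    have "norm (cx_re (of_cx w * kernel_sum x N z k)) = norm (\<Sum>i<N. cx_re (of_cx w * kernel_sum_from x N z k i))"
      unfolding kernel_sum_def sum_distrib_left
      by (simp only: bounded_linear.linear[OF bounded_linear_cx_re, THEN linear_sum])
    also have "\<dots> \<le> ?b"
    proof (intro sum_norm_le)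
      fix i assume "i \<in> {..<N}"
      then show "norm (cx_re (of_cx w * kernel_sum_from x N z k i)) \<le> d ^ Suc k * kernel_weight (cmod z) (cmod (z - 1)) N k i"
        using norm_kernel_sum_from_le[where x=x and N=N and d=d and i=i and w=w and z=z and k=k] assms that by simp
    qed
    finally show ?thesis .
  qed
  \<comment> \<open>Multiplication by -i moves the imaginary component into the real one, so the two
    choices of w bound both summands of the norm; hence the factor 2.\<close>
  from this[of 1] this[of "-\<i>"] show ?thesis
    by (simp add: norm_complexification_def)
qed

text \<open>Comparison with a positive supersolution: if h dominates 1 up to the factor c and the
  operator maps h below s h, then positivity propagates the bound through all iterates.\<close>

lemma kernel_weight_le:
  assumes "0 \<le> \<alpha>" "0 \<le> \<beta>" "0 \<le> d" "0 \<le> s" "0 \<le> c"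
    and h: "\<And>i. i < N \<Longrightarrow> 1 \<le> c * h i"
    and row: "\<And>i. i < N \<Longrightarrow> d * (\<Sum>j<N. (if i < j then \<alpha> else \<beta>) * h j) \<le> s * h i"
    and i: "i < N"
  shows "d ^ k * kernel_weight \<alpha> \<beta> N k i \<le> c * s ^ k * h i"
  using i
proof (induction k arbitrary: i)
  case (Suc k)
  have "d ^ Suc k * kernel_weight \<alpha> \<beta> N (Suc k) i
      = d * (\<Sum>j<N. (if i < j then \<alpha> else \<beta>) * (d ^ k * kernel_weight \<alpha> \<beta> N k j))"
    by (simp add: sum_distrib_left mult_ac)
  also have "\<dots> \<le> d * (\<Sum>j<N. (if i < j then \<alpha> else \<beta>) * (c * s ^ k * h j))"
    using assms(1-3) Suc.IH by (intro mult_left_mono sum_mono) auto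
  also have "\<dots> = c * s ^ k * (d * (\<Sum>j<N. (if i < j then \<alpha> else \<beta>) * h j))"
    by (simp add: sum_distrib_left mult_ac)
  also have "\<dots> \<le> c * s ^ k * (s * h i)"
    using assms(4,5) row[OF Suc.prems] by (intro mult_left_mono) auto
  finally show ?case by (simp add: mult_ac)
qed (use h in simp)

lemma sum_split_power:
  fixes X :: real
  assumes "X \<noteq> 1" "i < N"
  shows "(\<Sum>j<N. (if i < j then \<alpha> else \<beta>) * X ^ j) = ((\<alpha> - \<beta>) * X ^ Suc i + \<beta> - \<alpha> * X ^ N) / (1 - X)"
proof -
  have "(\<Sum>j<N. (if i < j then \<alpha> else \<beta>) * X ^ j) = (\<Sum>j<N. \<alpha> * X ^ j) + (\<Sum>j<N. (if j < Suc i then (\<beta> - \<alpha>) * X ^ j else 0))"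
    unfolding sum.distrib[symmetric] by (intro sum.cong refl) (auto simp: algebra_simps)
  also have "(\<Sum>j<N. (if j < Suc i then (\<beta> - \<alpha>) * X ^ j else 0)) = (\<Sum>j<Suc i. (\<beta> - \<alpha>) * X ^ j)"
    using assms(2) by (intro sum.mono_neutral_cong_right) auto
  finally show ?thesis
    unfolding sum_distrib_left[symmetric] sum_gp_strict
    using assms(1) by (simp add: add_divide_distrib[symmetric]) (simp add: algebra_simps)
qed

text \<open>The test function \<open>exp (- l j / N)\<close> is a discretisation of the positive eigenfunction of the
  kernel \<open>\<alpha>\<close> above and \<open>\<beta>\<close> below the diagonal, whose eigenvalue is
  \<open>r (\<alpha> - \<beta>) / ln (\<alpha> / \<beta>)\<close>.\<close>

lemma kernel_sum_exp_bound:
  fixes x :: "nat \<Rightarrow> 'a::real_normed_algebra_1"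
  assumes N: "N > 0" and r: "0 \<le> r" and x: "\<And>j. j < N \<Longrightarrow> norm (x j) \<le> r / real N"
    and l: "l \<noteq> 0" and sgn: "(cmod (z - 1) - cmod z * exp (- l)) / l \<le> 0" "0 \<le> (cmod z - cmod (z - 1)) / l"
  shows "norm (kernel_sum x N z k)
    \<le> 2 * r * exp \<bar>l\<bar> * exp \<bar>l\<bar> * (r * (cmod z - cmod (z - 1)) / (real N * (exp (l / real N) - 1))) ^ k"
proof -
  define X where "X = exp (- l / real N)"
  define s where "s = r * (cmod z - cmod (z - 1)) / (real N * (exp (l / real N) - 1))"
  define d where "d = r / real N"
  have X1: "X \<noteq> 1" using l N by (simp add: X_def)
  have XN: "X ^ N = exp (- l)" using N by (simp add: X_def exp_of_nat_mult[symmetric])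
  have el: "(exp (l / real N) - 1) / l > 0"
    using l N by (cases "l > 0") (auto simp: zero_less_divide_iff divide_less_0_iff)
  have s0: "0 \<le> s"
  proof -
    have "s = (r / real N) * ((cmod z - cmod (z - 1)) / l) / ((exp (l / real N) - 1) / l)"
      using l by (simp add: s_def)
    then show ?thesis
      using divide_nonneg_pos[OF mult_nonneg_nonneg[OF _ sgn(2)] el, of "r / real N"] r by simp
  qed
  \<comment> \<open>The source of the two factors \<open>exp \<bar>l\<bar>\<close>: one makes the
    test function a majorant of 1, the other removes it at the end.\<close>
  have h: "exp (- \<bar>l\<bar>) \<le> X ^ j" "X ^ j \<le> exp \<bar>l\<bar>" if "j < N" for j
  proof -
    have "\<bar>real j * (- l / real N)\<bar> = \<bar>l\<bar> * (real j / real N)" by (simp add: abs_mult)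
    also have "\<dots> \<le> \<bar>l\<bar>" using that by (intro mult_left_le) auto
    finally have "\<bar>real j * (- l / real N)\<bar> \<le> \<bar>l\<bar>" .
    then have "real j * (- l / real N) \<le> \<bar>l\<bar>" "- \<bar>l\<bar> \<le> real j * (- l / real N)" by linarith+
    then show "exp (- \<bar>l\<bar>) \<le> X ^ j" "X ^ j \<le> exp \<bar>l\<bar>"
      unfolding X_def exp_of_nat_mult[symmetric] by (simp_all only: exp_le_cancel_iff)
  qed
  have row: "d * (\<Sum>j<N. (if i < j then cmod z else cmod (z - 1)) * X ^ j) \<le> s * X ^ i" if "i < N" for i
  proof -
    have X': "1 - X = (exp (l / real N) - 1) * X"
      by (simp add: X_def left_diff_distrib mult_exp_exp)
    \<comment> \<open>The part of the closed form of the row sum that does not depend on i. Its sign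
      is the first sign hypothesis, and discarding it leaves exactly
      \<open>s * X ^ i\<close>.\<close>
    have "(cmod (z - 1) - cmod z * X ^ N) / (1 - X)
       = ((cmod (z - 1) - cmod z * exp (- l)) / l) / (((exp (l / real N) - 1) / l) * X)"
      using l by (simp add: XN X')
    also have "\<dots> \<le> 0"
      by (rule divide_nonpos_pos[OF sgn(1) mult_pos_pos[OF el]]) (simp add: X_def)
    finally have n: "(cmod (z - 1) - cmod z * X ^ N) / (1 - X) \<le> 0" .
    have "d * (\<Sum>j<N. (if i < j then cmod z else cmod (z - 1)) * X ^ j)
       = d * ((cmod z - cmod (z - 1)) * X ^ Suc i / (1 - X)) + d * ((cmod (z - 1) - cmod z * X ^ N) / (1 - X))"
      unfolding sum_split_power[OF X1 that] by (simp add: add_divide_distrib diff_divide_distrib algebra_simps)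
    also have "\<dots> \<le> d * ((cmod z - cmod (z - 1)) * X ^ Suc i / (1 - X))"
    proof -
      have "d * ((cmod (z - 1) - cmod z * X ^ N) / (1 - X)) \<le> 0"
        using r by (intro mult_nonneg_nonpos n) (simp add: d_def)
      then show ?thesis by linarith
    qed
    also have "\<dots> = s * X ^ i"
      unfolding X' s_def d_def by (simp add: X_def)
    finally show ?thesis .
  qed
  have w: "d ^ k * kernel_weight (cmod z) (cmod (z - 1)) N k i \<le> exp \<bar>l\<bar> * s ^ k * X ^ i" if "i < N" for i
  proof (rule kernel_weight_le[OF _ _ _ s0 _ _ row that])
    fix j assume "j < N"
    then have "exp \<bar>l\<bar> * exp (- \<bar>l\<bar>) \<le> exp \<bar>l\<bar> * X ^ j" using h by (intro mult_left_mono) auto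
    then show "1 \<le> exp \<bar>l\<bar> * X ^ j" by (simp add: mult_exp_exp)
  qed (use r in \<open>auto simp: d_def\<close>)
  have "norm (kernel_sum x N z k) \<le> 2 * (\<Sum>i<N. d ^ Suc k * kernel_weight (cmod z) (cmod (z - 1)) N k i)"
    using r x by (intro norm_kernel_sum_le) (auto simp: d_def)
  also have "\<dots> \<le> 2 * (\<Sum>i<N. d * (exp \<bar>l\<bar> * s ^ k * exp \<bar>l\<bar>))"
  proof (intro mult_left_mono sum_mono)
    fix i assume "i \<in> {..<N}"
    then have i: "i < N" by simp
    have "d ^ k * kernel_weight (cmod z) (cmod (z - 1)) N k i \<le> exp \<bar>l\<bar> * s ^ k * exp \<bar>l\<bar>"
      by (rule order_trans[OF w[OF i]]) (use h(2)[OF i] s0 in \<open>auto intro!: mult_left_mono\<close>)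
    then have "d * (d ^ k * kernel_weight (cmod z) (cmod (z - 1)) N k i) \<le> d * (exp \<bar>l\<bar> * s ^ k * exp \<bar>l\<bar>)"
      using r by (intro mult_left_mono) (auto simp: d_def)
    then show "d ^ Suc k * kernel_weight (cmod z) (cmod (z - 1)) N k i \<le> d * (exp \<bar>l\<bar> * s ^ k * exp \<bar>l\<bar>)"
      by (simp only: power_Suc mult.assoc)
  qed simp
  also have "\<dots> = 2 * r * exp \<bar>l\<bar> * exp \<bar>l\<bar> * s ^ k" using N by (simp add: d_def)
  finally show ?thesis by (simp only: s_def)
qed

text \<open>The degenerate case of equal weights, where the exponent of the test function would be
  0: constants are eigenfunctions, with eigenvalue \<open>r * cmod z\<close>.\<close>

lemma kernel_sum_const_bound:
  fixes x :: "nat \<Rightarrow> 'a::real_normed_algebra_1"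
  assumes N: "N > 0" and r: "0 \<le> r" and x: "\<And>j. j < N \<Longrightarrow> norm (x j) \<le> r / real N"
    and z: "cmod (z - 1) = cmod z"
  shows "norm (kernel_sum x N z k) \<le> 2 * r * (r * cmod z) ^ k"
proof -
  have w: "(r / real N) ^ k * kernel_weight (cmod z) (cmod z) N k i \<le> 1 * (r * cmod z) ^ k * 1" if "i < N" for i
    by (rule kernel_weight_le[where h="\<lambda>_. 1"]) (use r N that in auto)
  have "norm (kernel_sum x N z k) \<le> 2 * (\<Sum>i<N. (r / real N) ^ Suc k * kernel_weight (cmod z) (cmod (z - 1)) N k i)"
    using r x by (intro norm_kernel_sum_le) auto
  also have "\<dots> \<le> 2 * (\<Sum>i<N. (r / real N) * (r * cmod z) ^ k)"
  proof (intro mult_left_mono sum_mono)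
    fix i assume "i \<in> {..<N}"
    then have "(r / real N) * ((r / real N) ^ k * kernel_weight (cmod z) (cmod z) N k i) \<le> (r / real N) * (r * cmod z) ^ k"
      using w[of i] r by (intro mult_left_mono) auto
    then show "(r / real N) ^ Suc k * kernel_weight (cmod z) (cmod (z - 1)) N k i \<le> (r / real N) * (r * cmod z) ^ k"
      by (simp only: power_Suc mult.assoc z)
  qed simp
  also have "\<dots> = 2 * r * (r * cmod z) ^ k" using N by simp
  finally show ?thesis .
qed

text \<open>This is \<open>tanh y \<le> y\<close>: the auxiliary g is
  \<open>2 (t cosh t - sinh t)\<close>, with derivative \<open>2 t sinh t\<close>.\<close>

lemma one_minus_exp_le:
  assumes "0 \<le> (y::real)"
  shows "1 - y \<le> (1 + y) * exp (- (2 * y))"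
proof -
  define g where "g t = (1 + t) * exp (- t) - (1 - t) * exp t" for t :: real
  have "g 0 \<le> g y"
  proof (rule DERIV_nonneg_imp_nondecreasing[OF assms])
    fix t :: real assume t: "0 \<le> t"
    have "(g has_real_derivative t * exp t - t * exp (- t)) (at t)"
      unfolding g_def by (auto intro!: derivative_eq_intros simp: algebra_simps)
    moreover have "t * exp (- t) \<le> t * exp t" using t by (intro mult_left_mono) auto
    ultimately show "\<exists>d. (g has_real_derivative d) (at t) \<and> 0 \<le> d" by force
  qed
  then have "(1 - y) * exp y * exp (- y) \<le> (1 + y) * exp (- y) * exp (- y)"
    by (intro mult_right_mono) (auto simp: g_def)
  then show ?thesis by (simp add: mult.assoc mult_exp_exp)
qed

section \<open>Bounds in the limit of fine grids, on the unit interval and on circles\<close>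

lemma tendsto_exp_difference_quotient:
  assumes "(l::real) \<noteq> 0"
  shows "(\<lambda>N. c / (real N * (exp (l / real N) - 1))) \<longlonglongrightarrow> c / l"
proof -
  have "((\<lambda>h. (exp (0 + h) - exp 0) / h) \<longlongrightarrow> exp 0) (at (0::real))"
    using DERIV_exp[of "0::real"] unfolding DERIV_def .
  then have "((\<lambda>h. (exp h - 1) / h) \<longlongrightarrow> 1) (at (0::real))" by simp
  moreover have "filterlim (\<lambda>N. l / real N) (at 0) sequentially"
    unfolding filterlim_at
  proof
    show "\<forall>\<^sub>F N in sequentially. l / real N \<in> UNIV \<and> l / real N \<noteq> 0"
      using eventually_gt_at_top[of 0] by eventually_elim (use assms in auto)
    show "(\<lambda>N. l / real N) \<longlonglongrightarrow> 0" by (rule lim_const_over_n)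
  qed
  ultimately have "(\<lambda>N. (exp (l / real N) - 1) / (l / real N)) \<longlonglongrightarrow> 1"
    by (rule filterlim_compose)
  then have "(\<lambda>N. c / (l * ((exp (l / real N) - 1) / (l / real N)))) \<longlonglongrightarrow> c / (l * 1)"
    using assms by (intro tendsto_intros) auto
  then show ?thesis using assms by (simp add: mult.commute)
qed

lemma kernel_limit_exp_bound:
  fixes x :: "nat \<Rightarrow> nat \<Rightarrow> 'a::real_normed_algebra_1"
  assumes lim: "(\<lambda>N. kernel_sum (x N) N z k) \<longlonglongrightarrow> L" and r: "0 \<le> r"
    and x: "\<And>N j. j < N \<Longrightarrow> norm (x N j) \<le> r / real N"
    and l: "l \<noteq> 0" and sgn: "(cmod (z - 1) - cmod z * exp (- l)) / l \<le> 0" "0 \<le> (cmod z - cmod (z - 1)) / l"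
  shows "norm L \<le> 2 * r * exp \<bar>l\<bar> * exp \<bar>l\<bar> * (r * (cmod z - cmod (z - 1)) / l) ^ k"
proof (rule LIMSEQ_le)
  show "(\<lambda>N. norm (kernel_sum (x N) N z k)) \<longlonglongrightarrow> norm L" by (intro tendsto_norm lim)
  show "(\<lambda>N. 2 * r * exp \<bar>l\<bar> * exp \<bar>l\<bar> * (r * (cmod z - cmod (z - 1)) / (real N * (exp (l / real N) - 1))) ^ k)
     \<longlonglongrightarrow> 2 * r * exp \<bar>l\<bar> * exp \<bar>l\<bar> * (r * (cmod z - cmod (z - 1)) / l) ^ k"
    by (intro tendsto_intros tendsto_exp_difference_quotient l)
  show "\<exists>M. \<forall>N\<ge>M. norm (kernel_sum (x N) N z k)
     \<le> 2 * r * exp \<bar>l\<bar> * exp \<bar>l\<bar> * (r * (cmod z - cmod (z - 1)) / (real N * (exp (l / real N) - 1))) ^ k"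
    by (intro exI[of _ 1] allI impI kernel_sum_exp_bound r x l sgn) auto
qed

lemma kernel_limit_const_bound:
  fixes x :: "nat \<Rightarrow> nat \<Rightarrow> 'a::real_normed_algebra_1"
  assumes lim: "(\<lambda>N. kernel_sum (x N) N z k) \<longlonglongrightarrow> L" and r: "0 \<le> r"
    and x: "\<And>N j. j < N \<Longrightarrow> norm (x N j) \<le> r / real N"
    and z: "cmod (z - 1) = cmod z"
  shows "norm L \<le> 2 * r * (r * cmod z) ^ k"
proof (rule LIMSEQ_le_const2)
  show "(\<lambda>N. norm (kernel_sum (x N) N z k)) \<longlonglongrightarrow> norm L" by (intro tendsto_norm lim)
  show "\<exists>M. \<forall>N\<ge>M. norm (kernel_sum (x N) N z k) \<le> 2 * r * (r * cmod z) ^ k"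
    by (intro exI[of _ 1] allI impI kernel_sum_const_bound r x z) auto
qed

text \<open>With y = 2 u - 1 the weights are (1 + y)/2 and (1 - y)/2. The exponent l = 2 y gives the
  rate r y / (2 y) = r/2 exactly, and its sign condition is \<open>one_minus_exp_le\<close>. Because
  l stays in [-2, 2], the constant does not degenerate at u = 0 and u = 1.\<close>

lemma kernel_limit_real_bound:
  fixes x :: "nat \<Rightarrow> nat \<Rightarrow> 'a::real_normed_algebra_1"
  assumes lim: "(\<lambda>N. kernel_sum (x N) N (of_real u) k) \<longlonglongrightarrow> L" and r: "0 \<le> r"
    and x: "\<And>N j. j < N \<Longrightarrow> norm (x N j) \<le> r / real N" and u: "u \<in> {0..1}"
  shows "norm L \<le> 2 * r * exp 2 * exp 2 * (r / 2) ^ k"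
proof -
  have c: "cmod (of_real u) = u" "cmod (of_real u - 1) = 1 - u"
    using u norm_of_real[of "u - 1", where 'a=complex] by auto
  define y where "y = 2 * u - 1"
  have y: "\<bar>y\<bar> \<le> 1" using u by (auto simp: y_def)
  show ?thesis
  proof (cases "y = 0")
    case True
    have "norm L \<le> 2 * r * 1 * 1 * (r / 2) ^ k"
    proof -
      have u2: "u = 1 / 2" using True by (simp add: y_def)
      have "norm L \<le> 2 * r * (r * cmod (of_real u)) ^ k"
        by (rule kernel_limit_const_bound[OF lim r x]) (simp_all only: c, simp add: u2)
      then show ?thesis unfolding c u2 by simp
    qed
    also have "\<dots> \<le> 2 * r * exp 2 * exp 2 * (r / 2) ^ k"
      using r by (intro mult_mono) auto
    finally show ?thesis .
  next
    case False
    have "(cmod (of_real u - 1) - cmod (of_real u) * exp (- (2 * y))) / (2 * y) \<le> 0"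
    proof (cases "y > 0")
      case True
      then show ?thesis using one_minus_exp_le[of y] unfolding c
        by (intro divide_nonpos_pos) (auto simp: y_def algebra_simps)
    next
      case neg: False
      \<comment> \<open>The inequality for -y, multiplied by \<open>exp (- (2 * y))\<close>, gives
        the reversed inequality for y.\<close>
      then have "1 - (- y) \<le> (1 + (- y)) * exp (- (2 * (- y)))" by (intro one_minus_exp_le) auto
      then have "(1 + y) * exp (- (2 * y)) \<le> (1 - y) * (exp (2 * y) * exp (- (2 * y)))"
        using mult_right_mono[of "1 + y" "(1 - y) * exp (2 * y)" "exp (- (2 * y))"] by (simp add: mult.assoc)
      then have "(1 + y) * exp (- (2 * y)) \<le> 1 - y" by (simp add: mult_exp_exp)
      then show ?thesis using neg False unfolding c
        by (intro divide_nonneg_neg) (auto simp: y_def algebra_simps)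
    qed
    moreover have "0 \<le> (cmod (of_real u) - cmod (of_real u - 1)) / (2 * y)"
      unfolding c using False by (simp add: y_def zero_le_divide_iff) linarith
    ultimately have "norm L \<le> 2 * r * exp \<bar>2 * y\<bar> * exp \<bar>2 * y\<bar> * (r * (cmod (of_real u) - cmod (of_real u - 1)) / (2 * y)) ^ k"
      using False by (intro kernel_limit_exp_bound[OF lim r x]) auto
    also have "r * (cmod (of_real u) - cmod (of_real u - 1)) / (2 * y) = r / 2"
      using False unfolding c by (simp add: y_def field_simps)
    also have "2 * r * exp \<bar>2 * y\<bar> * exp \<bar>2 * y\<bar> * (r / 2) ^ k \<le> 2 * r * exp 2 * exp 2 * (r / 2) ^ k"
      using r y by (intro mult_mono) auto
    finally show ?thesis .
  qed
qed

text \<open>The ratio of the two weights is \<open>exp (Re \<zeta>)\<close>, so the exponent Re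
  \<zeta> gives a test function for which the first sign condition is an equality. The rate is below
  1 by \<open>two_sin_le\<close>. On the imaginary axis the weights agree, both being
  \<open>1 / (2 sin (cmod \<zeta> / 2))\<close>.\<close>

lemma kernel_limit_circle_bound:
  fixes x :: "nat \<Rightarrow> nat \<Rightarrow> 'a::real_normed_algebra_1"
  assumes lim: "\<And>k. (\<lambda>N. kernel_sum (x N) N (exp \<zeta> / (exp \<zeta> - 1)) k) \<longlonglongrightarrow> L k" and r: "0 \<le> r"
    and x: "\<And>N j. j < N \<Longrightarrow> norm (x N j) \<le> r / real N"
    and \<zeta>: "0 < cmod \<zeta>" "cmod \<zeta> < pi" "r < 2 * sin (cmod \<zeta> / 2)"
  shows "\<exists>D s. 0 \<le> s \<and> s < 1 \<and> (\<forall>k. norm (L k) \<le> D * s ^ k)"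
proof -
  define z where "z = exp \<zeta> / (exp \<zeta> - 1)"
  define c where "c = cmod (exp \<zeta> - 1)"
  have s0: "0 < 2 * sin (cmod \<zeta> / 2)" using \<zeta> r by linarith
  show ?thesis
  proof (cases "Re \<zeta> = 0")
    case True
    then have e: "\<zeta> = \<i> * of_real (Im \<zeta>)" by (simp add: complex_eq_iff)
    have im: "cmod \<zeta> = \<bar>Im \<zeta>\<bar>" using True by (simp add: cmod_def)
    have "c = 2 * \<bar>sin (Im \<zeta> / 2)\<bar>" unfolding c_def by (subst e) (rule dist_exp_i_1)
    also have "\<dots> = 2 * sin (cmod \<zeta> / 2)"
      using s0 unfolding im by (cases "Im \<zeta> \<ge> 0") auto
    finally have c: "c = 2 * sin (cmod \<zeta> / 2)" .
    have ne: "exp \<zeta> - 1 \<noteq> 0" using c s0 by (auto simp: c_def)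
    have "z - 1 = 1 / (exp \<zeta> - 1)" using ne by (simp add: z_def field_simps)
    then have n: "cmod z = 1 / c" "cmod (z - 1) = 1 / c"
      using True by (simp_all add: z_def c_def norm_divide norm_exp_eq_Re)
    have "norm (L k) \<le> 2 * r * (r * cmod z) ^ k" for k
      using kernel_limit_const_bound[OF lim[folded z_def] r x] n by simp
    moreover have "0 \<le> r * cmod z" "r * cmod z < 1"
      using r s0 \<zeta>(3) by (simp_all add: n c)
    ultimately show ?thesis by blast
  next
    case False
    have lb: "2 * sin (cmod \<zeta> / 2) \<le> Re \<zeta> * c / (exp (Re \<zeta>) - 1)"
      unfolding c_def using \<zeta> False by (intro two_sin_le) auto
    have "c \<noteq> 0" using lb s0 by auto
    then have ne: "exp \<zeta> - 1 \<noteq> 0" and c0: "c > 0" by (auto simp: c_def)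
    have "z - 1 = 1 / (exp \<zeta> - 1)" using ne by (simp add: z_def field_simps)
    then have n: "cmod z = exp (Re \<zeta>) / c" "cmod (z - 1) = 1 / c"
      by (simp_all add: z_def c_def norm_divide norm_exp_eq_Re)
    have eq: "(cmod z - cmod (z - 1)) / Re \<zeta> = (exp (Re \<zeta>) - 1) / (Re \<zeta> * c)"
      by (simp add: n diff_divide_distrib[symmetric])
    have pos: "(exp (Re \<zeta>) - 1) / (Re \<zeta> * c) > 0"
      using False c0 by (cases "Re \<zeta> > 0") (auto simp: zero_less_divide_iff mult_less_0_iff)
    define s where "s = r * (cmod z - cmod (z - 1)) / Re \<zeta>"
    have s: "s = r * ((exp (Re \<zeta>) - 1) / (Re \<zeta> * c))"
      unfolding s_def times_divide_eq_right[symmetric] eq ..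
    have "norm (L k) \<le> 2 * r * exp \<bar>Re \<zeta>\<bar> * exp \<bar>Re \<zeta>\<bar> * s ^ k" for k
      unfolding s_def
    proof (rule kernel_limit_exp_bound[OF lim[folded z_def] r x False])
      show "(cmod (z - 1) - cmod z * exp (- Re \<zeta>)) / Re \<zeta> \<le> 0"
        by (simp add: n mult_exp_exp)
      show "0 \<le> (cmod z - cmod (z - 1)) / Re \<zeta>" using pos unfolding eq by simp
    qed
    moreover have "0 \<le> s" unfolding s using r pos by (intro mult_nonneg_nonneg) auto
    moreover have "s < 1"
    proof -
      have "r < Re \<zeta> * c / (exp (Re \<zeta>) - 1)" using lb \<zeta>(3) by linarith
      also have "\<dots> = 1 / ((exp (Re \<zeta>) - 1) / (Re \<zeta> * c))" by simp
      finally show ?thesis unfolding s using pos by (simp only: pos_less_divide_eq)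
    qed
    ultimately show ?thesis by blast
  qed
qed



subsection \<open>Permutations, increasing tuples and lists\<close>

definition inc_tuples :: "nat \<Rightarrow> nat \<Rightarrow> (nat \<Rightarrow> nat) set" where
  "inc_tuples k N = {c \<in> {1..k} \<rightarrow>\<^sub>E {..<N}. \<forall>i\<in>{1..<k}. c i < c (Suc i)}"

definition inj_tuples :: "nat \<Rightarrow> nat \<Rightarrow> (nat \<Rightarrow> nat) set" where
  "inj_tuples k N = {c \<in> {1..k} \<rightarrow>\<^sub>E {..<N}. inj_on c {1..k}}"

lemma finite_inj_tuples: "finite (inj_tuples k N)"
  by (auto simp: inj_tuples_def finite_PiE)

lemma inc_tuples_less:
  assumes "c \<in> inc_tuples k N" "1 \<le> i" "i < j" "j \<le> k"
  shows "c i < c j"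
  using assms(3,4)
proof (induction j)
  case (Suc j)
  have "c j < c (Suc j)" if "j \<ge> 1" using assms(1) Suc.prems that by (auto simp: inc_tuples_def)
  then show ?case using Suc assms(2) by (cases "i = j") (auto simp: less_Suc_eq)
qed simp

lemma inc_tuples_subset_inj: "inc_tuples k N \<subseteq> inj_tuples k N"
proof
  fix c assume c: "c \<in> inc_tuples k N"
  have "inj_on c {1..k}"
  proof (rule linorder_inj_onI')
    fix i j assume "i \<in> {1..k}" "j \<in> {1..k}" "i < j"
    then show "c i \<noteq> c j" using inc_tuples_less[OF c, of i j] by simp
  qed
  then show "c \<in> inj_tuples k N" using c by (auto simp: inc_tuples_def inj_tuples_def)
qed

lemma inj_tuples_des_eq_0:
  assumes "c \<in> inj_tuples k N"
  shows "des k c = 0 \<longleftrightarrow> c \<in> inc_tuples k N"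
proof -
  have "c i \<noteq> c (Suc i)" if "i \<in> {1..<k}" for i
    using assms that inj_on_contraD[of c "{1..k}" i "Suc i"] by (auto simp: inj_tuples_def)
  then have "\<not> c (Suc i) < c i \<longleftrightarrow> c i < c (Suc i)" if "i \<in> {1..<k}" for i
    using that by (meson linorder_less_linear order_less_asym)
  then have "{i \<in> {1..<k}. c (Suc i) < c i} = {} \<longleftrightarrow> (\<forall>i\<in>{1..<k}. c i < c (Suc i))"
    by blast
  then show ?thesis using assms by (simp add: des_def inc_tuples_def inj_tuples_def)
qed

lemma inc_tuples_eq_iff_image:
  assumes "c \<in> inc_tuples k N" "c' \<in> inc_tuples k N" "c ` {1..k} = c' ` {1..k}"
  shows "c = c'"
proof -
  have s: "sorted (map d [1..<Suc k]) \<and> distinct (map d [1..<Suc k])" if d: "d \<in> inc_tuples k N" for d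
  proof
    show "sorted (map d [1..<Suc k])"
      unfolding sorted_iff_nth_mono_less
    proof (intro allI impI)
      fix i j assume "i < j" "j < length (map d [1..<Suc k])"
      then show "map d [1..<Suc k] ! i \<le> map d [1..<Suc k] ! j"
        using inc_tuples_less[OF d, of "Suc i" "Suc j"] by (simp del: upt_Suc)
    qed
    show "distinct (map d [1..<Suc k])"
      using subsetD[OF inc_tuples_subset_inj d]
      by (simp add: distinct_map inj_tuples_def atLeastLessThanSuc_atLeastAtMost del: upt_Suc)
  qed
  have "map c [1..<Suc k] = map c' [1..<Suc k]"
    using s[OF assms(1)] s[OF assms(2)] assms(3)
    by (intro sorted_distinct_set_unique) (auto simp: atLeastLessThanSuc_atLeastAtMost simp del: upt_Suc)
  then have "c i = c' i" if "i \<in> {1..k}" for i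
    using that by (simp add: atLeastLessThanSuc_atLeastAtMost del: upt_Suc)
  then show ?thesis
    using assms(1,2) by (intro PiE_ext[of c _ "\<lambda>_. {..<N}" c']) (auto simp: inc_tuples_def)
qed

lemma ex_inc_tuple_image:
  assumes "S \<subseteq> {..<N}" "card S = k"
  shows "\<exists>c \<in> inc_tuples k N. c ` {1..k} = S"
proof -
  have fS: "finite S" using assms(1) finite_subset by blast
  define c where "c = (\<lambda>i\<in>{1..k}. sorted_list_of_set S ! (i - 1))"
  have len: "length (sorted_list_of_set S) = k" using assms(2) by simp
  have im: "c ` {1..k} = S"
  proof -
    have "c ` {1..k} = (\<lambda>i. sorted_list_of_set S ! i) ` {..<k}"
    proof (intro set_eqI iffI)
      fix y assume "y \<in> (\<lambda>i. sorted_list_of_set S ! i) ` {..<k}"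
      then obtain i where "i < k" "y = sorted_list_of_set S ! i" by auto
      then show "y \<in> c ` {1..k}" by (intro image_eqI[of _ _ "Suc i"]) (auto simp: c_def)
    qed (auto simp: c_def)
    also have "\<dots> = set (sorted_list_of_set S)" using len by (auto simp: set_conv_nth)
    finally show ?thesis using fS by simp
  qed
  have "c \<in> inc_tuples k N"
    unfolding inc_tuples_def
  proof (intro CollectI conjI ballI)
    show "c \<in> {1..k} \<rightarrow>\<^sub>E {..<N}" using im assms(1) by (auto simp: c_def PiE_iff extensional_def)
    fix i assume i: "i \<in> {1..<k}"
    have "sorted_wrt (<) (sorted_list_of_set S)" by simp
    then have "sorted_list_of_set S ! (i - 1) < sorted_list_of_set S ! i"
      using sorted_wrt_nth_less[of "(<)" "sorted_list_of_set S" "i - 1" i] i len by simp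
    then show "c i < c (Suc i)" using i by (simp add: c_def)
  qed
  then show ?thesis using im by blast
qed

text \<open>The image of an injective tuple determines its increasing rearrangement c, and then the
  permutation is forced. Sums over permutations of ordered tuples thus become sums over all
  injective tuples.\<close>

lemma bij_betw_inc_perm:
  "bij_betw (\<lambda>(c, \<sigma>). c \<circ> \<sigma>) (inc_tuples k N \<times> {\<sigma>. \<sigma> permutes {1..k}}) (inj_tuples k N)"
  unfolding bij_betw_def
proof (intro conjI set_eqI iffI)
  have injc: "inj_on c {1..k}" if "c \<in> inc_tuples k N" for c
    using subsetD[OF inc_tuples_subset_inj that] by (simp add: inj_tuples_def)
  have img: "(c \<circ> \<sigma>) ` {1..k} = c ` {1..k}" if "\<sigma> permutes {1..k}" for c :: "nat \<Rightarrow> nat" and \<sigma>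
    by (simp only: image_comp[symmetric] permutes_image[OF that])
  show "inj_on (\<lambda>(c, \<sigma>). c \<circ> \<sigma>) (inc_tuples k N \<times> {\<sigma>. \<sigma> permutes {1..k}})"
  proof (rule inj_onI, clarsimp)
    fix c \<sigma> c' \<sigma>'
    assume a: "c \<in> inc_tuples k N" "\<sigma> permutes {Suc 0..k}" "c' \<in> inc_tuples k N" "\<sigma>' permutes {Suc 0..k}"
      "c \<circ> \<sigma> = c' \<circ> \<sigma>'"
    have cc: "c = c'"
      using img[of \<sigma> c] img[of \<sigma>' c'] a by (intro inc_tuples_eq_iff_image[OF a(1,3)]) simp
    have "\<sigma> i = \<sigma>' i" for i
    proof (cases "i \<in> {1..k}")
      case True
      have "c (\<sigma> i) = c (\<sigma>' i)" using a(5) cc by (metis comp_apply)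
      then show ?thesis
        using inj_onD[OF injc[OF a(1)], of "\<sigma> i" "\<sigma>' i"] permutes_in_image[OF a(2), of i] permutes_in_image[OF a(4), of i] True
        by simp
    next
      case False
      then show ?thesis using a(2,4) by (simp add: permutes_not_in)
    qed
    then show "c = c' \<and> \<sigma> = \<sigma>'" using cc by auto
  qed
  fix d
  {
    assume "d \<in> (\<lambda>(c, \<sigma>). c \<circ> \<sigma>) ` (inc_tuples k N \<times> {\<sigma>. \<sigma> permutes {1..k}})"
    then obtain c \<sigma> where c: "c \<in> inc_tuples k N" and \<sigma>: "\<sigma> permutes {1..k}" and d: "d = c \<circ> \<sigma>" by auto
    have "inj_on (c \<circ> \<sigma>) {1..k}"
      using injc[OF c] permutes_image[OF \<sigma>] by (intro comp_inj_on permutes_inj_on[OF \<sigma>]) simp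
    moreover have "c \<circ> \<sigma> \<in> {1..k} \<rightarrow>\<^sub>E {..<N}"
    proof (rule PiE_I)
      fix i assume "i \<in> {1..k}"
      then have "\<sigma> i \<in> {1..k}" using permutes_in_image[OF \<sigma>] by simp
      then show "(c \<circ> \<sigma>) i \<in> {..<N}" using c by (auto simp: inc_tuples_def PiE_iff)
    next
      fix i assume "i \<notin> {1..k}"
      then show "(c \<circ> \<sigma>) i = undefined"
        using c permutes_not_in[OF \<sigma>, of i] by (auto simp: inc_tuples_def PiE_iff extensional_def)
    qed
    ultimately show "d \<in> inj_tuples k N" unfolding d by (simp add: inj_tuples_def)
  next
    assume d: "d \<in> inj_tuples k N"
    have "card (d ` {1..k}) = k" using d by (simp add: inj_tuples_def card_image)
    moreover have "d ` {1..k} \<subseteq> {..<N}" using d by (auto simp: inj_tuples_def PiE_iff)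
    ultimately obtain c where c: "c \<in> inc_tuples k N" "c ` {1..k} = d ` {1..k}"
      using ex_inc_tuple_image by metis
    define \<sigma> where "\<sigma> i = (if i \<in> {1..k} then inv_into {1..k} c (d i) else i)" for i
    have cs: "c (\<sigma> i) = d i" "\<sigma> i \<in> {1..k}" if "i \<in> {1..k}" for i
    proof -
      have "d i \<in> c ` {1..k}" using c(2) that by simp
      then show "c (\<sigma> i) = d i" "\<sigma> i \<in> {1..k}"
        using that f_inv_into_f[of "d i" c "{1..k}"] inv_into_into[of "d i" c "{1..k}"] by (simp_all add: \<sigma>_def)
    qed
    have "inj_on \<sigma> {1..k}"
    proof (rule inj_onI)
      fix i j assume ij: "i \<in> {1..k}" "j \<in> {1..k}" "\<sigma> i = \<sigma> j"
      then have "d i = d j" using cs(1)[of i] cs(1)[of j] by simp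
      then show "i = j" using d ij(1,2) by (auto simp: inj_tuples_def dest: inj_onD)
    qed
    moreover have "\<sigma> ` {1..k} \<subseteq> {1..k}" using cs(2) by blast
    ultimately have "bij_betw \<sigma> {1..k} {1..k}"
      by (simp add: bij_betw_def endo_inj_surj)
    then have \<sigma>: "\<sigma> permutes {1..k}" by (rule bij_imp_permutes) (auto simp: \<sigma>_def)
    have "d = c \<circ> \<sigma>"
    proof
      fix i show "d i = (c \<circ> \<sigma>) i"
      proof (cases "i \<in> {1..k}")
        case False
        then have "\<sigma> i = i" by (simp only: \<sigma>_def if_False)
        then show ?thesis
          using False d c(1) by (auto simp: inj_tuples_def inc_tuples_def PiE_iff extensional_def)
      qed (use cs in simp)
    qed
    then show "d \<in> (\<lambda>(c, \<sigma>). c \<circ> \<sigma>) ` (inc_tuples k N \<times> {\<sigma>. \<sigma> permutes {1..k}})"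
      using c(1) \<sigma> by (intro image_eqI[of _ _ "(c, \<sigma>)"]) auto
  }
qed

lemma asc_des_comp_inc:
  assumes "c \<in> inc_tuples k N" "\<sigma> permutes {1..k}"
  shows "asc k (c \<circ> \<sigma>) = asc k \<sigma>" "des k (c \<circ> \<sigma>) = des k \<sigma>"
proof -
  have "c (\<sigma> i) < c (\<sigma> j) \<longleftrightarrow> \<sigma> i < \<sigma> j" if "i \<in> {1..k}" "j \<in> {1..k}" for i j
  proof -
    have s: "\<sigma> i \<in> {1..k}" "\<sigma> j \<in> {1..k}" using permutes_in_image[OF assms(2)] that by auto
    show ?thesis
      using s inc_tuples_less[OF assms(1), of "\<sigma> i" "\<sigma> j"] inc_tuples_less[OF assms(1), of "\<sigma> j" "\<sigma> i"]
      by (cases "\<sigma> i" "\<sigma> j" rule: linorder_cases) auto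
  qed
  then show "asc k (c \<circ> \<sigma>) = asc k \<sigma>" "des k (c \<circ> \<sigma>) = des k \<sigma>"
    unfolding asc_def des_def by (auto intro!: arg_cong[where f=card])
qed

text \<open>For increasing c the tuple \<open>c \<circ> \<sigma>\<close> has the same ascents and
  descents as \<sigma>, so the weight can be read off the tuple itself.\<close>

lemma sum_inc_mu_param:
  "(\<Sum>c\<in>inc_tuples k N. mu_param l k (\<lambda>i. x (c i)))
   = (\<Sum>c\<in>inj_tuples k N. (l ^ asc k c * (l - 1) ^ des k c) *\<^sub>R prod_list (map (\<lambda>i. x (c i)) [1..<Suc k]))"
    (is "_ = (\<Sum>c\<in>_. ?g c)")
proof -
  have "(\<Sum>c\<in>inj_tuples k N. ?g c)
     = (\<Sum>(c, \<sigma>)\<in>inc_tuples k N \<times> {\<sigma>. \<sigma> permutes {1..k}}. ?g (c \<circ> \<sigma>))"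
    by (subst sum.reindex_bij_betw[OF bij_betw_inc_perm, symmetric]) (simp add: case_prod_beta)
  also have "\<dots> = (\<Sum>c\<in>inc_tuples k N. \<Sum>\<sigma> | \<sigma> permutes {1..k}. ?g (c \<circ> \<sigma>))"
    by (rule sum.cartesian_product[symmetric])
  also have "\<dots> = (\<Sum>c\<in>inc_tuples k N. mu_param l k (\<lambda>i. x (c i)))"
    unfolding mu_param_def by (intro sum.cong refl) (auto simp: asc_des_comp_inc)
  finally show ?thesis ..
qed

text \<open>Parameter 1: the factor \<open>0 ^ des\<close> annihilates tuples with a descent and
  equals 1 on the increasing ones. The weight is left unsimplified so that it matches the general
  form at l = 1.\<close>

lemma sum_inc_prod_list:
  "(\<Sum>c\<in>inc_tuples k N. prod_list (map (\<lambda>i. x (c i)) [1..<Suc k]))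
   = (\<Sum>c\<in>inj_tuples k N. ((1::real) ^ asc k c * (1 - 1) ^ des k c) *\<^sub>R
        (prod_list (map (\<lambda>i. x (c i)) [1..<Suc k]) :: 'a::real_algebra_1))"
proof -
  have "(\<Sum>c\<in>inj_tuples k N. ((1::real) ^ asc k c * (1 - 1) ^ des k c) *\<^sub>R prod_list (map (\<lambda>i. x (c i)) [1..<Suc k]))
      = (\<Sum>c\<in>inj_tuples k N. if c \<in> inc_tuples k N then prod_list (map (\<lambda>i. x (c i)) [1..<Suc k]) else 0)"
    by (intro sum.cong refl) (simp add: inj_tuples_des_eq_0 power_0_left del: upt_Suc)
  also have "\<dots> = (\<Sum>c\<in>inc_tuples k N. prod_list (map (\<lambda>i. x (c i)) [1..<Suc k]))"
    using inc_tuples_subset_inj finite_inj_tuples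
    by (intro sum.mono_neutral_cong_right) auto
  finally show ?thesis ..
qed

section \<open>Words of cells and the contribution of repetitions\<close>

fun list_weight :: "real \<Rightarrow> nat list \<Rightarrow> real" where
  "list_weight l (i # j # L) = (if i < j then l else l - 1) * list_weight l (j # L)"
| "list_weight l L = 1"

definition nat_lists :: "nat \<Rightarrow> nat \<Rightarrow> nat list set" where
  "nat_lists N k = {L. set L \<subseteq> {..<N} \<and> length L = k}"

lemma finite_nat_lists: "finite (nat_lists N k)"
  unfolding nat_lists_def by (rule finite_lists_length_eq) simp

lemma nat_lists_0: "nat_lists N 0 = {[]}"
  by (auto simp: nat_lists_def)

lemma sum_nat_lists_Suc:
  "(\<Sum>L\<in>nat_lists N (Suc k). f L) = (\<Sum>j<N. \<Sum>L\<in>nat_lists N k. f (j # L))"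
proof -
  have "bij_betw (\<lambda>(j, L). j # L) ({..<N} \<times> nat_lists N k) (nat_lists N (Suc k))"
    by (rule bij_betwI[where g="\<lambda>L. (hd L, tl L)"]) (auto simp: nat_lists_def length_Suc_conv)
  then have "(\<Sum>x\<in>{..<N} \<times> nat_lists N k. f ((\<lambda>(j, L). j # L) x)) = (\<Sum>L\<in>nat_lists N (Suc k). f L)"
    by (rule sum.reindex_bij_betw)
  then show ?thesis by (simp add: sum.cartesian_product case_prod_beta)
qed

lemma kernel_sum_from_lists:
  "kernel_sum_from x N (of_real l) k i
   = of_re (\<Sum>L\<in>nat_lists N k. list_weight l (i # L) *\<^sub>R prod_list (map x (i # L)))"
proof (induction k arbitrary: i)
  case (Suc k)
  have ker: "of_cx (asc_kernel (of_real l) i j) = (if i < j then l else l - 1) *\<^sub>R 1" for j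
    by (simp add: asc_kernel_def of_cx_of_real[symmetric])
  have "kernel_sum_from x N (of_real l) (Suc k) i
      = of_re (x i * (\<Sum>j<N. (if i < j then l else l - 1) *\<^sub>R
          (\<Sum>L\<in>nat_lists N k. list_weight l (j # L) *\<^sub>R prod_list (map x (j # L)))))"
    unfolding kernel_sum_from.simps Suc ker by (simp only: of_re_simps of_re_sum of_re_scaleR mult_scaleR_left mult_1_left)
  also have "\<dots> = of_re (\<Sum>L\<in>nat_lists N (Suc k). list_weight l (i # L) *\<^sub>R prod_list (map x (i # L)))"
    unfolding sum_nat_lists_Suc sum_distrib_left scaleR_sum_right
    by (intro arg_cong[where f=of_re] sum.cong refl) simp
  finally show ?case .
qed (simp add: nat_lists_0)

lemma kernel_sum_lists:
  "kernel_sum x N (of_real l) k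
   = of_re (\<Sum>L\<in>nat_lists N (Suc k). list_weight l L *\<^sub>R prod_list (map x L))"
  unfolding kernel_sum_def kernel_sum_from_lists sum_nat_lists_Suc by (simp only: of_re_sum)

lemma list_weight_upt:
  "list_weight l (map c [m..<m + Suc k]) = (\<Prod>i\<in>{m..<m + k}. if c i < c (Suc i) then l else l - 1)"
proof (induction k arbitrary: m)
  case (Suc k)
  have "list_weight l (map c [m..<m + Suc (Suc k)]) = list_weight l (c m # map c [Suc m..<Suc m + Suc k])"
    by (subst upt_conv_Cons) auto
  also have "\<dots> = (if c m < c (Suc m) then l else l - 1) * list_weight l (map c [Suc m..<Suc m + Suc k])"
    by (simp add: upt_conv_Cons[of "Suc m"] del: upt_Suc)
  also have "\<dots> = (\<Prod>i\<in>{m..<m + Suc k}. if c i < c (Suc i) then l else l - 1)"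
    unfolding Suc by (subst prod.atLeast_Suc_lessThan[of m]) auto
  finally show ?case .
qed simp

lemma list_weight_inj_tuple:
  assumes "c \<in> inj_tuples (Suc k) N"
  shows "list_weight l (map c [1..<Suc (Suc k)]) = l ^ asc (Suc k) c * (l - 1) ^ des (Suc k) c"
proof -
  have "\<not> c i < c (Suc i) \<longleftrightarrow> c (Suc i) < c i" if "i \<in> {1..<Suc k}" for i
    using assms that inj_on_contraD[of c "{1..Suc k}" i "Suc i"] by (auto simp: inj_tuples_def)
  then have d: "{i \<in> {1..<Suc k}. \<not> c i < c (Suc i)} = {i \<in> {1..<Suc k}. c (Suc i) < c i}" by blast
  have "list_weight l (map c [1..<Suc (Suc k)]) = (\<Prod>i\<in>{1..<Suc k}. if c i < c (Suc i) then l else l - 1)"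
    using list_weight_upt[of l c 1 k] by simp
  also have "\<dots> = l ^ card ({1..<Suc k} \<inter> {i. c i < c (Suc i)}) * (l - 1) ^ card ({1..<Suc k} \<inter> - {i. c i < c (Suc i)})"
    by (subst prod.If_cases) (simp_all only: finite_atLeastLessThan prod_constant)
  finally have p: "list_weight l (map c [1..<Suc (Suc k)])
    = l ^ card ({1..<Suc k} \<inter> {i. c i < c (Suc i)}) * (l - 1) ^ card ({1..<Suc k} \<inter> - {i. c i < c (Suc i)})" .
  have a: "{1..<Suc k} \<inter> {i. c i < c (Suc i)} = {i \<in> {1..<Suc k}. c i < c (Suc i)}" by blast
  have b: "{1..<Suc k} \<inter> - {i. c i < c (Suc i)} = {i \<in> {1..<Suc k}. \<not> c i < c (Suc i)}" by blast
  show ?thesis by (simp only: p a b d asc_def des_def)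
qed

lemma bij_betw_tuples_lists:
  "bij_betw (\<lambda>c. map c [1..<Suc k]) ({1..k} \<rightarrow>\<^sub>E {..<N}) (nat_lists N k)"
proof (rule bij_betwI[where g="\<lambda>L. \<lambda>i\<in>{1..k}. L ! (i - 1)"])
  show "(\<lambda>c. map c [1..<Suc k]) \<in> ({1..k} \<rightarrow>\<^sub>E {..<N}) \<rightarrow> nat_lists N k"
    by (auto simp: nat_lists_def PiE_iff simp del: upt_Suc)
  show "(\<lambda>L. \<lambda>i\<in>{1..k}. L ! (i - 1)) \<in> nat_lists N k \<rightarrow> {1..k} \<rightarrow>\<^sub>E {..<N}"
  proof (intro funcsetI PiE_I)
    fix L i assume "L \<in> nat_lists N k" "i \<in> {1..k}"
    then have "L ! (i - 1) \<in> set L" "set L \<subseteq> {..<N}" by (auto simp: nat_lists_def)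
    then show "(\<lambda>i\<in>{1..k}. L ! (i - 1)) i \<in> {..<N}" using \<open>i \<in> {1..k}\<close> by auto
  next
    fix L :: "nat list" and i assume "i \<notin> {1..k}"
    then show "(\<lambda>i\<in>{1..k}. L ! (i - 1)) i = undefined" by (simp only: restrict_def if_False)
  qed
  show "(\<lambda>i\<in>{1..k}. map c [1..<Suc k] ! (i - 1)) = c" if "c \<in> {1..k} \<rightarrow>\<^sub>E {..<N}" for c
    using that by (auto simp: fun_eq_iff PiE_iff extensional_def simp del: upt_Suc)
  show "map (\<lambda>i\<in>{1..k}. L ! (i - 1)) [1..<Suc k] = L" if "L \<in> nat_lists N k" for L
    using that by (intro nth_equalityI) (auto simp: nat_lists_def simp del: upt_Suc)
qed

lemma sum_inj_tuples_lists:
  "(\<Sum>c\<in>inj_tuples k N. f (map c [1..<Suc k])) = (\<Sum>L | L \<in> nat_lists N k \<and> distinct L. f L)"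
proof -
  have "bij_betw (\<lambda>c. map c [1..<Suc k]) (inj_tuples k N) {L. L \<in> nat_lists N k \<and> distinct L}"
    unfolding bij_betw_def
  proof
    show "inj_on (\<lambda>c. map c [1..<Suc k]) (inj_tuples k N)"
      by (rule inj_on_subset[OF bij_betw_imp_inj_on[OF bij_betw_tuples_lists]]) (auto simp: inj_tuples_def)
    have d: "distinct (map c [1..<Suc k]) \<longleftrightarrow> inj_on c {1..k}" for c :: "nat \<Rightarrow> nat"
      by (simp add: distinct_map atLeastLessThanSuc_atLeastAtMost del: upt_Suc)
    show "(\<lambda>c. map c [1..<Suc k]) ` inj_tuples k N = {L. L \<in> nat_lists N k \<and> distinct L}"
    proof (intro set_eqI iffI)
      fix L assume "L \<in> (\<lambda>c. map c [1..<Suc k]) ` inj_tuples k N"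
      then obtain c where c: "c \<in> {1..k} \<rightarrow>\<^sub>E {..<N}" "inj_on c {1..k}" "L = map c [1..<Suc k]"
        by (auto simp only: inj_tuples_def)
      then show "L \<in> {L. L \<in> nat_lists N k \<and> distinct L}"
        using bij_betw_apply[OF bij_betw_tuples_lists c(1)] d[of c] by simp
    next
      fix L assume L: "L \<in> {L. L \<in> nat_lists N k \<and> distinct L}"
      then have "L \<in> (\<lambda>c. map c [1..<Suc k]) ` ({1..k} \<rightarrow>\<^sub>E {..<N})"
        using bij_betw_imp_surj_on[OF bij_betw_tuples_lists, of k N] by simp
      then obtain c where c: "c \<in> {1..k} \<rightarrow>\<^sub>E {..<N}" "L = map c [1..<Suc k]" by blast
      then have "c \<in> inj_tuples k N" using L d[of c] by (simp add: inj_tuples_def)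
      then show "L \<in> (\<lambda>c. map c [1..<Suc k]) ` inj_tuples k N" using c(2) by blast
    qed
  qed
  then show ?thesis by (rule sum.reindex_bij_betw)
qed

text \<open>There are N (N - 1) ... (N - k + 1) words without repetition, which is at least
  \<open>(N - k) ^ k\<close>. For k > N the truncated difference makes this lower bound
  trivial.\<close>

lemma card_nondistinct_le:
  "real (card {L \<in> nat_lists N k. \<not> distinct L}) \<le> real N ^ k - real (N - k) ^ k"
proof -
  have tot: "card (nat_lists N k) = N ^ k"
    unfolding nat_lists_def by (subst card_lists_length_eq) auto
  have "(N - k) ^ k \<le> card {L \<in> nat_lists N k. distinct L}"
  proof (cases "k \<le> N")
    case True
    have "{L \<in> nat_lists N k. distinct L} = {L. length L = k \<and> distinct L \<and> set L \<subseteq> {..<N}}"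
      by (auto simp: nat_lists_def)
    then have "card {L \<in> nat_lists N k. distinct L} = \<Prod>{N - k + 1..N}"
      using card_lists_distinct_length_eq[of "{..<N}" k] True by simp
    moreover have "(\<Prod>i\<in>{N - k + 1..N}. N - k) \<le> \<Prod>{N - k + 1..N}"
      by (intro prod_mono) auto
    ultimately show ?thesis using True by simp
  next
    case False
    then show ?thesis by (cases k) auto
  qed
  then have "real ((N - k) ^ k) \<le> real (card {L \<in> nat_lists N k. distinct L})" by (simp only: of_nat_le_iff)
  moreover have "card {L \<in> nat_lists N k. distinct L} + card {L \<in> nat_lists N k. \<not> distinct L} = N ^ k"
    unfolding tot[symmetric]
    by (subst card_Un_disjoint[symmetric]) (auto intro!: arg_cong[where f=card] finite_subset[OF _ finite_nat_lists])
  ultimately show ?thesis by (simp flip: of_nat_power of_nat_add)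
qed

lemma card_noninjective_le:
  "real (card {c \<in> {1..k} \<rightarrow>\<^sub>E {..<N}. \<not> inj_on c {1..k}}) \<le> real N ^ k - real (N - k) ^ k"
proof -
  have "(\<lambda>c. map c [1..<Suc k]) ` {c \<in> {1..k} \<rightarrow>\<^sub>E {..<N}. \<not> inj_on c {1..k}} \<subseteq> {L \<in> nat_lists N k. \<not> distinct L}"
    using bij_betw_imp_surj_on[OF bij_betw_tuples_lists, of k N]
    by (auto simp: distinct_map atLeastLessThanSuc_atLeastAtMost simp del: upt_Suc)
  moreover have "inj_on (\<lambda>c. map c [1..<Suc k]) {c \<in> {1..k} \<rightarrow>\<^sub>E {..<N}. \<not> inj_on c {1..k}}"
    by (rule inj_on_subset[OF bij_betw_imp_inj_on[OF bij_betw_tuples_lists]]) auto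
  ultimately have "card {c \<in> {1..k} \<rightarrow>\<^sub>E {..<N}. \<not> inj_on c {1..k}} \<le> card {L \<in> nat_lists N k. \<not> distinct L}"
    by (intro card_inj_on_le) (auto intro: finite_subset[OF _ finite_nat_lists])
  then show ?thesis using card_nondistinct_le[of N k] by linarith
qed

text \<open>The total mass of tuples with a repetition when every cell has mass at most r/N. Its
  vanishing is where the absence of atoms takes effect.\<close>

lemma noninjective_fraction_tendsto: "(\<lambda>N. (real N ^ k - real (N - k) ^ k) * (r / real N) ^ k) \<longlonglongrightarrow> 0"
proof -
  have "(\<lambda>N. (1 - (1 - real k / real N) ^ k) * r ^ k) \<longlonglongrightarrow> (1 - (1 - 0) ^ k) * r ^ k"
    by (intro tendsto_intros lim_const_over_n)
  then have "(\<lambda>N. (1 - (1 - real k / real N) ^ k) * r ^ k) \<longlonglongrightarrow> 0" by simp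
  moreover have "\<forall>\<^sub>F N in sequentially. (1 - (1 - real k / real N) ^ k) * r ^ k = (real N ^ k - real (N - k) ^ k) * (r / real N) ^ k"
    using eventually_ge_at_top[of "Suc k"]
  proof eventually_elim
    case (elim N)
    then have "1 - real k / real N = real (N - k) / real N" by (simp add: field_simps of_nat_diff)
    then show ?case using elim by (simp add: power_divide field_simps)
  qed
  ultimately show ?thesis by (rule Lim_transform_eventually)
qed

lemma norm_prod_list_le:
  fixes X :: "'b \<Rightarrow> 'a::real_normed_algebra_1"
  assumes "\<And>i. i \<in> set L \<Longrightarrow> norm (X i) \<le> d"
  shows "norm (prod_list (map X L)) \<le> d ^ length L"
  using assms
proof (induction L)
  case (Cons a L)
  have "norm (X a * prod_list (map X L)) \<le> norm (X a) * norm (prod_list (map X L))" by (rule norm_mult_ineq)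
  also have "\<dots> \<le> d * d ^ length L"
    using Cons order_trans[OF norm_ge_zero, of "X a" d] by (intro mult_mono) auto
  finally show ?case by simp
qed simp

lemma abs_list_weight_le:
  assumes "l \<in> {0..1}"
  shows "\<bar>list_weight l L\<bar> \<le> 1"
proof (induction L rule: induct_list012)
  case (3 i j L)
  have "\<bar>if i < j then l else l - 1\<bar> * \<bar>list_weight l (j # L)\<bar> \<le> 1 * 1"
    using assms 3 by (intro mult_mono) auto
  then show ?case by (simp add: abs_mult)
qed auto

text \<open>The two sums differ by the words with a repetition, whose weights are at most 1 in
  absolute value for a parameter in [0, 1].\<close>

lemma norm_inj_sum_minus_kernel_sum_le:
  fixes x :: "nat \<Rightarrow> 'a::real_normed_algebra_1"
  assumes l: "l \<in> {0..1}" and d: "0 \<le> d" "\<And>j. j < N \<Longrightarrow> norm (x j) \<le> d"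
  shows "norm (kernel_sum x N (of_real l) k - of_re (\<Sum>c\<in>inj_tuples (Suc k) N.
       (l ^ asc (Suc k) c * (l - 1) ^ des (Suc k) c) *\<^sub>R prod_list (map (\<lambda>i. x (c i)) [1..<Suc (Suc k)])))
    \<le> (real N ^ Suc k - real (N - Suc k) ^ Suc k) * d ^ Suc k"
proof -
  let ?f = "\<lambda>L. list_weight l L *\<^sub>R prod_list (map x L)"
  have "(\<Sum>c\<in>inj_tuples (Suc k) N.
       (l ^ asc (Suc k) c * (l - 1) ^ des (Suc k) c) *\<^sub>R prod_list (map (\<lambda>i. x (c i)) [1..<Suc (Suc k)]))
    = (\<Sum>c\<in>inj_tuples (Suc k) N. ?f (map c [1..<Suc (Suc k)]))"
    by (intro sum.cong refl) (simp only: list_weight_inj_tuple map_map o_def)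
  also have "\<dots> = (\<Sum>L | L \<in> nat_lists N (Suc k) \<and> distinct L. ?f L)"
    by (rule sum_inj_tuples_lists)
  finally have e: "(\<Sum>c\<in>inj_tuples (Suc k) N.
       (l ^ asc (Suc k) c * (l - 1) ^ des (Suc k) c) *\<^sub>R prod_list (map (\<lambda>i. x (c i)) [1..<Suc (Suc k)]))
    = (\<Sum>L | L \<in> nat_lists N (Suc k) \<and> distinct L. ?f L)" .
  have "(\<Sum>L\<in>nat_lists N (Suc k). ?f L)
     = (\<Sum>L | L \<in> nat_lists N (Suc k) \<and> distinct L. ?f L) + (\<Sum>L | L \<in> nat_lists N (Suc k) \<and> \<not> distinct L. ?f L)"
    by (subst sum.union_disjoint[symmetric])
      (auto intro!: sum.cong finite_subset[OF _ finite_nat_lists])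
  then have "norm (kernel_sum x N (of_real l) k - of_re (\<Sum>L | L \<in> nat_lists N (Suc k) \<and> distinct L. ?f L))
     = norm (\<Sum>L | L \<in> nat_lists N (Suc k) \<and> \<not> distinct L. ?f L)"
    unfolding kernel_sum_lists of_re_simps(4)[symmetric] norm_of_re by simp
  also have "\<dots> \<le> real (card {L. L \<in> nat_lists N (Suc k) \<and> \<not> distinct L}) * d ^ Suc k"
  proof (intro sum_norm_bound)
    fix L assume "L \<in> {L. L \<in> nat_lists N (Suc k) \<and> \<not> distinct L}"
    then have L: "set L \<subseteq> {..<N}" "length L = Suc k" by (auto simp: nat_lists_def)
    have "norm (prod_list (map x L)) \<le> d ^ length L" using L d by (intro norm_prod_list_le) auto
    then have "\<bar>list_weight l L\<bar> * norm (prod_list (map x L)) \<le> 1 * d ^ length L"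
      using abs_list_weight_le[OF l] by (intro mult_mono) auto
    then show "norm (?f L) \<le> d ^ Suc k" unfolding norm_scaleR L(2) by simp
  qed
  also have "\<dots> \<le> (real N ^ Suc k - real (N - Suc k) ^ Suc k) * d ^ Suc k"
    by (rule mult_right_mono[OF card_nondistinct_le]) (use d(1) in simp)
  finally show ?thesis unfolding e .
qed

text \<open>The Beta integral up to sign, by integration by parts:
  \<open>l ^ Suc a * (l - 1) ^ Suc d\<close> vanishes at both ends. With a + d + 1 = k it turns the
  weights of \<open>mu_param\<close> into the coefficients of \<open>mu\<close>.\<close>

lemma has_integral_asc_des:
  "((\<lambda>l::real. l ^ a * (l - 1) ^ d) has_integral ((- 1) ^ d * fact a * fact d / fact (Suc (a + d)))) {0..1}"
proof (induction d arbitrary: a)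
  case 0
  have "((\<lambda>l::real. l ^ a) has_integral (1 ^ Suc a / real (Suc a) - 0 ^ Suc a / real (Suc a))) {0..1}"
    by (intro fundamental_theorem_of_calculus)
      (auto intro!: derivative_eq_intros simp: has_real_derivative_iff_has_vector_derivative[symmetric] simp del: of_nat_Suc power_Suc)
  then show ?case by simp
next
  case (Suc d)
  let ?g = "\<lambda>l::real. l ^ Suc a * (l - 1) ^ Suc d"
  have "((\<lambda>l. real (Suc a) * (l ^ a * (l - 1) ^ Suc d) + real (Suc d) * (l ^ Suc a * (l - 1) ^ d)) has_integral (?g 1 - ?g 0)) {0..1}"
  proof (intro fundamental_theorem_of_calculus)
    fix l :: real
    have "(?g has_real_derivative (real (Suc a) * (l ^ a * (l - 1) ^ Suc d) + real (Suc d) * (l ^ Suc a * (l - 1) ^ d))) (at l within {0..1})"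
      by (auto intro!: derivative_eq_intros simp del: of_nat_Suc power_Suc simp: mult_ac)
    then show "(?g has_vector_derivative (real (Suc a) * (l ^ a * (l - 1) ^ Suc d) + real (Suc d) * (l ^ Suc a * (l - 1) ^ d))) (at l within {0..1})"
      by (simp only: has_real_derivative_iff_has_vector_derivative)
  qed simp
  then have "((\<lambda>l. real (Suc a) * (l ^ a * (l - 1) ^ Suc d) + real (Suc d) * (l ^ Suc a * (l - 1) ^ d)) has_integral 0) {0..1}"
    by simp
  from has_integral_diff[OF this has_integral_mult_right[OF Suc[of "Suc a"], of "real (Suc d)"]]
  have "((\<lambda>l. real (Suc a) * (l ^ a * (l - 1) ^ Suc d)) has_integral
     (- (real (Suc d) * ((- 1) ^ d * fact (Suc a) * fact d / fact (Suc (Suc a + d)))))) {0..1}"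
    by simp
  from has_integral_mult_right[OF this, of "1 / real (Suc a)"]
  have "((\<lambda>l. l ^ a * (l - 1) ^ Suc d) has_integral
     (1 / real (Suc a) * (- (real (Suc d) * ((- 1) ^ d * fact (Suc a) * fact d / fact (Suc (Suc a + d))))))) {0..1}"
    by (simp del: of_nat_Suc power_Suc)
  also have "1 / real (Suc a) * (- (real (Suc d) * ((- 1) ^ d * fact (Suc a) * fact d / fact (Suc (Suc a + d)))))
    = (- 1) ^ Suc d * fact a * fact (Suc d) / fact (Suc (a + Suc d))"
    by (simp only: fact_Suc[of a] fact_Suc[of d] power_Suc add_Suc add_Suc_right) (simp del: fact_Suc of_nat_Suc)
  finally show ?case .
qed

lemma asc_plus_des:
  assumes "\<sigma> permutes {1..k}" "k \<ge> 1"
  shows "Suc (asc k \<sigma> + des k \<sigma>) = k"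
proof -
  have inj: "inj \<sigma>" by (rule permutes_inj[OF assms(1)])
  have un: "{i \<in> {1..<k}. \<sigma> i < \<sigma> (Suc i)} \<union> {i \<in> {1..<k}. \<sigma> i > \<sigma> (Suc i)} = {1..<k}"
    using inj_eq[OF inj] by (auto simp: not_less nat_less_le)
  have "card ({i \<in> {1..<k}. \<sigma> i < \<sigma> (Suc i)} \<union> {i \<in> {1..<k}. \<sigma> i > \<sigma> (Suc i)}) = asc k \<sigma> + des k \<sigma>"
    unfolding asc_def des_def by (rule card_Un_disjoint) auto
  then have "asc k \<sigma> + des k \<sigma> = card {1..<k}" unfolding un by simp
  then show ?thesis using assms(2) by simp
qed



subsection \<open>Multilinear expressions\<close>

text \<open>Arguments are functions on all natural numbers, so the first clause restricts the
  dependence to indices 1 to k. The norm bound serves domination by a positive measure, the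
  sequential continuity serves limits on boxes.\<close>

definition multilinear_form :: "nat \<Rightarrow> ((nat \<Rightarrow> 'a::real_normed_vector) \<Rightarrow> 'a) \<Rightarrow> bool" where
  "multilinear_form k F \<longleftrightarrow>
     (\<forall>X Y. (\<forall>i\<in>{1..k}. X i = Y i) \<longrightarrow> F X = F Y) \<and>
     (\<forall>X. \<forall>i\<in>{1..k}. linear (\<lambda>v. F (X(i := v)))) \<and>
     (\<exists>C. \<forall>X. norm (F X) \<le> C * (\<Prod>i\<in>{1..k}. norm (X i))) \<and>
     (\<forall>X Y. (\<forall>i\<in>{1..k}. (\<lambda>n. X n i) \<longlonglongrightarrow> Y i) \<longrightarrow> (\<lambda>n. F (X n)) \<longlonglongrightarrow> F Y)"

lemma multilinear_formD:
  assumes "multilinear_form k F"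
  shows "\<And>X Y. (\<And>i. i \<in> {1..k} \<Longrightarrow> X i = Y i) \<Longrightarrow> F X = F Y"
    and "\<And>X i. i \<in> {1..k} \<Longrightarrow> linear (\<lambda>v. F (X(i := v)))"
    and "\<exists>C\<ge>0. \<forall>X. norm (F X) \<le> C * (\<Prod>i\<in>{1..k}. norm (X i))"
    and "\<And>X Y. (\<And>i. i \<in> {1..k} \<Longrightarrow> (\<lambda>n. X n i) \<longlonglongrightarrow> Y i) \<Longrightarrow> (\<lambda>n. F (X n)) \<longlonglongrightarrow> F Y"
proof -
  obtain C where C: "\<And>X. norm (F X) \<le> C * (\<Prod>i\<in>{1..k}. norm (X i))"
    using assms unfolding multilinear_form_def by blast
  have "norm (F X) \<le> max C 0 * (\<Prod>i\<in>{1..k}. norm (X i))" for X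
    by (rule order_trans[OF C]) (intro mult_right_mono prod_nonneg, auto)
  then show "\<exists>C\<ge>0. \<forall>X. norm (F X) \<le> C * (\<Prod>i\<in>{1..k}. norm (X i))"
    by (intro exI[of _ "max C 0"]) auto
qed (use assms in \<open>simp_all add: multilinear_form_def\<close>)

lemma multilinear_form_sum:
  fixes F :: "'b \<Rightarrow> (nat \<Rightarrow> 'a::real_normed_vector) \<Rightarrow> 'a"
  assumes "finite A" "\<And>a. a \<in> A \<Longrightarrow> multilinear_form k (F a)"
  shows "multilinear_form k (\<lambda>X. \<Sum>a\<in>A. w a *\<^sub>R F a X)"
  unfolding multilinear_form_def
proof (intro conjI allI impI ballI)
  fix X Y :: "nat \<Rightarrow> 'a" assume "\<forall>i\<in>{1..k}. X i = Y i"
  then have "F a X = F a Y" if "a \<in> A" for a using multilinear_formD(1)[OF assms(2)[OF that]] by blast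
  then show "(\<Sum>a\<in>A. w a *\<^sub>R F a X) = (\<Sum>a\<in>A. w a *\<^sub>R F a Y)" by simp
next
  fix X :: "nat \<Rightarrow> 'a" and i assume "i \<in> {1..k}"
  then have "linear (\<lambda>v. F a (X(i := v)))" if "a \<in> A" for a
    using multilinear_formD(2)[OF assms(2)[OF that]] by blast
  then show "linear (\<lambda>v. \<Sum>a\<in>A. w a *\<^sub>R F a (X(i := v)))"
    by (intro linear_compose_sum ballI linear_compose_scale_right)
next
  have "\<forall>a\<in>A. \<exists>C. \<forall>X. norm (F a X) \<le> C * (\<Prod>i\<in>{1..k}. norm (X i))"
    using multilinear_formD(3)[OF assms(2)] by blast
  then obtain C where C: "\<And>a X. a \<in> A \<Longrightarrow> norm (F a X) \<le> C a * (\<Prod>i\<in>{1..k}. norm (X i))" by metis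
  have "norm (\<Sum>a\<in>A. w a *\<^sub>R F a X) \<le> (\<Sum>a\<in>A. \<bar>w a\<bar> * C a) * (\<Prod>i\<in>{1..k}. norm (X i))" for X
    unfolding sum_distrib_right
  proof (rule sum_norm_le)
    fix a assume "a \<in> A"
    then show "norm (w a *\<^sub>R F a X) \<le> \<bar>w a\<bar> * C a * (\<Prod>i\<in>{1..k}. norm (X i))"
      unfolding norm_scaleR mult.assoc by (intro mult_left_mono C) auto
  qed
  then show "\<exists>C. \<forall>X. norm (\<Sum>a\<in>A. w a *\<^sub>R F a X) \<le> C * (\<Prod>i\<in>{1..k}. norm (X i))" by blast
next
  fix X :: "nat \<Rightarrow> nat \<Rightarrow> 'a" and Y assume "\<forall>i\<in>{1..k}. (\<lambda>n. X n i) \<longlonglongrightarrow> Y i"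
  then have "(\<lambda>n. F a (X n)) \<longlonglongrightarrow> F a Y" if "a \<in> A" for a
    using multilinear_formD(4)[OF assms(2)[OF that]] by blast
  then show "(\<lambda>n. \<Sum>a\<in>A. w a *\<^sub>R F a (X n)) \<longlonglongrightarrow> (\<Sum>a\<in>A. w a *\<^sub>R F a Y)"
    by (intro tendsto_sum tendsto_scaleR tendsto_const)
qed

lemma tendsto_prod_list:
  fixes f :: "'b \<Rightarrow> nat \<Rightarrow> 'a::real_normed_algebra_1"
  assumes "\<And>i. i \<in> set L \<Longrightarrow> f i \<longlonglongrightarrow> g i"
  shows "(\<lambda>n. prod_list (map (\<lambda>i. f i n) L)) \<longlonglongrightarrow> prod_list (map g L)"
  using assms by (induction L) (auto intro: tendsto_mult)

lemma norm_prod_list_le_prod: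
  fixes f :: "'b \<Rightarrow> 'a::real_normed_algebra_1"
  shows "norm (prod_list (map f L)) \<le> prod_list (map (\<lambda>i. norm (f i)) L)"
proof (induction L)
  case (Cons a L)
  have "norm (f a * prod_list (map f L)) \<le> norm (f a) * norm (prod_list (map f L))" by (rule norm_mult_ineq)
  also have "\<dots> \<le> norm (f a) * prod_list (map (\<lambda>i. norm (f i)) L)" using Cons by (intro mult_left_mono) auto
  finally show ?case by simp
qed simp

lemma multilinear_form_monomial:
  assumes "\<sigma> permutes {1..k}"
  shows "multilinear_form k (\<lambda>X :: nat \<Rightarrow> 'a::real_normed_algebra_1. prod_list (map (\<lambda>i. X (\<sigma> i)) [1..<Suc k]))"
  unfolding multilinear_form_def
proof (intro conjI allI impI ballI)
  have mem: "\<sigma> i \<in> {1..k}" if "i \<in> set [1..<Suc k]" for i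
    using permutes_in_image[OF assms, of i] that by (simp del: upt_Suc)
  fix X Y :: "nat \<Rightarrow> 'a" assume "\<forall>i\<in>{1..k}. X i = Y i"
  then show "prod_list (map (\<lambda>i. X (\<sigma> i)) [1..<Suc k]) = prod_list (map (\<lambda>i. Y (\<sigma> i)) [1..<Suc k])"
    using mem by (intro arg_cong[where f=prod_list] map_cong refl) blast
next
  fix X :: "nat \<Rightarrow> 'a" and i assume i: "i \<in> {1..k}"
  define j where "j = inv \<sigma> i"
  have j: "j \<in> {1..k}" "\<sigma> j = i"
    using permutes_in_image[OF permutes_inv[OF assms], of i] i permutes_inverses(1)[OF assms] by (auto simp: j_def)
  have "[1..<Suc k] = [1..<j] @ j # [Suc j..<Suc k]"
    using j(1) upt_add_eq_append[of 1 j "Suc k - j"] by (simp add: upt_conv_Cons del: upt_Suc)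
  have "map (\<lambda>m. (X(i := v)) (\<sigma> m)) L = map (\<lambda>m. X (\<sigma> m)) L" if "j \<notin> set L" for v L
    using that j(2) permutes_inj[OF assms] by (auto dest: injD)
  then have "map (\<lambda>m. (X(i := v)) (\<sigma> m)) [1..<j] = map (\<lambda>m. X (\<sigma> m)) [1..<j]"
    "map (\<lambda>m. (X(i := v)) (\<sigma> m)) [Suc j..<Suc k] = map (\<lambda>m. X (\<sigma> m)) [Suc j..<Suc k]" for v
    by (metis atLeastLessThan_iff atLeastLessThan_upt less_irrefl, metis Suc_n_not_le_n atLeastLessThan_iff atLeastLessThan_upt)
  then have "prod_list (map (\<lambda>m. (X(i := v)) (\<sigma> m)) [1..<Suc k])
      = prod_list (map (\<lambda>m. X (\<sigma> m)) [1..<j]) * v * prod_list (map (\<lambda>m. X (\<sigma> m)) [Suc j..<Suc k])" for v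
    unfolding \<open>[1..<Suc k] = _\<close> map_append list.map prod_list.append prod_list.Cons by (simp only: j(2) fun_upd_same mult.assoc)
  moreover have "linear (\<lambda>v. a * v * b)" for a b :: 'a
    by (rule linearI) (auto simp: algebra_simps)
  ultimately show "linear (\<lambda>v. prod_list (map (\<lambda>m. (X(i := v)) (\<sigma> m)) [1..<Suc k]))" by simp
next
  have "norm (prod_list (map (\<lambda>i. X (\<sigma> i)) [1..<Suc k])) \<le> 1 * (\<Prod>i\<in>{1..k}. norm (X i))" for X :: "nat \<Rightarrow> 'a"
  proof -
    have "norm (prod_list (map (\<lambda>i. X (\<sigma> i)) [1..<Suc k])) \<le> prod_list (map (\<lambda>i. norm (X (\<sigma> i))) [1..<Suc k])"
      by (rule norm_prod_list_le_prod)
    also have "\<dots> = (\<Prod>i\<in>{1..k}. norm (X (\<sigma> i)))"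
      using prod.distinct_set_conv_list[of "[1..<Suc k]" "\<lambda>i. norm (X (\<sigma> i))"]
      by (simp add: atLeastLessThanSuc_atLeastAtMost del: upt_Suc)
    also have "\<dots> = (\<Prod>i\<in>{1..k}. norm (X i))"
      using prod.permute[OF assms, of "\<lambda>i. norm (X i)"] by (simp add: o_def)
    finally show ?thesis by simp
  qed
  then show "\<exists>C. \<forall>X :: nat \<Rightarrow> 'a. norm (prod_list (map (\<lambda>i. X (\<sigma> i)) [1..<Suc k])) \<le> C * (\<Prod>i\<in>{1..k}. norm (X i))" by blast
next
  fix X :: "nat \<Rightarrow> nat \<Rightarrow> 'a" and Y assume "\<forall>i\<in>{1..k}. (\<lambda>n. X n i) \<longlonglongrightarrow> Y i"
  then show "(\<lambda>n. prod_list (map (\<lambda>i. X n (\<sigma> i)) [1..<Suc k])) \<longlonglongrightarrow> prod_list (map (\<lambda>i. Y (\<sigma> i)) [1..<Suc k])"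
    using permutes_in_image[OF assms] by (intro tendsto_prod_list) (auto simp del: upt_Suc)
qed

text \<open>Evaluates F on step measures, which are linear combinations of the cell masses, as a sum
  over k-tuples of cells.\<close>

lemma multilinear_form_expand:
  fixes F :: "(nat \<Rightarrow> 'a::real_normed_vector) \<Rightarrow> 'a"
  assumes F: "multilinear_form k F"
  shows "F (\<lambda>i. \<Sum>j<N. a i j *\<^sub>R x j) = (\<Sum>c\<in>{1..k} \<rightarrow>\<^sub>E {..<N}. (\<Prod>i\<in>{1..k}. a i (c i)) *\<^sub>R F (\<lambda>i. x (c i)))"
proof -
  \<comment> \<open>Generalised for the induction: only the slots in S are expanded, the others hold
    arbitrary values Y.\<close>
  have "F (\<lambda>i. if i \<in> S then \<Sum>j<N. a i j *\<^sub>R x j else Y i)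
      = (\<Sum>c\<in>S \<rightarrow>\<^sub>E {..<N}. (\<Prod>i\<in>S. a i (c i)) *\<^sub>R F (\<lambda>i. if i \<in> S then x (c i) else Y i))"
    if "finite S" "S \<subseteq> {1..k}" for S Y
    using that
  proof (induction S arbitrary: Y rule: finite_induct)
    case empty
    then show ?case by simp
  next
    case (insert m S)
    have m: "m \<in> {1..k}" using insert.prems by simp
    let ?Z = "\<lambda>i. if i \<in> S then \<Sum>j<N. a i j *\<^sub>R x j else Y i"
    interpret linear "\<lambda>v. F (?Z(m := v))" by (rule multilinear_formD(2)[OF F m])
    have "F (\<lambda>i. if i \<in> insert m S then \<Sum>j<N. a i j *\<^sub>R x j else Y i) = F (?Z(m := \<Sum>j<N. a m j *\<^sub>R x j))"
      by (intro arg_cong[where f=F]) auto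
    also have "\<dots> = (\<Sum>j<N. a m j *\<^sub>R F (?Z(m := x j)))" by (simp add: sum scale)
    also have "\<dots> = (\<Sum>j<N. a m j *\<^sub>R F (\<lambda>i. if i \<in> S then \<Sum>j<N. a i j *\<^sub>R x j else (Y(m := x j)) i))"
      using insert.hyps by (intro sum.cong refl arg_cong2[where f=scaleR] arg_cong[where f=F]) auto
    also have "\<dots> = (\<Sum>j<N. a m j *\<^sub>R (\<Sum>c\<in>S \<rightarrow>\<^sub>E {..<N}. (\<Prod>i\<in>S. a i (c i)) *\<^sub>R
         F (\<lambda>i. if i \<in> S then x (c i) else (Y(m := x j)) i)))"
      using insert.prems by (subst insert.IH) auto
    also have "\<dots> = (\<Sum>(j, c)\<in>{..<N} \<times> (S \<rightarrow>\<^sub>E {..<N}). (\<Prod>i\<in>insert m S. a i ((c(m := j)) i)) *\<^sub>R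
         F (\<lambda>i. if i \<in> insert m S then x ((c(m := j)) i) else Y i))"
      unfolding scaleR_sum_right sum.cartesian_product
    proof (intro sum.cong refl, clarify)
      fix j c
      have "(\<Prod>i\<in>insert m S. a i ((c(m := j)) i)) = a m j * (\<Prod>i\<in>S. a i (c i))"
        using insert.hyps by (simp, intro disjI2 prod.cong refl) auto
      moreover have "(\<lambda>i. if i \<in> insert m S then x ((c(m := j)) i) else Y i)
         = (\<lambda>i. if i \<in> S then x (c i) else (Y(m := x j)) i)"
        using insert.hyps by auto
      ultimately show "a m j *\<^sub>R (\<Prod>i\<in>S. a i (c i)) *\<^sub>R F (\<lambda>i. if i \<in> S then x (c i) else (Y(m := x j)) i)
         = (\<Prod>i\<in>insert m S. a i ((c(m := j)) i)) *\<^sub>R F (\<lambda>i. if i \<in> insert m S then x ((c(m := j)) i) else Y i)"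
        by (simp only: scaleR_scaleR)
    qed
    also have "\<dots> = (\<Sum>c\<in>insert m S \<rightarrow>\<^sub>E {..<N}. (\<Prod>i\<in>insert m S. a i (c i)) *\<^sub>R F (\<lambda>i. if i \<in> insert m S then x (c i) else Y i))"
      unfolding PiE_insert_eq
      by (subst sum.reindex[OF inj_combinator[OF insert.hyps(2)]]) (auto intro!: sum.cong)
    finally show ?case .
  qed
  from this[of "{1..k}" "\<lambda>_. 0"]
  have "F (\<lambda>i. if i \<in> {1..k} then \<Sum>j<N. a i j *\<^sub>R x j else 0)
     = (\<Sum>c\<in>{1..k} \<rightarrow>\<^sub>E {..<N}. (\<Prod>i\<in>{1..k}. a i (c i)) *\<^sub>R F (\<lambda>i. if i \<in> {1..k} then x (c i) else 0))"
    by simp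
  moreover have "F (\<lambda>i. if i \<in> {1..k} then X i else 0) = F X" for X
    by (rule multilinear_formD(1)[OF F]) simp
  ultimately show ?thesis by simp
qed

subsection \<open>Measures on the cube\<close>

lemma subintervals_Int: "J \<in> subintervals I \<Longrightarrow> K \<in> subintervals I \<Longrightarrow> J \<inter> K \<in> subintervals I"
  by (auto simp: subintervals_def intro: is_interval_Int)

lemma subintervals_borel: "J \<in> subintervals I \<Longrightarrow> J \<in> sets (borel :: real measure)"
  unfolding subintervals_def by (auto intro: real_interval_borel_measurable)

definition interval_boxes :: "real set \<Rightarrow> nat \<Rightarrow> (nat \<Rightarrow> real) set set" where
  "interval_boxes I k = {PiE {1..k} J | J. \<forall>i\<in>{1..k}. J i \<in> subintervals I}"

lemma Int_stable_interval_boxes: "Int_stable (interval_boxes I k)"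
proof (rule Int_stableI)
  fix a b assume "a \<in> interval_boxes I k" "b \<in> interval_boxes I k"
  then obtain J K where "a = PiE {1..k} J" "b = PiE {1..k} K"
    "\<forall>i\<in>{1..k}. J i \<in> subintervals I" "\<forall>i\<in>{1..k}. K i \<in> subintervals I"
    by (auto simp: interval_boxes_def)
  then show "a \<inter> b \<in> interval_boxes I k"
    unfolding interval_boxes_def
    by (intro CollectI exI[of _ "\<lambda>i. J i \<inter> K i"]) (auto simp: PiE_Int intro: subintervals_Int)
qed

lemma interval_boxes_subset_Pow: "interval_boxes I k \<subseteq> Pow (PiE {1..k} (\<lambda>_. I))"
  by (auto simp: interval_boxes_def subintervals_def PiE_iff)

text \<open>The preimage in the cube of a half-line under a coordinate is a box, so coordinates are
  measurable for the sigma algebra of boxes, and these generate the product sigma algebra.\<close>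

lemma sets_PiM_interval_boxes:
  assumes "is_interval I"
  shows "sets (PiM {1..k} (\<lambda>_. restrict_space borel I)) = sigma_sets (PiE {1..k} (\<lambda>_. I)) (interval_boxes I k)"
proof
  let ?\<Omega> = "PiE {1..k} (\<lambda>_. I)"
  let ?N = "sigma ?\<Omega> (interval_boxes I k)"
  have sN: "sets ?N = sigma_sets ?\<Omega> (interval_boxes I k)" "space ?N = ?\<Omega>"
    using interval_boxes_subset_Pow by (simp_all add: sets_measure_of space_measure_of)
  have meas: "(\<lambda>t. t i) \<in> borel_measurable ?N" if i: "i \<in> {1..k}" for i
    unfolding borel_measurable_iff_le
  proof
    fix a :: real
    have "{t \<in> space ?N. t i \<le> a} = PiE {1..k} (\<lambda>j. if j = i then I \<inter> {..a} else I)"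
    proof (intro set_eqI)
      fix t
      have "t j \<in> (if j = i then I \<inter> {..a} else I) \<longleftrightarrow> t j \<in> I \<and> (j = i \<longrightarrow> t i \<le> a)" for j by auto
      then have "(\<forall>j\<in>{1..k}. t j \<in> (if j = i then I \<inter> {..a} else I)) \<longleftrightarrow> (\<forall>j\<in>{1..k}. t j \<in> I) \<and> t i \<le> a"
        using i by blast
      then show "t \<in> {t \<in> space ?N. t i \<le> a} \<longleftrightarrow> t \<in> PiE {1..k} (\<lambda>j. if j = i then I \<inter> {..a} else I)"
        unfolding sN mem_Collect_eq PiE_iff by blast
    qed
    also have "\<dots> \<in> interval_boxes I k"
      unfolding interval_boxes_def using assms
      by (intro CollectI exI[of _ "\<lambda>j. if j = i then I \<inter> {..a} else I"]) (auto simp: subintervals_def intro: is_interval_Int is_interval_ci)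
    finally show "{t \<in> space ?N. t i \<le> a} \<in> sets ?N" unfolding sN by (rule sigma_sets.Basic)
  qed
  have "sets (PiM {1..k} (\<lambda>_. restrict_space borel I)) \<subseteq> sets ?N"
  proof (rule sets_PiM_in_sets)
    show "space ?N = (\<Pi>\<^sub>E i\<in>{1..k}. space (restrict_space borel I))" unfolding sN by (simp add: space_restrict_space)
    fix i A assume i: "i \<in> {1..k}" and A: "A \<in> sets (restrict_space borel I)"
    obtain B where B: "B \<in> sets borel" "A = I \<inter> B" using A by (auto simp: sets_restrict_space)
    have "(\<lambda>t. t i) -` B \<inter> space ?N \<in> sets ?N" by (rule measurable_sets[OF meas[OF i] B(1)])
    moreover have "{x \<in> space ?N. x i \<in> A} = (\<lambda>t. t i) -` B \<inter> space ?N"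
      unfolding sN B(2) using i by auto
    ultimately show "{x \<in> space ?N. x i \<in> A} \<in> sets ?N" by simp
  qed
  then show "sets (PiM {1..k} (\<lambda>_. restrict_space borel I)) \<subseteq> sigma_sets ?\<Omega> (interval_boxes I k)" unfolding sN .
  have "interval_boxes I k \<subseteq> sets (PiM {1..k} (\<lambda>_. restrict_space borel I))"
  proof
    fix A assume "A \<in> interval_boxes I k"
    then obtain J where J: "A = PiE {1..k} J" "\<And>i. i \<in> {1..k} \<Longrightarrow> J i \<in> subintervals I"
      by (auto simp: interval_boxes_def)
    have "J i \<in> sets (restrict_space borel I)" if "i \<in> {1..k}" for i
      using subintervals_borel[OF J(2)[OF that]] J(2)[OF that] unfolding sets_restrict_space
      by (intro image_eqI[of _ _ "J i"]) (auto simp: subintervals_def)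
    then show "A \<in> sets (PiM {1..k} (\<lambda>_. restrict_space borel I))"
      unfolding J(1) by (intro sets_PiM_I_finite) auto
  qed
  from sets.sigma_sets_subset[OF this]
  show "sigma_sets ?\<Omega> (interval_boxes I k) \<subseteq> sets (PiM {1..k} (\<lambda>_. restrict_space borel I))"
    by (simp add: space_PiM space_restrict_space)
qed

definition countably_additive_on :: "'s set set \<Rightarrow> ('s set \<Rightarrow> 'a::real_normed_vector) \<Rightarrow> bool" where
  "countably_additive_on \<A> M \<longleftrightarrow>
     (\<forall>A :: nat \<Rightarrow> 's set. range A \<subseteq> \<A> \<longrightarrow> disjoint_family A \<longrightarrow> (\<lambda>n. M (A n)) sums M (\<Union>n. A n))"

lemma countably_additive_on_empty:
  assumes "countably_additive_on \<A> M" "{} \<in> \<A>"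
  shows "M {} = 0"
proof -
  have "(\<lambda>n::nat. M {}) sums M (\<Union>n::nat. {})"
    using assms unfolding countably_additive_on_def by (auto simp: disjoint_family_on_def)
  from summable_LIMSEQ_zero[OF sums_summable[OF this]] show ?thesis by (simp add: LIMSEQ_const_iff)
qed

lemma countably_additive_on_Un:
  assumes M: "countably_additive_on \<A> M" and A: "A \<in> \<A>" "B \<in> \<A>" "{} \<in> \<A>" "A \<inter> B = {}"
  shows "M (A \<union> B) = M A + M B"
proof -
  define D where "D n = (if n = 0 then A else if n = 1 then B else {})" for n :: nat
  have "range D \<subseteq> \<A>" "disjoint_family D" using A by (auto simp: D_def disjoint_family_on_def)
  then have "(\<lambda>n. M (D n)) sums M (\<Union>n. D n)" using M unfolding countably_additive_on_def by blast
  moreover have "(\<Union>n. D n) = A \<union> B"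
  proof
    show "A \<union> B \<subseteq> (\<Union>n. D n)" using UN_upper[of 0 UNIV D] UN_upper[of 1 UNIV D] by (auto simp: D_def)
  qed (auto simp: D_def split: if_splits)
  moreover have "(\<lambda>n. M (D n)) sums (\<Sum>n\<in>{0, 1}. M (D n))"
    using countably_additive_on_empty[OF M A(3)] by (intro sums_finite) (auto simp: D_def)
  ultimately show ?thesis using sums_unique2 by (fastforce simp: D_def)
qed

lemma product_measure_iff:
  assumes "is_interval I"
  shows "product_measure I \<phi> k F M \<longleftrightarrow>
     countably_additive_on (sigma_sets (PiE {1..k} (\<lambda>_. I)) (interval_boxes I k)) M \<and>
     (\<forall>J. (\<forall>i\<in>{1..k}. J i \<in> subintervals I) \<longrightarrow> M (PiE {1..k} J) = F (\<lambda>i. \<phi> (J i)))"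
  unfolding product_measure_def countably_additive_on_def sets_PiM_interval_boxes[OF assms] ..

text \<open>Dynkin's argument with vector values: boxes are closed under intersection, and
  additivity carries agreement to complements and disjoint unions. It justifies the unique
  description in \<open>ordered_integral\<close>.\<close>

lemma product_measure_unique:
  assumes I: "is_interval I" and M: "product_measure I \<phi> k F M" "product_measure I \<phi> k F M'"
    and A: "A \<in> sigma_sets (PiE {1..k} (\<lambda>_. I)) (interval_boxes I k)"
  shows "M A = M' A"
proof -
  let ?\<Omega> = "PiE {1..k} (\<lambda>_. I)"
  let ?S = "sigma_sets ?\<Omega> (interval_boxes I k)"
  have ca: "countably_additive_on ?S M" "countably_additive_on ?S M'"
    and box: "\<And>J. \<forall>i\<in>{1..k}. J i \<in> subintervals I \<Longrightarrow> M (PiE {1..k} J) = M' (PiE {1..k} J)"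
    using M unfolding product_measure_iff[OF I] by auto
  have e: "{} \<in> ?S" by (rule sigma_sets.Empty)
  have "?\<Omega> \<in> interval_boxes I k"
    unfolding interval_boxes_def using I by (auto simp: subintervals_def)
  then have \<Omega>: "?\<Omega> \<in> ?S" "M ?\<Omega> = M' ?\<Omega>"
    using I box[of "\<lambda>_. I"] by (auto intro: sigma_sets.Basic simp: subintervals_def)
  show ?thesis
    using Int_stable_interval_boxes interval_boxes_subset_Pow A
  proof (induction A rule: sigma_sets_induct_disjoint)
    case (basic A)
    then obtain J where "A = PiE {1..k} J" "\<forall>i\<in>{1..k}. J i \<in> subintervals I"
      by (auto simp: interval_boxes_def)
    then show ?case using box[of J] by simp
  next
    case empty
    show ?case using countably_additive_on_empty[OF ca(1) e] countably_additive_on_empty[OF ca(2) e] by simp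
  next
    case (compl A)
    have sub: "A \<union> (?\<Omega> - A) = ?\<Omega>"
      using sigma_sets_into_sp[OF interval_boxes_subset_Pow compl(1)] by blast
    have c: "?\<Omega> - A \<in> ?S" using compl(1) by (rule sigma_sets.Compl)
    have "M ?\<Omega> = M A + M (?\<Omega> - A)" "M' ?\<Omega> = M' A + M' (?\<Omega> - A)"
      using countably_additive_on_Un[OF ca(1) compl(1) c e] countably_additive_on_Un[OF ca(2) compl(1) c e]
      unfolding sub by auto
    then show ?case using compl(2) \<Omega>(2) by simp
  next
    case (union A)
    then have "(\<lambda>n. M (A n)) sums M (\<Union>n. A n)" "(\<lambda>n. M' (A n)) sums M' (\<Union>n. A n)"
      using ca unfolding countably_additive_on_def by blast+
    then show ?case using union(3) sums_unique2 by simp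
  qed
qed

lemma ordered_simplex_measurable:
  assumes "is_interval I"
  shows "ordered_simplex I k \<in> sets (PiM {1..k} (\<lambda>_. restrict_space borel I))"
proof -
  let ?P = "PiM {1..k} (\<lambda>_. restrict_space (borel :: real measure) I)"
  have m: "(\<lambda>t. t i) \<in> borel_measurable ?P" if "i \<in> {1..k}" for i
    using measurable_component_singleton[OF that, of "\<lambda>_. restrict_space borel I"]
    by (rule measurable_restrict_space2_iff[THEN iffD1, THEN conjunct1])
  have "{t \<in> space ?P. \<forall>i\<in>{1..<k}. t i \<le> t (Suc i)} \<in> sets ?P"
    by (intro sets.sets_Collect_finite_All borel_measurable_le m) auto
  moreover have "{t \<in> space ?P. \<forall>i\<in>{1..<k}. t i \<le> t (Suc i)} = ordered_simplex I k"
    by (simp add: ordered_simplex_def space_PiM space_restrict_space)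
  ultimately show ?thesis by simp
qed

lemma ordered_integral_eqI:
  assumes I: "is_interval I" and M: "product_measure I \<phi> k F M"
  shows "ordered_integral I \<phi> k F = M (ordered_simplex I k)"
  unfolding ordered_integral_def
proof (rule the_equality)
  fix v assume "\<exists>M. product_measure I \<phi> k F M \<and> v = M (ordered_simplex I k)"
  then obtain M' where M': "product_measure I \<phi> k F M'" "v = M' (ordered_simplex I k)" by blast
  have "ordered_simplex I k \<in> sigma_sets (PiE {1..k} (\<lambda>_. I)) (interval_boxes I k)"
    using ordered_simplex_measurable[OF I] unfolding sets_PiM_interval_boxes[OF I] .
  from product_measure_unique[OF I M'(1) M this] show "v = M (ordered_simplex I k)" using M'(2) by simp
qed (use M in blast)

text \<open>A three-epsilon argument. Its use is for countable disjoint unions, where S n are the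
  partial sums and the error T n is uniform in the grid.\<close>

lemma convergent_of_approximations:
  fixes X :: "nat \<Rightarrow> 'a::banach"
  assumes S: "\<And>n. convergent (S n)" and X: "\<And>n N. norm (X N - S n N) \<le> T n" and T: "T \<longlonglongrightarrow> (0::real)"
  shows "convergent X"
proof -
  have "Cauchy X"
  proof (rule CauchyI)
    fix e :: real assume e: "e > 0"
    then have "\<forall>\<^sub>F n in sequentially. T n < e / 3" using order_tendstoD(2)[OF T, of "e / 3"] by simp
    then obtain n where n: "T n < e / 3" by (auto simp: eventually_sequentially)
    have "Cauchy (S n)" by (rule convergent_Cauchy[OF S])
    then obtain M where M: "\<And>a b. a \<ge> M \<Longrightarrow> b \<ge> M \<Longrightarrow> norm (S n a - S n b) < e / 3"
      using e CauchyD[of "S n" "e / 3"] by auto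
    show "\<exists>M. \<forall>a\<ge>M. \<forall>b\<ge>M. norm (X a - X b) < e"
    proof (intro exI[of _ M] allI impI)
      fix a b assume ab: "a \<ge> M" "b \<ge> M"
      have "X a - X b = (X a - S n a) + (S n a - S n b) - (X b - S n b)" by simp
      also have "norm \<dots> \<le> norm (X a - S n a) + norm (S n a - S n b) + norm (X b - S n b)"
        by (intro order_trans[OF norm_triangle_ineq4] add_mono norm_triangle_ineq order_refl)
      also have "\<dots> < e" using X[of a n] X[of b n] M[OF ab] n by linarith
      finally show "norm (X a - X b) < e" .
    qed
  qed
  then show ?thesis by (rule Cauchy_convergent)
qed



subsection \<open>Product measures as limits over grids\<close>

lemma vector_measure_on_empty:
  assumes "vector_measure_on I \<phi>"
  shows "\<phi> {} = 0"
proof -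
  have "(\<lambda>n::nat. \<phi> {}) sums \<phi> (\<Union>n::nat. {})"
    using assms[unfolded vector_measure_on_def, rule_format, of "\<lambda>_. {}"]
    by (simp add: disjoint_family_on_def subintervals_def is_interval_empty)
  from summable_LIMSEQ_zero[OF sums_summable[OF this]] show ?thesis by (simp add: LIMSEQ_const_iff)
qed

text \<open>B plays the variation measure and \<open>cell N\<close> cuts I into N consecutive pieces
  of mass at most r/N. The only link between \<phi> and B is \<open>norm_le_cell\<close>.\<close>

locale interval_grid =
  fixes I :: "real set" and \<phi> :: "real set \<Rightarrow> 'a::banach" and B :: "real measure" and r :: real
    and cell :: "nat \<Rightarrow> nat \<Rightarrow> real set"
  assumes interval: "is_interval I" and r_nonneg: "0 \<le> r"
    and sets_B: "sets B = sets (restrict_space borel I)"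
    and finite_B: "finite_measure B"
    and vector_measure: "vector_measure_on I \<phi>"
    and cell_interval: "\<And>N j. j < N \<Longrightarrow> cell N j \<in> subintervals I"
    and cell_less: "\<And>N i j s t. i < j \<Longrightarrow> j < N \<Longrightarrow> s \<in> cell N i \<Longrightarrow> t \<in> cell N j \<Longrightarrow> s < t"
    and cell_Un: "\<And>N. 0 < N \<Longrightarrow> (\<Union>j<N. cell N j) = I"
    and norm_le_cell: "\<And>N j K. j < N \<Longrightarrow> K \<in> subintervals I \<Longrightarrow> K \<subseteq> cell N j \<Longrightarrow> norm (\<phi> K) \<le> measure B (cell N j)"
    and cell_small: "\<And>N j. j < N \<Longrightarrow> measure B (cell N j) \<le> r / real N"
begin

sublocale finite_measure B by (rule finite_B)

definition "mass N j = \<phi> (cell N j)"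

definition "step_measure N J = (\<Sum>j<N. (measure B (J \<inter> cell N j) / measure B (cell N j)) *\<^sub>R mass N j)"

lemma sets_subinterval: "J \<in> subintervals I \<Longrightarrow> J \<in> sets B"
  unfolding sets_B sets_restrict_space
  by (intro image_eqI[of _ _ J] subintervals_borel) (auto simp: subintervals_def)

lemma norm_mass_le: "j < N \<Longrightarrow> norm (mass N j) \<le> r / real N"
  using norm_le_cell[of j N "cell N j"] cell_interval[of j N] cell_small[of j N] unfolding mass_def by simp

lemma vm_empty: "\<phi> {} = 0"
  by (rule vector_measure_on_empty[OF vector_measure])

lemma cell_disjoint: "i < N \<Longrightarrow> j < N \<Longrightarrow> i \<noteq> j \<Longrightarrow> cell N i \<inter> cell N j = {}"
  using cell_less[of i j N] cell_less[of j i N] by (cases i j rule: linorder_cases) force+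

lemma vm_split_cells:
  assumes "0 < N" and J: "J \<in> subintervals I"
  shows "\<phi> J = (\<Sum>j<N. \<phi> (J \<inter> cell N j))"
proof -
  define K where "K j = (if j < N then J \<inter> cell N j else {})" for j
  have "range K \<subseteq> subintervals I"
    using J cell_interval subintervals_Int by (auto simp: K_def subintervals_def)
  moreover have "disjoint_family K"
    unfolding disjoint_family_on_def
  proof (intro ballI impI)
    fix i j :: nat assume "i \<noteq> j"
    then show "K i \<inter> K j = {}" using cell_disjoint[of i N j] by (auto simp: K_def)
  qed
  moreover have U: "(\<Union>n. K n) = J"
  proof -
    have "(\<Union>n. K n) = J \<inter> (\<Union>j<N. cell N j)" by (auto simp: K_def split: if_splits)
    then show ?thesis using cell_Un[OF assms(1)] J by (auto simp: subintervals_def)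
  qed
  ultimately have "(\<lambda>n. \<phi> (K n)) sums \<phi> J"
    using vector_measure[unfolded vector_measure_on_def, rule_format, of K] J by simp
  moreover have "(\<lambda>n. \<phi> (K n)) sums (\<Sum>n\<in>{..<N}. \<phi> (K n))"
    by (rule sums_finite) (auto simp: K_def vm_empty)
  ultimately have "\<phi> J = (\<Sum>n\<in>{..<N}. \<phi> (K n))" by (rule sums_unique2)
  then show ?thesis by (simp add: K_def)
qed

text \<open>A cell lying between two others that meet an interval is contained in it. So only the
  first and the last cell met can be cut properly.\<close>

lemma card_boundary_cells:
  assumes J: "J \<in> subintervals I"
  shows "card {j. j < N \<and> J \<inter> cell N j \<noteq> {} \<and> \<not> cell N j \<subseteq> J} \<le> 2"
proof -
  let ?S = "{j. j < N \<and> J \<inter> cell N j \<noteq> {} \<and> \<not> cell N j \<subseteq> J}"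
  have fin: "finite ?S" by simp
  have no3: "\<not> (i < j \<and> j < l)" if S: "i \<in> ?S" "j \<in> ?S" "l \<in> ?S" for i j l
  proof
    assume lt: "i < j \<and> j < l"
    obtain a where a: "a \<in> J" "a \<in> cell N i" using S(1) by blast
    obtain b where b: "b \<in> J" "b \<in> cell N l" using S(3) by blast
    have "cell N j \<subseteq> J"
    proof
      fix t assume t: "t \<in> cell N j"
      have "a < t" "t < b"
        using cell_less[of i j N a t] cell_less[of j l N t b] lt S a b t by auto
      then show "t \<in> J" using J a(1) b(1) mem_is_interval_1_I[of J a b t] by (simp add: subintervals_def)
    qed
    then show False using S(2) by blast
  qed
  show ?thesis
  proof (cases "?S = {}")
    case False
    have "?S \<subseteq> {Min ?S, Max ?S}"
    proof
      fix j assume j: "j \<in> ?S"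
      have "Min ?S \<le> j" "j \<le> Max ?S" using Min_le[OF fin j] Max_ge[OF fin j] .
      moreover have "Min ?S \<in> ?S" "Max ?S \<in> ?S" using Min_in[OF fin False] Max_in[OF fin False] .
      ultimately show "j \<in> {Min ?S, Max ?S}" using no3[of "Min ?S" j "Max ?S"] j by force
    qed
    then have "card ?S \<le> card {Min ?S, Max ?S}" by (intro card_mono) auto
    also have "\<dots> \<le> 2" by (simp add: card_insert_if)
    finally show ?thesis .
  next
    case True
    show ?thesis unfolding True by simp
  qed
qed

text \<open>On cells inside or outside J the step measure agrees with \<phi>; each of the at most
  two remaining cells contributes at most 2 r / N.\<close>

lemma step_measure_tendsto:
  assumes J: "J \<in> subintervals I"
  shows "(\<lambda>N. step_measure N J) \<longlonglongrightarrow> \<phi> J"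
proof -
  have "norm (step_measure N J - \<phi> J) \<le> 4 * r / real N" if N: "0 < N" for N
  proof -
    let ?S = "{j. j < N \<and> J \<inter> cell N j \<noteq> {} \<and> \<not> cell N j \<subseteq> J}"
    let ?e = "\<lambda>j. (measure B (J \<inter> cell N j) / measure B (cell N j)) *\<^sub>R mass N j - \<phi> (J \<inter> cell N j)"
    have zero: "?e j = 0" if j: "j < N" "j \<notin> ?S" for j
    proof (cases "J \<inter> cell N j = {}")
      case True
      then show ?thesis by (simp add: vm_empty)
    next
      case False
      then have e: "J \<inter> cell N j = cell N j" using j by auto
      \<comment> \<open>A cell of B-measure 0 needs separate care: the quotient is 0 by convention,
        and \<phi> vanishes on the cell as well.\<close>
      show ?thesis
      proof (cases "measure B (cell N j) = 0")
        case True
        then have "\<phi> (cell N j) = 0" using norm_le_cell[of j N "cell N j"] cell_interval[OF j(1)] j(1) by simp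
        then show ?thesis unfolding e mass_def by simp
      qed (simp add: e mass_def)
    qed
    have le: "norm (?e j) \<le> 2 * (r / real N)" if j: "j < N" for j
    proof -
      have "measure B (J \<inter> cell N j) \<le> measure B (cell N j)"
        using sets_subinterval[OF cell_interval[OF j]] by (intro finite_measure_mono) auto
      then have "measure B (J \<inter> cell N j) / measure B (cell N j) \<le> 1" by (cases "measure B (cell N j) = 0") (auto simp: divide_le_eq_1 less_le)
      moreover have "0 \<le> measure B (J \<inter> cell N j) / measure B (cell N j)" by simp
      ultimately have "norm ((measure B (J \<inter> cell N j) / measure B (cell N j)) *\<^sub>R mass N j) \<le> 1 * (r / real N)"
        unfolding norm_scaleR by (intro mult_mono norm_mass_le j) auto
      moreover have "norm (\<phi> (J \<inter> cell N j)) \<le> r / real N"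
        using norm_le_cell[of j N "J \<inter> cell N j"] subintervals_Int[OF J cell_interval[OF j]] cell_small[OF j] j by simp
      ultimately show ?thesis using norm_triangle_ineq4[of "(measure B (J \<inter> cell N j) / measure B (cell N j)) *\<^sub>R mass N j" "\<phi> (J \<inter> cell N j)"]
        by linarith
    qed
    have "step_measure N J - \<phi> J = (\<Sum>j<N. ?e j)"
      unfolding step_measure_def vm_split_cells[OF N J] by (simp only: sum_subtractf)
    also have "\<dots> = (\<Sum>j\<in>?S. ?e j)" using zero by (intro sum.mono_neutral_right) auto
    finally have eq: "step_measure N J - \<phi> J = (\<Sum>j\<in>?S. ?e j)" .
    have "norm (step_measure N J - \<phi> J) \<le> real (card ?S) * (2 * (r / real N))"
      unfolding eq using le by (intro sum_norm_bound) auto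
    also have "\<dots> \<le> real 2 * (2 * (r / real N))"
      by (rule mult_right_mono[OF of_nat_mono[OF card_boundary_cells[OF J]]]) (use r_nonneg in simp)
    finally show ?thesis by simp
  qed
  then have "\<forall>\<^sub>F N in sequentially. norm (step_measure N J - \<phi> J) \<le> 4 * r / real N"
    using eventually_gt_at_top[of 0] by (rule eventually_mono[rotated]) 
  then have "(\<lambda>N. step_measure N J - \<phi> J) \<longlonglongrightarrow> 0"
    by (rule Lim_null_comparison) (rule lim_const_over_n)
  then show ?thesis by (rule LIM_zero_cancel)
qed

section \<open>The dominating measure on the cube and the approximating measures\<close>

definition cube :: "nat \<Rightarrow> (nat \<Rightarrow> real) measure" where
  "cube k = PiM {1..k} (\<lambda>_. B)"

definition cell_box :: "nat \<Rightarrow> (nat \<Rightarrow> nat) \<Rightarrow> nat \<Rightarrow> (nat \<Rightarrow> real) set" where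
  "cell_box N t k = PiE {1..k} (\<lambda>i. cell N (t i))"

lemma sets_cube: "sets (cube k) = sigma_sets (PiE {1..k} (\<lambda>_. I)) (interval_boxes I k)"
  unfolding cube_def sets_PiM_interval_boxes[OF interval, symmetric]
  by (intro sets_PiM_cong refl) (rule sets_B)

lemma product_sigma_finite_B: "product_sigma_finite (\<lambda>_::nat. B)"
  by (intro product_sigma_finite.intro sigma_finite_measure_axioms)

lemma emeasure_box:
  assumes "\<And>i. i \<in> {1..k} \<Longrightarrow> E i \<in> sets B"
  shows "emeasure (cube k) (PiE {1..k} E) = ennreal (\<Prod>i\<in>{1..k}. measure B (E i))"
proof -
  have "emeasure (cube k) (PiE {1..k} E) = (\<Prod>i\<in>{1..k}. emeasure B (E i))"
    unfolding cube_def by (rule product_sigma_finite.emeasure_PiM[OF product_sigma_finite_B _ assms]) simp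
  also have "\<dots> = ennreal (\<Prod>i\<in>{1..k}. measure B (E i))"
    unfolding emeasure_eq_measure by (rule prod_ennreal) simp
  finally show ?thesis .
qed

lemma measure_box:
  assumes "\<And>i. i \<in> {1..k} \<Longrightarrow> E i \<in> sets B"
  shows "measure (cube k) (PiE {1..k} E) = (\<Prod>i\<in>{1..k}. measure B (E i))"
proof -
  have "measure (cube k) (PiE {1..k} E) = enn2real (ennreal (\<Prod>i\<in>{1..k}. measure B (E i)))"
    by (simp only: Sigma_Algebra.measure_def[of "cube k"] emeasure_box[OF assms])
  then show ?thesis by (simp add: prod_nonneg)
qed

lemma finite_measure_cube: "finite_measure (cube k)"
proof (rule finite_measureI)
  have "space (cube k) = PiE {1..k} (\<lambda>_. space B)" by (simp add: cube_def space_PiM)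
  then show "emeasure (cube k) (space (cube k)) \<noteq> \<infinity>"
    using emeasure_box[of k "\<lambda>_. space B"] by simp
qed

lemma cell_box_sets: "t \<in> {1..k} \<rightarrow>\<^sub>E {..<N} \<Longrightarrow> cell_box N t k \<in> sets (cube k)"
  unfolding cell_box_def cube_def
  using sets_subinterval[OF cell_interval] by (intro sets_PiM_I_finite) (auto simp: PiE_iff)

lemma measure_cell_box:
  assumes "t \<in> {1..k} \<rightarrow>\<^sub>E {..<N}"
  shows "measure (cube k) (cell_box N t k) = (\<Prod>i\<in>{1..k}. measure B (cell N (t i)))"
  unfolding cell_box_def using assms sets_subinterval[OF cell_interval] by (intro measure_box) (auto simp: PiE_iff)

lemma cell_box_disjoint:
  assumes "t \<in> {1..k} \<rightarrow>\<^sub>E {..<N}" "t' \<in> {1..k} \<rightarrow>\<^sub>E {..<N}" "t \<noteq> t'"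
  shows "cell_box N t k \<inter> cell_box N t' k = {}"
proof -
  obtain i where i: "i \<in> {1..k}" "t i \<noteq> t' i" using PiE_ext[OF assms(1,2)] assms(3) by blast
  then have "cell N (t i) \<inter> cell N (t' i) = {}"
    using assms(1,2) by (intro cell_disjoint) (auto simp: PiE_iff)
  then show ?thesis using i(1) unfolding cell_box_def PiE_Int by (auto simp: PiE_eq_empty_iff)
qed

text \<open>The product measure formed from step measures: its density with respect to
  \<open>cube k\<close> is constant on each cell box. The dominating measure is the same for all
  N.\<close>

definition grid_measure :: "nat \<Rightarrow> ((nat \<Rightarrow> 'a) \<Rightarrow> 'a) \<Rightarrow> nat \<Rightarrow> (nat \<Rightarrow> real) set \<Rightarrow> 'a" where
  "grid_measure k F N A = (\<Sum>t\<in>{1..k} \<rightarrow>\<^sub>E {..<N}.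
     (measure (cube k) (A \<inter> cell_box N t k) / measure (cube k) (cell_box N t k)) *\<^sub>R F (\<lambda>i. mass N (t i)))"

context
  fixes k :: nat and F :: "(nat \<Rightarrow> 'a) \<Rightarrow> 'a" and C :: real
  assumes F: "multilinear_form k F" and C: "0 \<le> C" "\<And>X. norm (F X) \<le> C * (\<Prod>i\<in>{1..k}. norm (X i))"
begin

interpretation cube: finite_measure "cube k" by (rule finite_measure_cube)

lemma norm_F_cell_le:
  assumes t: "t \<in> {1..k} \<rightarrow>\<^sub>E {..<N}"
  shows "norm (F (\<lambda>i. mass N (t i))) \<le> C * measure (cube k) (cell_box N t k)"
proof -
  have "(\<Prod>i\<in>{1..k}. norm (mass N (t i))) \<le> (\<Prod>i\<in>{1..k}. measure B (cell N (t i)))"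
  proof (intro prod_mono conjI norm_ge_zero)
    fix i assume "i \<in> {1..k}"
    then have "t i < N" using t by (auto simp: PiE_iff)
    then show "norm (mass N (t i)) \<le> measure B (cell N (t i))"
      unfolding mass_def using cell_interval by (intro norm_le_cell) auto
  qed
  then have "C * (\<Prod>i\<in>{1..k}. norm (mass N (t i))) \<le> C * measure (cube k) (cell_box N t k)"
    unfolding measure_cell_box[OF t] using C(1) by (intro mult_left_mono)
  then show ?thesis using C(2)[of "\<lambda>i. mass N (t i)"] by linarith
qed

lemma norm_term_le:
  assumes t: "t \<in> {1..k} \<rightarrow>\<^sub>E {..<N}" and A: "A \<in> sets (cube k)"
  shows "norm ((measure (cube k) (A \<inter> cell_box N t k) / measure (cube k) (cell_box N t k)) *\<^sub>R F (\<lambda>i. mass N (t i)))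
    \<le> C * measure (cube k) (A \<inter> cell_box N t k)"
proof -
  let ?a = "measure (cube k) (A \<inter> cell_box N t k)" and ?b = "measure (cube k) (cell_box N t k)"
  have "norm ((?a / ?b) *\<^sub>R F (\<lambda>i. mass N (t i))) \<le> (?a / ?b) * (C * ?b)"
    using norm_F_cell_le[OF t] by (simp add: mult_left_mono del: times_divide_eq_left)
  also have "\<dots> \<le> C * ?a" using C(1) by (cases "?b = 0") auto
  finally show ?thesis .
qed

text \<open>Domination by one finite positive measure, with a constant that does not depend on N;
  the uniformity below comes from here.\<close>

lemma norm_grid_measure_le:
  assumes A: "A \<in> sets (cube k)"
  shows "norm (grid_measure k F N A) \<le> C * measure (cube k) A"
proof -
  let ?T = "{1..k} \<rightarrow>\<^sub>E {..<N}"
  have "norm (grid_measure k F N A) \<le> (\<Sum>t\<in>?T. C * measure (cube k) (A \<inter> cell_box N t k))"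
    unfolding grid_measure_def by (intro sum_norm_le norm_term_le A)
  also have "\<dots> = C * measure (cube k) (\<Union>t\<in>?T. A \<inter> cell_box N t k)"
  proof -
    have "measure (cube k) (\<Union>t\<in>?T. A \<inter> cell_box N t k) = (\<Sum>t\<in>?T. measure (cube k) (A \<inter> cell_box N t k))"
    proof (rule cube.finite_measure_finite_Union)
      show "finite ?T" by (intro finite_PiE) auto
      show "(\<lambda>t. A \<inter> cell_box N t k) ` ?T \<subseteq> sets (cube k)"
        by (intro image_subsetI sets.Int A cell_box_sets)
      show "disjoint_family_on (\<lambda>t. A \<inter> cell_box N t k) ?T"
        unfolding disjoint_family_on_def
      proof (intro ballI impI)
        fix t t' assume "t \<in> ?T" "t' \<in> ?T" "t \<noteq> t'"
        from cell_box_disjoint[OF this] show "A \<inter> cell_box N t k \<inter> (A \<inter> cell_box N t' k) = {}" by blast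
      qed
    qed
    then show ?thesis by (simp add: sum_distrib_left)
  qed
  also have "\<dots> \<le> C * measure (cube k) A"
    using C(1) A by (intro mult_left_mono cube.finite_measure_mono) auto
  finally show ?thesis .
qed

lemma grid_measure_sums:
  assumes "range A \<subseteq> sets (cube k)" "disjoint_family A"
  shows "(\<lambda>n. grid_measure k F N (A n)) sums grid_measure k F N (\<Union>n. A n)"
  unfolding grid_measure_def
proof (intro sums_sum sums_scaleR_left)
  fix t assume t: "t \<in> {1..k} \<rightarrow>\<^sub>E {..<N}"
  have "(\<lambda>n. measure (cube k) (A n \<inter> cell_box N t k)) sums measure (cube k) (\<Union>n. A n \<inter> cell_box N t k)"
  proof (rule cube.finite_measure_UNION)
    show "range (\<lambda>n. A n \<inter> cell_box N t k) \<subseteq> sets (cube k)"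
      using assms(1) cell_box_sets[OF t] by (intro image_subsetI sets.Int) auto
    show "disjoint_family (\<lambda>n. A n \<inter> cell_box N t k)"
      using assms(2) by (rule disjoint_family_on_bisimulation) auto
  qed
  then have "(\<lambda>n. measure (cube k) (A n \<inter> cell_box N t k) / measure (cube k) (cell_box N t k)) sums
     (measure (cube k) (\<Union>n. A n \<inter> cell_box N t k) / measure (cube k) (cell_box N t k))"
    by (rule sums_divide)
  then show "(\<lambda>n. measure (cube k) (A n \<inter> cell_box N t k) / measure (cube k) (cell_box N t k)) sums
     (measure (cube k) ((\<Union>n. A n) \<inter> cell_box N t k) / measure (cube k) (cell_box N t k))"
    by (simp only: Int_UN_distrib2 UN_simps)
qed

lemma grid_measure_box:
  assumes J: "\<forall>i\<in>{1..k}. J i \<in> subintervals I"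
  shows "grid_measure k F N (PiE {1..k} J) = F (\<lambda>i. step_measure N (J i))"
  unfolding step_measure_def multilinear_form_expand[OF F] grid_measure_def
proof (intro sum.cong refl arg_cong2[where f=scaleR])
  fix t assume t: "t \<in> {1..k} \<rightarrow>\<^sub>E {..<N}"
  have "measure (cube k) (PiE {1..k} J \<inter> cell_box N t k) = (\<Prod>i\<in>{1..k}. measure B (J i \<inter> cell N (t i)))"
    unfolding cell_box_def PiE_Int
  proof (rule measure_box)
    fix i assume "i \<in> {1..k}"
    then show "J i \<inter> cell N (t i) \<in> sets B"
      using J t by (intro sets_subinterval subintervals_Int cell_interval) (auto simp: PiE_iff)
  qed
  then show "measure (cube k) (PiE {1..k} J \<inter> cell_box N t k) / measure (cube k) (cell_box N t k)
     = (\<Prod>i\<in>{1..k}. measure B (J i \<inter> cell N (t i)) / measure B (cell N (t i)))"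
    unfolding measure_cell_box[OF t] by (simp add: prod_dividef)
qed

lemma grid_measure_box_tendsto:
  assumes J: "\<forall>i\<in>{1..k}. J i \<in> subintervals I"
  shows "(\<lambda>N. grid_measure k F N (PiE {1..k} J)) \<longlonglongrightarrow> F (\<lambda>i. \<phi> (J i))"
  unfolding grid_measure_box[OF J]
  by (rule multilinear_formD(4)[OF F]) (use J step_measure_tendsto in blast)

text \<open>Countable additivity uniformly in N: the remainder is the measure of a tail union,
  dominated by a bound in which N does not occur.\<close>

lemma grid_measure_tail:
  assumes A: "range A \<subseteq> sets (cube k)" "disjoint_family A"
  shows "norm (grid_measure k F N (\<Union>n. A n) - (\<Sum>m<n. grid_measure k F N (A m)))
     \<le> C * measure (cube k) (\<Union>m. A (m + n))"
    and "(\<lambda>n. C * measure (cube k) (\<Union>m. A (m + n))) \<longlonglongrightarrow> 0"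
proof -
  have A': "range (\<lambda>m. A (m + n)) \<subseteq> sets (cube k)" "disjoint_family (\<lambda>m. A (m + n))" for n
    using A by (auto simp: disjoint_family_on_def)
  have "grid_measure k F N (\<Union>n. A n) - (\<Sum>m<n. grid_measure k F N (A m)) = grid_measure k F N (\<Union>m. A (m + n))"
    using grid_measure_sums[OF A, of N] by (intro sums_unique2[OF _ grid_measure_sums[OF A']]) (rule sums_split_initial_segment)
  moreover have "(\<Union>m. A (m + n)) \<in> sets (cube k)" using A'(1)[of n] by (intro sets.countable_UN) auto
  ultimately show "norm (grid_measure k F N (\<Union>n. A n) - (\<Sum>m<n. grid_measure k F N (A m)))
     \<le> C * measure (cube k) (\<Union>m. A (m + n))"
    using norm_grid_measure_le by simp
  have "measure (cube k) (\<Union>m. A (m + n)) = (\<Sum>m. measure (cube k) (A (m + n)))" for n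
    using cube.finite_measure_UNION[OF A'] by (simp add: sums_iff)
  moreover have "(\<lambda>n. \<Sum>m. measure (cube k) (A (m + n))) \<longlonglongrightarrow> 0"
    by (rule suminf_exist_split2[OF sums_summable[OF cube.finite_measure_UNION[OF A]]])
  ultimately show "(\<lambda>n. C * measure (cube k) (\<Union>m. A (m + n))) \<longlonglongrightarrow> 0"
    by (simp add: tendsto_mult_right_zero)
qed

text \<open>Convergence on boxes is convergence of the step measures inserted into F. A Dynkin
  induction extends it to all measurable sets, the uniform tails handling disjoint unions.\<close>

lemma convergent_grid_measure:
  assumes A: "A \<in> sets (cube k)"
  shows "convergent (\<lambda>N. grid_measure k F N A)"
  using Int_stable_interval_boxes interval_boxes_subset_Pow A[unfolded sets_cube]
proof (induction A rule: sigma_sets_induct_disjoint)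
  case (basic A)
  then obtain J where "A = PiE {1..k} J" "\<forall>i\<in>{1..k}. J i \<in> subintervals I" by (auto simp: interval_boxes_def)
  then show ?case using grid_measure_box_tendsto[of J] by (auto intro: convergentI)
next
  case empty
  show ?case by (simp add: grid_measure_def convergent_const)
next
  case (compl A)
  let ?\<Omega> = "PiE {1..k} (\<lambda>_. I)"
  have "convergent (\<lambda>N. grid_measure k F N ?\<Omega>)"
    using grid_measure_box_tendsto[of "\<lambda>_. I"] interval by (auto simp: subintervals_def intro: convergentI)
  then have "convergent (\<lambda>N. grid_measure k F N ?\<Omega> - grid_measure k F N A)" using compl(2) by (rule convergent_diff)
  moreover have "grid_measure k F N (?\<Omega> - A) = grid_measure k F N ?\<Omega> - grid_measure k F N A" for N
  proof -
    have ca: "countably_additive_on (sets (cube k)) (grid_measure k F N)"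
      unfolding countably_additive_on_def using grid_measure_sums by blast
    have m: "A \<in> sets (cube k)" "?\<Omega> - A \<in> sets (cube k)" "{} \<in> sets (cube k)"
      using compl(1) unfolding sets_cube by (auto intro: sigma_sets.Compl sigma_sets.Empty)
    have "A \<union> (?\<Omega> - A) = ?\<Omega>" using sigma_sets_into_sp[OF interval_boxes_subset_Pow compl(1)] by blast
    then show ?thesis using countably_additive_on_Un[OF ca m] by (metis Diff_disjoint add_diff_cancel_left')
  qed
  ultimately show ?case by simp
next
  case (union A)
  have A: "range A \<subseteq> sets (cube k)" using union(2) unfolding sets_cube .
  show ?case
  proof (rule convergent_of_approximations)
    show "convergent (\<lambda>N. \<Sum>m<n. grid_measure k F N (A m))" for n by (intro convergent_sum union(3))
  qed (rule grid_measure_tail[OF A union(1)])+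
qed

definition limit_measure where "limit_measure A = lim (\<lambda>N. grid_measure k F N A)"

lemma grid_measure_tendsto: "A \<in> sets (cube k) \<Longrightarrow> (\<lambda>N. grid_measure k F N A) \<longlonglongrightarrow> limit_measure A"
  unfolding limit_measure_def using convergent_grid_measure convergent_LIMSEQ_iff by blast

text \<open>The tail estimate survives N tending to infinity and gives countable additivity of the
  limit. This is the existence half for \<open>ordered_integral\<close>.\<close>

lemma product_measure_limit_measure: "product_measure I \<phi> k F limit_measure"
  unfolding product_measure_iff[OF interval]
proof (intro conjI allI impI)
  show "countably_additive_on (sigma_sets (PiE {1..k} (\<lambda>_. I)) (interval_boxes I k)) limit_measure"
    unfolding countably_additive_on_def sets_cube[symmetric]
  proof (intro allI impI)
    fix A :: "nat \<Rightarrow> (nat \<Rightarrow> real) set" assume A: "range A \<subseteq> sets (cube k)" "disjoint_family A"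
    have U: "(\<Union>n. A n) \<in> sets (cube k)" using A(1) by (intro sets.countable_UN) auto
    have "norm (limit_measure (\<Union>n. A n) - (\<Sum>m<n. limit_measure (A m))) \<le> C * measure (cube k) (\<Union>m. A (m + n))" for n
    proof (rule LIMSEQ_le_const2)
      show "(\<lambda>N. norm (grid_measure k F N (\<Union>n. A n) - (\<Sum>m<n. grid_measure k F N (A m))))
         \<longlonglongrightarrow> norm (limit_measure (\<Union>n. A n) - (\<Sum>m<n. limit_measure (A m)))"
        using A(1) by (intro tendsto_norm tendsto_diff tendsto_sum grid_measure_tendsto U) auto
    qed (use grid_measure_tail(1)[OF A] in blast)
    then have "\<forall>\<^sub>F n in sequentially. norm (limit_measure (\<Union>n. A n) - (\<Sum>m<n. limit_measure (A m))) \<le> C * measure (cube k) (\<Union>m. A (m + n))"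
      by (intro always_eventually allI)
    then have "(\<lambda>n. limit_measure (\<Union>n. A n) - (\<Sum>m<n. limit_measure (A m))) \<longlonglongrightarrow> 0"
      by (rule Lim_null_comparison) (rule grid_measure_tail(2)[OF A])
    then have "(\<lambda>n. limit_measure (\<Union>n. A n) - (limit_measure (\<Union>n. A n) - (\<Sum>m<n. limit_measure (A m))))
        \<longlonglongrightarrow> limit_measure (\<Union>n. A n) - 0"
      by (intro tendsto_diff tendsto_const)
    then show "(\<lambda>n. limit_measure (A n)) sums limit_measure (\<Union>n. A n)" by (simp add: sums_def)
  qed
  fix J assume J: "\<forall>i\<in>{1..k}. J i \<in> subintervals I"
  show "limit_measure (PiE {1..k} J) = F (\<lambda>i. \<phi> (J i))"
    unfolding limit_measure_def by (rule limI[OF grid_measure_box_tendsto[OF J]])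
qed

text \<open>A cell box with increasing indices lies inside the simplex, and one with distinct but
  not increasing indices misses it. Only boxes with a repeated cell contribute an error.\<close>

lemma grid_measure_simplex_approx:
  "norm (grid_measure k F N (ordered_simplex I k) - (\<Sum>t\<in>inc_tuples k N. F (\<lambda>i. mass N (t i))))
    \<le> C * ((real N ^ k - real (N - k) ^ k) * (r / real N) ^ k)"
proof -
  let ?T = "{1..k} \<rightarrow>\<^sub>E {..<N}"
  let ?S = "ordered_simplex I k"
  let ?g = "\<lambda>t. (measure (cube k) (?S \<inter> cell_box N t k) / measure (cube k) (cell_box N t k)) *\<^sub>R F (\<lambda>i. mass N (t i))"
  let ?e = "\<lambda>t. ?g t - (if t \<in> inc_tuples k N then F (\<lambda>i. mass N (t i)) else 0)"
  let ?E = "{t \<in> ?T. \<not> inj_on t {1..k}}"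
  have fT: "finite ?T" by (intro finite_PiE) auto
  have S: "?S \<in> sets (cube k)"
    unfolding sets_cube sets_PiM_interval_boxes[OF interval, symmetric] by (rule ordered_simplex_measurable[OF interval])
  have zero: "?e t = 0" if t: "t \<in> ?T" "inj_on t {1..k}" for t
  proof (cases "t \<in> inc_tuples k N")
    case True
    have "cell_box N t k \<subseteq> ?S"
    proof
      fix s assume s: "s \<in> cell_box N t k"
      have sc: "s i \<in> cell N (t i)" "t i < N" if "i \<in> {1..k}" for i
        using s t(1) that by (auto simp: cell_box_def PiE_iff)
      have "s i \<in> I" if "i \<in> {1..k}" for i
        using sc[OF that] cell_interval[of "t i" N] by (auto simp: subintervals_def)
      moreover have "s i \<le> s (Suc i)" if i: "i \<in> {1..<k}" for i
        using sc[of i] sc[of "Suc i"] i True cell_less[of "t i" "t (Suc i)" N "s i" "s (Suc i)"]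
        by (auto simp: inc_tuples_def)
      moreover have "s \<in> extensional {1..k}" using s by (auto simp: cell_box_def PiE_iff)
      ultimately show "s \<in> ?S" unfolding ordered_simplex_def PiE_iff by blast
    qed
    then have e: "?S \<inter> cell_box N t k = cell_box N t k" by blast
    show ?thesis
    proof (cases "measure (cube k) (cell_box N t k) = 0")
      case z: True
      then have "F (\<lambda>i. mass N (t i)) = 0" using norm_F_cell_le[OF t(1)] by simp
      then show ?thesis by simp
    qed (use True in \<open>simp add: e\<close>)
  next
    case False
    then obtain i where i: "i \<in> {1..<k}" "\<not> t i < t (Suc i)" using t(1) by (auto simp: inc_tuples_def)
    have "t i \<noteq> t (Suc i)" using inj_on_contraD[OF t(2), of i "Suc i"] i(1) by auto
    then have lt: "t (Suc i) < t i" using i(2) by simp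
    have "?S \<inter> cell_box N t k = {}"
    proof (rule ccontr)
      assume "?S \<inter> cell_box N t k \<noteq> {}"
      then obtain s where s: "s \<in> ?S" "s \<in> cell_box N t k" by blast
      have "s i \<le> s (Suc i)" using s(1) i(1) by (auto simp: ordered_simplex_def)
      moreover have "s i \<in> cell N (t i)" "s (Suc i) \<in> cell N (t (Suc i))" "t i < N"
        using s(2) i(1) t(1) by (auto simp: cell_box_def PiE_iff)
      ultimately show False using cell_less[OF lt, of N "s (Suc i)" "s i"] by simp
    qed
    then show ?thesis using False by simp
  qed
  have le: "norm (?e t) \<le> C * (r / real N) ^ k" if t: "t \<in> ?E" for t
  proof -
    have tT: "t \<in> ?T" using t by simp
    have "t \<notin> inc_tuples k N" using t inc_tuples_subset_inj by (auto simp: inj_tuples_def)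
    then have "norm (?e t) \<le> C * measure (cube k) (?S \<inter> cell_box N t k)" using norm_term_le[OF tT S] by simp
    also have "\<dots> \<le> C * measure (cube k) (cell_box N t k)"
      using C(1) cell_box_sets[OF tT] by (intro mult_left_mono cube.finite_measure_mono) auto
    also have "\<dots> \<le> C * (\<Prod>i\<in>{1..k}. r / real N)"
      unfolding measure_cell_box[OF tT] using C(1) tT
      by (intro mult_left_mono prod_mono) (auto simp: PiE_iff intro: cell_small)
    finally show ?thesis by simp
  qed
  have inc: "inc_tuples k N \<subseteq> ?T" by (auto simp: inc_tuples_def)
  have "(\<Sum>t\<in>inc_tuples k N. F (\<lambda>i. mass N (t i))) = (\<Sum>t\<in>?T. if t \<in> inc_tuples k N then F (\<lambda>i. mass N (t i)) else 0)"
    using inc fT by (intro sum.mono_neutral_cong_left) auto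
  then have "grid_measure k F N ?S - (\<Sum>t\<in>inc_tuples k N. F (\<lambda>i. mass N (t i))) = (\<Sum>t\<in>?T. ?e t)"
    unfolding grid_measure_def by (simp only: sum_subtractf)
  also have "\<dots> = (\<Sum>t\<in>?E. ?e t)" using zero fT by (intro sum.mono_neutral_right) auto
  finally have eq: "grid_measure k F N ?S - (\<Sum>t\<in>inc_tuples k N. F (\<lambda>i. mass N (t i))) = (\<Sum>t\<in>?E. ?e t)" .
  have "norm (grid_measure k F N ?S - (\<Sum>t\<in>inc_tuples k N. F (\<lambda>i. mass N (t i)))) \<le> real (card ?E) * (C * (r / real N) ^ k)"
    unfolding eq using le by (intro sum_norm_bound)
  also have "\<dots> \<le> (real N ^ k - real (N - k) ^ k) * (C * (r / real N) ^ k)"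
    using card_noninjective_le[of k N] C(1) r_nonneg by (intro mult_right_mono) auto
  finally show ?thesis by (simp only: mult.left_commute)
qed

lemma inc_sum_tendsto_ordered_integral_aux:
  "(\<lambda>N. \<Sum>t\<in>inc_tuples k N. F (\<lambda>i. mass N (t i))) \<longlonglongrightarrow> ordered_integral I \<phi> k F"
proof -
  let ?S = "ordered_simplex I k"
  have S: "?S \<in> sets (cube k)"
    unfolding sets_cube sets_PiM_interval_boxes[OF interval, symmetric] by (rule ordered_simplex_measurable[OF interval])
  have "(\<lambda>N. C * ((real N ^ k - real (N - k) ^ k) * (r / real N) ^ k)) \<longlonglongrightarrow> 0"
    by (intro tendsto_mult_right_zero noninjective_fraction_tendsto)
  then have "(\<lambda>N. grid_measure k F N ?S - (\<Sum>t\<in>inc_tuples k N. F (\<lambda>i. mass N (t i)))) \<longlonglongrightarrow> 0"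
    by (rule Lim_null_comparison[rotated]) (intro always_eventually allI grid_measure_simplex_approx)
  from tendsto_diff[OF grid_measure_tendsto[OF S] this]
  show ?thesis
    unfolding ordered_integral_eqI[OF interval product_measure_limit_measure] by simp
qed

end

lemma inc_sum_tendsto_ordered_integral:
  assumes F: "multilinear_form k F"
  shows "(\<lambda>N. \<Sum>t\<in>inc_tuples k N. F (\<lambda>i. mass N (t i))) \<longlonglongrightarrow> ordered_integral I \<phi> k F"
proof -
  obtain C where "0 \<le> C" "\<And>X. norm (F X) \<le> C * (\<Prod>i\<in>{1..k}. norm (X i))"
    using multilinear_formD(3)[OF F] by blast
  then show ?thesis by (rule inc_sum_tendsto_ordered_integral_aux[OF F])
qed

end



subsection \<open>The variation measure\<close>

locale finite_variation_measure =
  fixes I :: "real set" and \<phi> :: "real set \<Rightarrow> 'a::banach"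
  assumes interval: "is_interval I" and bounded_I: "bounded I"
    and vector_measure: "vector_measure_on I \<phi>"
    and no_atoms: "continuous_measure_on I \<phi>"
    and finite_variation: "variation \<phi> I < \<infinity>"
begin

definition "partitions H = {P. finite P \<and> P \<subseteq> subintervals H \<and> disjoint P}"

definition "nsum P = (\<Sum>K\<in>P. norm (\<phi> K))"

definition "var H = enn2real (variation \<phi> H)"

definition "v t = var (I \<inter> {..t})"

lemma vm_empty: "\<phi> {} = 0"
  by (rule vector_measure_on_empty[OF vector_measure])

lemma vm_Un:
  assumes "J \<in> subintervals I" "K \<in> subintervals I" "J \<inter> K = {}" "J \<union> K \<in> subintervals I"
  shows "\<phi> (J \<union> K) = \<phi> J + \<phi> K"
proof -
  define D where "D n = (if n = 0 then J else if n = 1 then K else {})" for n :: nat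
  have "range D \<subseteq> subintervals I" "disjoint_family D"
    using assms by (auto simp: D_def disjoint_family_on_def subintervals_def)
  moreover have U: "(\<Union>n. D n) = J \<union> K"
  proof
    show "J \<union> K \<subseteq> (\<Union>n. D n)" using UN_upper[of 0 UNIV D] UN_upper[of 1 UNIV D] by (auto simp: D_def)
  qed (auto simp: D_def split: if_splits)
  ultimately have "(\<lambda>n. \<phi> (D n)) sums \<phi> (J \<union> K)"
    using vector_measure[unfolded vector_measure_on_def, rule_format, of D] assms(4) by simp
  moreover have "(\<lambda>n. \<phi> (D n)) sums (\<Sum>n\<in>{0, 1}. \<phi> (D n))"
    using vm_empty by (intro sums_finite) (auto simp: D_def)
  ultimately have "\<phi> (J \<union> K) = (\<Sum>n\<in>{0, 1}. \<phi> (D n))" by (rule sums_unique2)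
  then show ?thesis by (simp add: D_def)
qed

lemma variation_eq: "variation \<phi> H = (SUP P \<in> partitions H. ennreal (nsum P))"
  unfolding variation_def partitions_def nsum_def by (simp add: sum_ennreal)

lemma partitions_mono: "H \<subseteq> H' \<Longrightarrow> partitions H \<subseteq> partitions H'"
  by (auto simp: partitions_def subintervals_def)

lemma empty_partition: "{} \<in> partitions H"
  by (simp add: partitions_def disjoint_def)

lemma variation_finite: "H \<subseteq> I \<Longrightarrow> variation \<phi> H < \<infinity>"
  using SUP_subset_mono[OF partitions_mono order_refl, of H I] finite_variation
  unfolding variation_eq by (meson le_less_trans)

lemma nsum_nonneg: "0 \<le> nsum P"
  by (simp add: nsum_def sum_nonneg)

lemma nsum_le_var:
  assumes "H \<subseteq> I" "P \<in> partitions H"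
  shows "nsum P \<le> var H"
proof -
  have "ennreal (nsum P) \<le> variation \<phi> H" unfolding variation_eq by (rule SUP_upper[OF assms(2)])
  then have "enn2real (ennreal (nsum P)) \<le> var H"
    unfolding var_def using variation_finite[OF assms(1)] by (intro enn2real_mono) auto
  then show ?thesis by (simp add: nsum_nonneg)
qed

lemma var_least:
  assumes "\<And>P. P \<in> partitions H \<Longrightarrow> nsum P \<le> b"
  shows "var H \<le> b"
proof -
  have b: "0 \<le> b" using assms[OF empty_partition] by (simp add: nsum_def)
  have "variation \<phi> H \<le> ennreal b"
    unfolding variation_eq using assms by (intro SUP_least ennreal_leI)
  then show ?thesis unfolding var_def using b by (intro enn2real_leI)
qed

lemma var_approx:
  assumes "H \<subseteq> I" "e > 0"
  obtains P where "P \<in> partitions H" "var H < nsum P + e"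
proof -
  have "\<exists>P\<in>partitions H. var H - e < nsum P"
  proof (rule ccontr)
    assume "\<not> (\<exists>P\<in>partitions H. var H - e < nsum P)"
    then have "var H \<le> var H - e" by (intro var_least) (simp add: not_less)
    then show False using assms(2) by simp
  qed
  then show ?thesis using that by (auto simp: algebra_simps)
qed

lemma var_mono: "H \<subseteq> H' \<Longrightarrow> H' \<subseteq> I \<Longrightarrow> var H \<le> var H'"
  by (rule var_least, rule nsum_le_var, assumption, erule subsetD[OF partitions_mono, rotated])

text \<open>Superadditivity: families of intervals in disjoint sets join to a family in their
  union.\<close>

lemma var_plus_nsum_le:
  assumes H: "H \<subseteq> T" "H' \<subseteq> T" "T \<subseteq> I" "H \<inter> H' = {}" and P: "P \<in> partitions H'"
  shows "var H + nsum P \<le> var T"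
proof -
  have "var H \<le> var T - nsum P"
  proof (rule var_least)
    fix R assume R: "R \<in> partitions H"
    have int: "K = {}" if "K \<in> R" "K' \<in> P" "x \<in> K" "x \<in> K'" for K K' x
    proof -
      have "K \<subseteq> H" "K' \<subseteq> H'" using that(1,2) R P by (auto simp: partitions_def subintervals_def)
      then show ?thesis using that(3,4) H(4) by blast
    qed
    have "A \<inter> B = {}" if "A \<in> R \<union> P" "B \<in> R \<union> P" "A \<noteq> B" for A B
    proof (cases "A \<in> R \<longleftrightarrow> B \<in> R")
      case True
      then show ?thesis using that R P by (cases "A \<in> R") (auto simp: partitions_def disjoint_def)
    next
      case False
      then show ?thesis using that int by blast
    qed
    then have "disjoint (R \<union> P)" unfolding disjoint_def by blast
    then have "R \<union> P \<in> partitions T"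
      using subsetD[OF partitions_mono[OF H(1)] R] subsetD[OF partitions_mono[OF H(2)] P]
      by (simp add: partitions_def)
    then have "nsum (R \<union> P) \<le> var T" by (rule nsum_le_var[OF H(3)])
    moreover have "nsum (R \<union> P) + (\<Sum>K\<in>R \<inter> P. norm (\<phi> K)) = nsum R + nsum P"
      unfolding nsum_def using R P by (intro sum.union_inter) (auto simp: partitions_def)
    \<comment> \<open>Both families may contain the empty interval, which the union counts once; its
      \<phi> is 0.\<close>
    moreover have "(\<Sum>K\<in>R \<inter> P. norm (\<phi> K)) = 0"
    proof (rule sum.neutral, rule ballI)
      fix K assume "K \<in> R \<inter> P"
      then have "K = {}" using int by blast
      then show "norm (\<phi> K) = 0" by (simp add: vm_empty)
    qed
    ultimately show "nsum R \<le> var T - nsum P" by simp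
  qed
  then show ?thesis by simp
qed

lemma sum_cut_le_var:
  assumes P: "P \<in> partitions I" and H: "is_interval H"
  shows "(\<lambda>K. K \<inter> H) ` P \<in> partitions (I \<inter> H)" "(\<Sum>K\<in>P. norm (\<phi> (K \<inter> H))) = nsum ((\<lambda>K. K \<inter> H) ` P)"
proof -
  have dis: "A \<inter> B = {}" if "A \<in> P" "B \<in> P" "A \<noteq> B" for A B
    using P that by (auto simp: partitions_def disjoint_def)
  show "(\<lambda>K. K \<inter> H) ` P \<in> partitions (I \<inter> H)"
    unfolding partitions_def
  proof (intro CollectI conjI)
    show "finite ((\<lambda>K. K \<inter> H) ` P)" using P by (simp add: partitions_def)
    show "(\<lambda>K. K \<inter> H) ` P \<subseteq> subintervals (I \<inter> H)"
      using P H by (auto simp: partitions_def subintervals_def intro: is_interval_Int)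
    have "(A \<inter> H) \<inter> (B \<inter> H) = {}" if "A \<in> P" "B \<in> P" "A \<inter> H \<noteq> B \<inter> H" for A B
    proof -
      have "A \<noteq> B" using that(3) by auto
      then show ?thesis using dis[OF that(1,2)] by auto
    qed
    then show "disjoint ((\<lambda>K. K \<inter> H) ` P)" unfolding disjoint_def by blast
  qed
  show "(\<Sum>K\<in>P. norm (\<phi> (K \<inter> H))) = nsum ((\<lambda>K. K \<inter> H) ` P)"
    unfolding nsum_def
  proof (subst sum.reindex_nontrivial)
    show "finite P" using P by (simp add: partitions_def)
    fix A B assume AB: "A \<in> P" "B \<in> P" "A \<noteq> B" "A \<inter> H = B \<inter> H"
    then have "A \<inter> H = {}" using dis[OF AB(1-3)] by auto
    then show "norm (\<phi> (A \<inter> H)) = 0" by (simp add: vm_empty)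
  qed simp
qed

lemma cut_subinterval: "K \<in> subintervals I \<Longrightarrow> is_interval H \<Longrightarrow> K \<inter> H \<in> subintervals I"
  by (auto simp: subintervals_def intro: is_interval_Int)

lemma vm_cut:
  assumes K: "K \<in> subintervals I" and st: "s \<le> t"
  shows "\<phi> (K \<inter> {s<..t}) = \<phi> (K \<inter> {..t}) - \<phi> (K \<inter> {..s})"
proof -
  have e: "K \<inter> {..s} \<union> K \<inter> {s<..t} = K \<inter> {..t}" using st by auto
  have "\<phi> (K \<inter> {..s} \<union> K \<inter> {s<..t}) = \<phi> (K \<inter> {..s}) + \<phi> (K \<inter> {s<..t})"
    by (rule vm_Un) (auto simp: e intro!: cut_subinterval K is_interval_ic is_interval_oc)
  then show ?thesis unfolding e by simp
qed

lemma vm_singleton: "\<phi> (K \<inter> {t}) = 0" if "K \<subseteq> I"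
  using that no_atoms vm_empty by (cases "t \<in> K") (auto simp: continuous_measure_on_def)

text \<open>Countable additivity, applied to the consecutive differences along a monotone sequence.
  From the left the limit omits the point t, which carries no mass.\<close>

lemma distribution_continuous:
  assumes K: "K \<in> subintervals I"
  shows "isCont (\<lambda>t. \<phi> (K \<inter> {..t})) t"
proof -
  let ?G = "\<lambda>t. \<phi> (K \<inter> {..t})"
  have "(?G \<longlongrightarrow> ?G t) (at_left t)"
  proof (rule tendsto_at_left_sequentially[of "t - 1"])
    fix S :: "nat \<Rightarrow> real" assume S: "\<And>n. S n < t" "incseq S" "S \<longlonglongrightarrow> t"
    define D where "D n = K \<inter> (if n = 0 then {..S 0} else {S (n - 1)<..S n})" for n
    have mono: "S i \<le> S j" if "i \<le> j" for i j using S(2) that by (simp add: incseq_def)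
    have r: "range D \<subseteq> subintervals I"
      using K by (auto simp: D_def intro!: cut_subinterval is_interval_ic is_interval_oc)
    have Dl: "x \<le> S n" if "x \<in> D n" for x n using that by (auto simp: D_def split: if_splits)
    have Dg: "S n < x" if "x \<in> D m" "n < m" for x n m
    proof -
      have "m \<noteq> 0" "n \<le> m - 1" using that(2) by auto
      then show ?thesis using that(1) mono[of n "m - 1"] by (auto simp: D_def)
    qed
    have d: "disjoint_family D"
      unfolding disjoint_family_on_def
    proof (intro ballI impI)
      fix i j :: nat assume "i \<noteq> j"
      then show "D i \<inter> D j = {}"
        using Dl[of _ i] Dl[of _ j] Dg[of _ j i] Dg[of _ i j] by (cases "i < j") (force simp: not_less)+
    qed
    have U: "(\<Union>n. D n) = K \<inter> {..<t}"
    proof (intro set_eqI iffI)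
      fix x assume "x \<in> (\<Union>n. D n)"
      then obtain n where n: "x \<in> D n" by blast
      then have "x < t" using Dl[OF n] S(1)[of n] by simp
      then show "x \<in> K \<inter> {..<t}" using n by (auto simp: D_def)
    next
      fix x assume x: "x \<in> K \<inter> {..<t}"
      have "\<forall>\<^sub>F n in sequentially. x < S n" using S(3) x by (auto intro: order_tendstoD)
      then obtain n where "x < S n" by (auto simp: eventually_sequentially)
      then have ex: "x \<le> S n" by simp
      define l where "l = (LEAST n. x \<le> S n)"
      have l: "x \<le> S l" unfolding l_def by (rule LeastI[of "\<lambda>n. x \<le> S n", OF ex])
      have "\<not> x \<le> S (l - 1)" if "l \<noteq> 0"
        unfolding l_def by (rule not_less_Least) (use that in \<open>simp add: l_def\<close>)
      then have "x \<in> D l" using l x by (auto simp: D_def)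
      then show "x \<in> (\<Union>n. D n)" by blast
    qed
    have sub: "(\<Union>n. D n) \<in> subintervals I" unfolding U by (intro cut_subinterval K is_interval_io)
    have "(\<lambda>n. \<phi> (D n)) sums \<phi> (K \<inter> {..<t})"
      using vector_measure[unfolded vector_measure_on_def, rule_format, OF r d sub] unfolding U .
    then have "(\<lambda>n. \<Sum>i\<le>n. \<phi> (D i)) \<longlonglongrightarrow> \<phi> (K \<inter> {..<t})" by (simp add: sums_def_le)
    moreover have "(\<Sum>i\<le>n. \<phi> (D i)) = ?G (S n)" for n
    proof (induction n)
      case 0
      show ?case by (simp add: D_def)
    next
      case (Suc n)
      have "\<phi> (D (Suc n)) = ?G (S (Suc n)) - ?G (S n)"
        using vm_cut[OF K mono[of n "Suc n"]] by (simp add: D_def)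
      then show ?case using Suc by simp
    qed
    moreover have "\<phi> (K \<inter> {..<t}) = ?G t"
    proof -
      have e: "K \<inter> {..<t} \<union> K \<inter> {t} = K \<inter> {..t}" by auto
      have it: "is_interval {t}" using is_interval_cc[of t t] by simp
      have "\<phi> (K \<inter> {..<t} \<union> K \<inter> {t}) = \<phi> (K \<inter> {..<t}) + \<phi> (K \<inter> {t})"
        by (rule vm_Un) (auto simp: e intro!: cut_subinterval K is_interval_ic is_interval_io it)
      then show ?thesis unfolding e using vm_singleton[of K t] K by (simp add: subintervals_def)
    qed
    ultimately show "(\<lambda>n. ?G (S n)) \<longlonglongrightarrow> ?G t" by simp
  qed simp
  moreover have "(?G \<longlongrightarrow> ?G t) (at_right t)"
  proof (rule tendsto_at_right_sequentially[of _ "t + 1"])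
    fix S :: "nat \<Rightarrow> real" assume S: "\<And>n. t < S n" "decseq S" "S \<longlonglongrightarrow> t"
    define D where "D n = K \<inter> {S (Suc n)<..S n}" for n
    have mono: "S j \<le> S i" if "i \<le> j" for i j using S(2) that by (simp add: decseq_def)
    have r: "range D \<subseteq> subintervals I" using K by (auto simp: D_def intro!: cut_subinterval is_interval_oc)
    have Dl: "x \<le> S (Suc m)" if "x \<in> D n" "m < n" for x m n
      using that mono[of "Suc m" n] by (auto simp: D_def)
    have Dg: "S (Suc n) < x" if "x \<in> D n" for x n using that by (auto simp: D_def)
    have d: "disjoint_family D"
      unfolding disjoint_family_on_def
    proof (intro ballI impI)
      fix i j :: nat assume "i \<noteq> j"
      then show "D i \<inter> D j = {}"
        using Dl[of _ i j] Dl[of _ j i] Dg[of _ j] Dg[of _ i] by (cases "i < j") (force simp: not_less)+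
    qed
    have U: "(\<Union>n. D n) = K \<inter> {t<..S 0}"
    proof (intro set_eqI iffI)
      fix x assume "x \<in> (\<Union>n. D n)"
      then obtain n where n: "x \<in> D n" by blast
      then have "t < x" "x \<le> S 0" using Dg[OF n] S(1)[of "Suc n"] mono[of 0 n] by (auto simp: D_def)
      then show "x \<in> K \<inter> {t<..S 0}" using n by (auto simp: D_def)
    next
      fix x assume x: "x \<in> K \<inter> {t<..S 0}"
      have "\<forall>\<^sub>F n in sequentially. S n < x" using S(3) x by (auto intro: order_tendstoD)
      then obtain n where ex: "S n < x" by (auto simp: eventually_sequentially)
      define l where "l = (LEAST n. S n < x)"
      have l: "S l < x" unfolding l_def by (rule LeastI[of "\<lambda>n. S n < x", OF ex])
      have l0: "l \<noteq> 0" using l x by (metis Int_iff greaterThanAtMost_iff not_le)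
      have "\<not> S (l - 1) < x"
        unfolding l_def by (rule not_less_Least) (use l0 in \<open>simp add: l_def\<close>)
      then have "x \<in> D (l - 1)" using l x l0 by (auto simp: D_def)
      then show "x \<in> (\<Union>n. D n)" by blast
    qed
    have sub: "(\<Union>n. D n) \<in> subintervals I" unfolding U by (intro cut_subinterval K is_interval_oc)
    have "(\<lambda>n. \<phi> (D n)) sums \<phi> (K \<inter> {t<..S 0})"
      using vector_measure[unfolded vector_measure_on_def, rule_format, OF r d sub] unfolding U .
    then have "(\<lambda>n. \<Sum>i<n. \<phi> (D i)) \<longlonglongrightarrow> \<phi> (K \<inter> {t<..S 0})" by (simp add: sums_def)
    moreover have "(\<Sum>i<n. \<phi> (D i)) = ?G (S 0) - ?G (S n)" for n
    proof (induction n)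
      case (Suc n)
      have "\<phi> (D n) = ?G (S n) - ?G (S (Suc n))"
        using vm_cut[OF K mono[of n "Suc n"]] by (simp add: D_def)
      then show ?case using Suc by simp
    qed simp
    moreover have "\<phi> (K \<inter> {t<..S 0}) = ?G (S 0) - ?G t"
      using vm_cut[OF K, of t "S 0"] S(1)[of 0] by simp
    ultimately have "(\<lambda>n. ?G (S 0) - ?G (S n)) \<longlonglongrightarrow> ?G (S 0) - ?G t" by simp
    from tendsto_diff[OF tendsto_const[of "?G (S 0)"] this]
    show "(\<lambda>n. ?G (S n)) \<longlonglongrightarrow> ?G t" by simp
  qed simp
  ultimately show ?thesis unfolding isCont_def by (simp add: filterlim_at_split)
qed

section \<open>Continuity of the variation and equidistribution of its mass\<close>

lemma v_plus_norm_le: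
  assumes "J \<in> subintervals I" "J \<subseteq> {s<..t}" "s \<le> t"
  shows "v s + norm (\<phi> J) \<le> v t"
proof -
  have "var (I \<inter> {..s}) + nsum {J} \<le> var (I \<inter> {..t})"
    using assms by (intro var_plus_nsum_le[of _ _ "I \<inter> {s<..t}"])
      (auto simp: partitions_def subintervals_def disjoint_def)
  then show ?thesis by (simp add: v_def nsum_def)
qed

lemma v_mono: "s \<le> t \<Longrightarrow> v s \<le> v t"
  unfolding v_def by (intro var_mono) auto

text \<open>Cut a nearly optimal family at s and t: the parts left of s sum to at most
  \<open>v s\<close>, those right of t to at most \<open>var I - v t\<close>. What remains of the
  increment of v is carried by finitely many distribution functions of \<phi>, up to e.\<close>

lemma v_increment_le:
  assumes P: "P \<in> partitions I" "var I < nsum P + e" and st: "s \<le> t"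
  shows "v t \<le> v s + (\<Sum>K\<in>P. norm (\<phi> (K \<inter> {..t}) - \<phi> (K \<inter> {..s}))) + e"
proof -
  have PK: "K \<in> subintervals I" if "K \<in> P" for K using P(1) that by (auto simp: partitions_def)
  have "nsum P \<le> (\<Sum>K\<in>P. norm (\<phi> (K \<inter> {..s})) + norm (\<phi> (K \<inter> {..t}) - \<phi> (K \<inter> {..s})) + norm (\<phi> (K \<inter> {t<..})))"
    unfolding nsum_def
  proof (rule sum_mono)
    fix K assume "K \<in> P"
    note K = PK[OF this]
    have e: "K \<inter> {..t} \<union> K \<inter> {t<..} = K" by auto
    have "\<phi> (K \<inter> {..t} \<union> K \<inter> {t<..}) = \<phi> (K \<inter> {..t}) + \<phi> (K \<inter> {t<..})"
      by (rule vm_Un) (auto simp: e intro!: cut_subinterval K is_interval_ic is_interval_oi)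
    then have "\<phi> K = \<phi> (K \<inter> {..s}) + (\<phi> (K \<inter> {..t}) - \<phi> (K \<inter> {..s})) + \<phi> (K \<inter> {t<..})" unfolding e by simp
    then have "norm (\<phi> K) = norm (\<phi> (K \<inter> {..s}) + (\<phi> (K \<inter> {..t}) - \<phi> (K \<inter> {..s})) + \<phi> (K \<inter> {t<..}))"
      by (rule arg_cong)
    then show "norm (\<phi> K) \<le> norm (\<phi> (K \<inter> {..s})) + norm (\<phi> (K \<inter> {..t}) - \<phi> (K \<inter> {..s})) + norm (\<phi> (K \<inter> {t<..}))"
      using norm_triangle_ineq[of "\<phi> (K \<inter> {..s}) + (\<phi> (K \<inter> {..t}) - \<phi> (K \<inter> {..s}))" "\<phi> (K \<inter> {t<..})"]
        norm_triangle_ineq[of "\<phi> (K \<inter> {..s})" "\<phi> (K \<inter> {..t}) - \<phi> (K \<inter> {..s})"] by linarith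
  qed
  also have "\<dots> = (\<Sum>K\<in>P. norm (\<phi> (K \<inter> {..s}))) + (\<Sum>K\<in>P. norm (\<phi> (K \<inter> {..t}) - \<phi> (K \<inter> {..s})))
      + (\<Sum>K\<in>P. norm (\<phi> (K \<inter> {t<..})))"
    by (simp only: sum.distrib)
  finally have 1: "nsum P \<le> (\<Sum>K\<in>P. norm (\<phi> (K \<inter> {..s}))) + (\<Sum>K\<in>P. norm (\<phi> (K \<inter> {..t}) - \<phi> (K \<inter> {..s})))
      + (\<Sum>K\<in>P. norm (\<phi> (K \<inter> {t<..})))" .
  have 2: "(\<Sum>K\<in>P. norm (\<phi> (K \<inter> {..s}))) \<le> v s"
    unfolding v_def sum_cut_le_var(2)[OF P(1) is_interval_ic]
    by (rule nsum_le_var[OF _ sum_cut_le_var(1)[OF P(1) is_interval_ic]]) simp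
  have 3: "v t + (\<Sum>K\<in>P. norm (\<phi> (K \<inter> {t<..}))) \<le> var I"
    unfolding v_def sum_cut_le_var(2)[OF P(1) is_interval_oi]
    by (rule var_plus_nsum_le[OF _ _ _ _ sum_cut_le_var(1)[OF P(1) is_interval_oi]]) auto
  show ?thesis using 1 2 3 P(2) by linarith
qed

text \<open>The variation inherits the absence of atoms, since its increments are dominated, up to
  e/2, by a finite sum of continuous functions vanishing at t.\<close>

lemma v_continuous: "isCont v t"
  unfolding continuous_at_eps_delta
proof (intro allI impI)
  fix e :: real assume e: "e > 0"
  obtain P where P: "P \<in> partitions I" "var I < nsum P + e / 2" using var_approx[of I "e / 2"] e by auto
  let ?g = "\<lambda>s. \<Sum>K\<in>P. norm (\<phi> (K \<inter> {..s}) - \<phi> (K \<inter> {..t}))"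
  have g: "isCont ?g t"
    using P(1) by (intro continuous_intros distribution_continuous) (auto simp: partitions_def)
  then obtain d where d: "d > 0" "\<And>s. dist s t < d \<Longrightarrow> dist (?g s) (?g t) < e / 2"
    using g[unfolded continuous_at_eps_delta, rule_format, of "e / 2"] e by auto
  show "\<exists>d>0. \<forall>s. dist s t < d \<longrightarrow> dist (v s) (v t) < e"
  proof (intro exI[of _ d] conjI allI impI d(1))
    fix s assume s: "dist s t < d"
    have g: "?g s < e / 2" using d(2)[OF s] by (simp add: dist_real_def)
    have g': "(\<Sum>K\<in>P. norm (\<phi> (K \<inter> {..t}) - \<phi> (K \<inter> {..s}))) = ?g s" by (simp add: norm_minus_commute)
    show "dist (v s) (v t) < e"
    proof (cases "s \<le> t")
      case True
      then show ?thesis using v_increment_le[OF P True] v_mono[OF True] g g' by (simp add: dist_real_def)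
    next
      case False
      then have "t \<le> s" by simp
      then show ?thesis using v_increment_le[OF P \<open>t \<le> s\<close>] v_mono[OF \<open>t \<le> s\<close>] g by (simp add: dist_real_def)
    qed
  qed
qed

lemma var_nonneg: "0 \<le> var H" by (simp add: var_def)

lemma var_singleton: "var (I \<inter> {t}) = 0"
proof -
  have "var (I \<inter> {t}) \<le> 0"
  proof (rule var_least)
    fix P assume P: "P \<in> partitions (I \<inter> {t})"
    have "\<phi> K = 0" if "K \<in> P" for K
    proof -
      have "K \<subseteq> I" "K = K \<inter> {t}" using P that by (auto simp: partitions_def subintervals_def)
      then show ?thesis using vm_singleton[of K t] by simp
    qed
    then show "nsum P \<le> 0" by (simp add: nsum_def)
  qed
  then show ?thesis using var_nonneg[of "I \<inter> {t}"] by simp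
qed

lemma ex_equidistant_points:
  assumes ab: "a \<le> b" "v a = 0" "v b = var I" and N: "0 < N"
  shows "\<exists>\<tau>. \<tau> 0 = a \<and> \<tau> N = b \<and> (\<forall>i j. i \<le> j \<longrightarrow> j \<le> N \<longrightarrow> \<tau> i \<le> \<tau> j) \<and> (\<forall>j<N. v (\<tau> (Suc j)) - v (\<tau> j) \<le> var I / real N)"
proof (cases "var I = 0")
  \<comment> \<open>With zero variation all levels coincide and would not force the points to be
    increasing.\<close>
  case True
  have "v t = 0" if "a \<le> t" "t \<le> b" for t using v_mono[OF that(1)] v_mono[OF that(2)] ab True by simp
  then show ?thesis
    using ab N True by (intro exI[of _ "\<lambda>j. if j = 0 then a else b"]) auto
next
  case False
  then have r: "var I > 0" using var_nonneg[of I] by simp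
  have "\<exists>t. v t = real j * (var I / real N)" if "j \<le> N" for j
  proof -
    have "real j / real N \<le> 1" using that N by simp
    then have "real j / real N * var I \<le> 1 * var I" using r by (intro mult_right_mono) auto
    then have "v a \<le> real j * (var I / real N)" "real j * (var I / real N) \<le> v b" using r ab by auto
    from IVT[OF this ab(1)] show ?thesis using v_continuous by blast
  qed
  then obtain \<sigma> where \<sigma>: "\<And>j. j \<le> N \<Longrightarrow> v (\<sigma> j) = real j * (var I / real N)" by metis
  \<comment> \<open>The intermediate value theorem yields some points of level 0 and
    \<open>var I\<close>; the end points are overwritten to be exactly a and b.\<close>
  define \<tau> where "\<tau> j = (if j = 0 then a else if j = N then b else \<sigma> j)" for j
  have \<tau>: "v (\<tau> j) = real j * (var I / real N)" if "j \<le> N" for j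
    using that \<sigma> ab N by (auto simp: \<tau>_def)
  have "\<tau> i \<le> \<tau> j" if "i \<le> j" "j \<le> N" for i j
  proof (cases "i = j")
    case False
    then have "real i * (var I / real N) < real j * (var I / real N)"
      using that r N by (intro mult_strict_right_mono) auto
    then have "v (\<tau> i) < v (\<tau> j)" using \<tau>[of i] \<tau>[of j] that by simp
    then show ?thesis using v_mono[of "\<tau> j" "\<tau> i"] by linarith
  qed simp
  moreover have "v (\<tau> (Suc j)) - v (\<tau> j) \<le> var I / real N" if "j < N" for j
    using \<tau>[of j] \<tau>[of "Suc j"] that by (simp add: algebra_simps add_divide_distrib)
  ultimately show ?thesis using N by (intro exI[of _ \<tau>]) (auto simp: \<tau>_def)
qed

lemma ex_interval_grid: "\<exists>B cell. interval_grid I \<phi> B (var I) cell"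
proof (cases "I = {}")
  case True
  \<comment> \<open>The empty interval is set apart because infimum and supremum carry no
    information there.\<close>
  have "interval_grid I \<phi> (restrict_space borel I) (var I) (\<lambda>_ _. {})"
  proof (rule interval_grid.intro)
    show "finite_measure (restrict_space borel I)"
      by (rule finite_measureI) (simp add: True space_restrict_space)
  qed (auto simp: True interval var_nonneg vector_measure[unfolded True] subintervals_def vm_empty)
  then show ?thesis by blast
next
  case False
  \<comment> \<open>Starting strictly to the left of I, the half-open cells also cover a left end
    point that belongs to I.\<close>
  define a b where "a = Inf I - 1" and "b = Sup I"
  have bd: "bdd_below I" "bdd_above I" using bounded_I bounded_imp_bdd_below bounded_imp_bdd_above by auto
  have Iab: "Inf I \<le> x" "x \<le> b" if "x \<in> I" for x
    using that bd by (auto simp: b_def intro: cInf_lower cSup_upper)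
  have ab: "a < Inf I" "Inf I \<le> b" using False Iab by (auto simp: a_def intro: order_trans)
  have mem: "x \<in> I" if x: "Inf I < x" "x < b" for x
  proof -
    obtain p where "p \<in> I" "p < x" using cInf_less_iff[OF False bd(1)] x(1) by blast
    moreover obtain q where "q \<in> I" "x < q" using less_cSup_iff[OF False bd(2)] x(2) unfolding b_def by blast
    ultimately show ?thesis using mem_is_interval_1_I[OF interval, of p q x] by simp
  qed
  have "I \<inter> {..a} = {}" using Iab(1) ab(1) by force
  then have va: "v a = 0" using var_singleton[of a] var_mono[of "{}" "I \<inter> {a}"] var_nonneg[of "{}"] by (simp add: v_def)
  have "v (Inf I) \<le> var (I \<inter> {Inf I})" unfolding v_def using Iab(1) by (intro var_mono) force+
  then have vi: "v (Inf I) = 0" using var_singleton var_nonneg by (metis antisym v_def)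
  have "I \<inter> {..b} = I" using Iab(2) by auto
  then have vb: "v b = var I" by (simp add: v_def)
  define M where "M = interval_measure v"
  have rc: "continuous (at_right t) v" for t
    using v_continuous[of t] by (rule continuous_at_imp_continuous_at_within)
  have Ioc: "emeasure M {s<..t} = ennreal (v t - v s)" if "s \<le> t" for s t
    unfolding M_def by (rule emeasure_interval_measure_Ioc[OF that v_mono rc])
  have Icc: "emeasure M {s..t} = ennreal (v t - v s)" if "s \<le> t" for s t
    unfolding M_def by (rule emeasure_interval_measure_Icc[OF that v_mono])
      (simp_all add: continuous_at_imp_continuous_on v_continuous)
  have sM: "sets M = sets borel" "space M = UNIV" by (simp_all add: M_def)
  have Ib: "I \<in> sets borel" by (rule real_interval_borel_measurable[OF interval])
  \<comment> \<open>I may or may not contain its end points; both lie in this null set, so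
    \<open>I \<inter> {s<..t}\<close> has the full mass \<open>v t - v s\<close>.\<close>
  have null: "{a..Inf I} \<union> {b} \<in> null_sets M"
  proof (rule null_sets.Un)
    show "{a..Inf I} \<in> null_sets M"
      using Icc[of a "Inf I"] ab va vi by (intro null_setsI) (auto simp: sM)
    show "{b} \<in> null_sets M" using Icc[of b b] by (intro null_setsI) (auto simp: sM)
  qed
  have emI: "emeasure M (I \<inter> {s<..t}) = ennreal (v t - v s)" if "a \<le> s" "s \<le> t" "t \<le> b" for s t
  proof -
    let ?N = "{a..Inf I} \<union> {b}"
    have "emeasure M (I \<inter> {s<..t}) = emeasure M (I \<inter> {s<..t} - ?N)"
      using Ib by (intro emeasure_Diff_null_set[OF null, symmetric]) (auto simp: sM)
    also have "I \<inter> {s<..t} - ?N = {s<..t} - ?N"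
    proof (intro set_eqI iffI)
      fix x assume x: "x \<in> {s<..t} - ?N"
      then have "Inf I < x" "x < b" using that by auto
      then show "x \<in> I \<inter> {s<..t} - ?N" using mem x by blast
    qed auto
    also have "emeasure M ({s<..t} - ?N) = emeasure M {s<..t}"
      by (intro emeasure_Diff_null_set[OF null]) (auto simp: sM)
    finally show ?thesis using Ioc[OF that(2)] by simp
  qed
  define B where "B = restrict_space M I"
  have "\<forall>N. \<exists>\<tau>. 0 < N \<longrightarrow> \<tau> 0 = a \<and> \<tau> N = b \<and> (\<forall>i j. i \<le> j \<longrightarrow> j \<le> N \<longrightarrow> \<tau> i \<le> \<tau> j) \<and> (\<forall>j<N. v (\<tau> (Suc j)) - v (\<tau> j) \<le> var I / real N)"
    using ex_equidistant_points[OF _ va vb] ab by auto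
  then obtain \<tau> where \<tau>: "\<And>N. 0 < N \<Longrightarrow> \<tau> N 0 = a" "\<And>N. 0 < N \<Longrightarrow> \<tau> N N = b"
    "\<And>N i j. 0 < N \<Longrightarrow> i \<le> j \<Longrightarrow> j \<le> N \<Longrightarrow> \<tau> N i \<le> \<tau> N j"
    "\<And>N j. j < N \<Longrightarrow> v (\<tau> N (Suc j)) - v (\<tau> N j) \<le> var I / real N"
    by (metis gr_implies_not0 not_gr_zero)
  define cell where "cell N j = I \<inter> {\<tau> N j<..\<tau> N (Suc j)}" for N j
  have rng: "a \<le> \<tau> N j" "\<tau> N j \<le> \<tau> N (Suc j)" "\<tau> N (Suc j) \<le> b" if "j < N" for N j
    using \<tau>(1,2)[of N] \<tau>(3)[of N 0 j] \<tau>(3)[of N j "Suc j"] \<tau>(3)[of N "Suc j" N] that by auto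
  have mcell: "measure B (cell N j) = v (\<tau> N (Suc j)) - v (\<tau> N j)" if j: "j < N" for N j
  proof -
    have "emeasure B (cell N j) = emeasure M (cell N j)"
      unfolding B_def using Ib by (intro emeasure_restrict_space) (auto simp: cell_def sM)
    also have "\<dots> = ennreal (v (\<tau> N (Suc j)) - v (\<tau> N j))"
      unfolding cell_def by (rule emI[OF rng[OF j]])
    finally show ?thesis
      unfolding Sigma_Algebra.measure_def[of B] using v_mono[OF rng(2)[OF j]] by simp
  qed
  have "interval_grid I \<phi> B (var I) cell"
  proof (rule interval_grid.intro)
    show "is_interval I" by (rule interval)
    show "0 \<le> var I" by (rule var_nonneg)
    show "sets B = sets (restrict_space borel I)"
      unfolding B_def sets_restrict_space sM ..
    show "vector_measure_on I \<phi>" by (rule vector_measure)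
    have "emeasure B (space B) = emeasure M I"
      unfolding B_def using Ib by (subst emeasure_restrict_space) (auto simp: sM space_restrict_space)
    also have "\<dots> \<le> emeasure M {a<..b}"
      using Iab ab by (intro emeasure_mono) (force simp: sM)+
    also have "\<dots> < \<infinity>" using Ioc[of a b] ab by simp
    finally show "finite_measure B" by (intro finite_measureI) simp
    fix N j :: nat
    show "cell N j \<in> subintervals I" if "j < N"
      unfolding cell_def subintervals_def using interval by (auto intro: is_interval_Int is_interval_oc)
    show "s < t" if "i < j" "j < N" "s \<in> cell N i" "t \<in> cell N j" for i s t
      using that \<tau>(3)[of N "Suc i" j] by (auto simp: cell_def)
    show "(\<Union>j<N. cell N j) = I" if N: "0 < N"
    proof (intro set_eqI iffI)
      fix x assume x: "x \<in> I"
      have "a < x" "x \<le> b" using Iab[OF x] ab by auto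
      have "\<exists>j<n. x \<in> {\<tau> N j<..\<tau> N (Suc j)}" if "x \<le> \<tau> N n" "n \<le> N" for n
        using that
      proof (induction n)
        case 0
        then show ?case using \<tau>(1)[OF N] \<open>a < x\<close> by simp
      next
        case (Suc n)
        show ?case
        proof (cases "x \<le> \<tau> N n")
          case True
          then show ?thesis using Suc by (meson Suc_leD less_SucI)
        next
          case False
          then show ?thesis using Suc.prems by (intro exI[of _ n]) auto
        qed
      qed
      from this[of N] show "x \<in> (\<Union>j<N. cell N j)" using \<tau>(2)[OF N] \<open>x \<le> b\<close> x by (auto simp: cell_def)
    qed (auto simp: cell_def)
    show "norm (\<phi> K) \<le> measure B (cell N j)" if "j < N" "K \<in> subintervals I" "K \<subseteq> cell N j" for K
      using v_plus_norm_le[OF that(2), of "\<tau> N j" "\<tau> N (Suc j)"] that(3) rng(2)[OF that(1)]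
      unfolding mcell[OF that(1)] by (auto simp: cell_def)
    show "measure B (cell N j) \<le> var I / real N" if "j < N"
      unfolding mcell[OF that] by (rule \<tau>(4)[OF that])
  qed
  then show ?thesis by blast
qed

end



subsection \<open>The Magnus expansion\<close>

locale magnus_grid = interval_grid I \<phi> B r cell
  for I and \<phi> :: "real set \<Rightarrow> 'a::{real_normed_algebra_1,banach}" and B r cell +
  assumes r_less_2: "r < 2"
begin

abbreviation monomial :: "nat \<Rightarrow> (nat \<Rightarrow> nat) \<Rightarrow> (nat \<Rightarrow> 'a) \<Rightarrow> 'a" where
  "monomial k \<sigma> X \<equiv> prod_list (map (\<lambda>i. X (\<sigma> i)) [1..<Suc k])"

text \<open>The value 0 at index 0 makes the sequences start in degree 1, as
  \<open>magnus_series\<close> requires; the unit of the ordered exponential is added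
  separately.\<close>

definition "P k = (if k = 0 then 0 else ordered_integral I \<phi> k (\<lambda>X. prod_list (map X [1..<Suc k])))"

definition "q l k = (if k = 0 then 0 else mu_param_R l I \<phi> k)"

definition "m k = (if k = 0 then 0 else mu_R I \<phi> k)"

text \<open>The unique description of \<open>ordered_integral\<close> hides linearity in the
  integrand; it is recovered from the limits of sums over increasing tuples.\<close>

lemma ordered_integral_sum_monomials:
  "ordered_integral I \<phi> k (\<lambda>X. \<Sum>\<sigma> | \<sigma> permutes {1..k}. w \<sigma> *\<^sub>R monomial k \<sigma> X)
   = (\<Sum>\<sigma> | \<sigma> permutes {1..k}. w \<sigma> *\<^sub>R ordered_integral I \<phi> k (monomial k \<sigma>))"
proof (rule LIMSEQ_unique)
  have fin: "finite {\<sigma>. \<sigma> permutes {1..k}}" by (rule finite_permutations) simp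
  show "(\<lambda>N. \<Sum>t\<in>inc_tuples k N. \<Sum>\<sigma> | \<sigma> permutes {1..k}. w \<sigma> *\<^sub>R monomial k \<sigma> (\<lambda>i. mass N (t i)))
    \<longlonglongrightarrow> ordered_integral I \<phi> k (\<lambda>X. \<Sum>\<sigma> | \<sigma> permutes {1..k}. w \<sigma> *\<^sub>R monomial k \<sigma> X)"
    by (rule inc_sum_tendsto_ordered_integral[OF multilinear_form_sum[OF fin]])
      (rule multilinear_form_monomial, simp)
  have "(\<lambda>N. \<Sum>\<sigma> | \<sigma> permutes {1..k}. w \<sigma> *\<^sub>R (\<Sum>t\<in>inc_tuples k N. monomial k \<sigma> (\<lambda>i. mass N (t i))))
    \<longlonglongrightarrow> (\<Sum>\<sigma> | \<sigma> permutes {1..k}. w \<sigma> *\<^sub>R ordered_integral I \<phi> k (monomial k \<sigma>))"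
  proof (intro tendsto_sum tendsto_scaleR tendsto_const)
    fix \<sigma> assume "\<sigma> \<in> {\<sigma>. \<sigma> permutes {1..k}}"
    then have "\<sigma> permutes {1..k}" by simp
    from inc_sum_tendsto_ordered_integral[OF multilinear_form_monomial[OF this]]
    show "(\<lambda>N. \<Sum>t\<in>inc_tuples k N. monomial k \<sigma> (\<lambda>i. mass N (t i))) \<longlonglongrightarrow> ordered_integral I \<phi> k (monomial k \<sigma>)" .
  qed
  moreover have "(\<Sum>\<sigma> | \<sigma> permutes {1..k}. w \<sigma> *\<^sub>R (\<Sum>t\<in>inc_tuples k N. monomial k \<sigma> (\<lambda>i. mass N (t i))))
    = (\<Sum>t\<in>inc_tuples k N. \<Sum>\<sigma> | \<sigma> permutes {1..k}. w \<sigma> *\<^sub>R monomial k \<sigma> (\<lambda>i. mass N (t i)))" for N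
    unfolding scaleR_sum_right by (rule sum.swap)
  ultimately show "(\<lambda>N. \<Sum>t\<in>inc_tuples k N. \<Sum>\<sigma> | \<sigma> permutes {1..k}. w \<sigma> *\<^sub>R monomial k \<sigma> (\<lambda>i. mass N (t i)))
    \<longlonglongrightarrow> (\<Sum>\<sigma> | \<sigma> permutes {1..k}. w \<sigma> *\<^sub>R ordered_integral I \<phi> k (monomial k \<sigma>))" by simp
qed

lemma mu_param_R_eq:
  "mu_param_R l I \<phi> k = (\<Sum>\<sigma> | \<sigma> permutes {1..k}. (l ^ asc k \<sigma> * (l - 1) ^ des k \<sigma>) *\<^sub>R ordered_integral I \<phi> k (monomial k \<sigma>))"
proof -
  have "mu_param l k = (\<lambda>X :: nat \<Rightarrow> 'a. \<Sum>\<sigma> | \<sigma> permutes {1..k}. (l ^ asc k \<sigma> * (l - 1) ^ des k \<sigma>) *\<^sub>R monomial k \<sigma> X)"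
    by (rule ext) (rule mu_param_def)
  then show ?thesis unfolding mu_param_R_def by (simp only: ordered_integral_sum_monomials)
qed

lemma mu_R_eq:
  "mu_R I \<phi> k = (\<Sum>\<sigma> | \<sigma> permutes {1..k}. ((- 1) ^ des k \<sigma> * (fact (asc k \<sigma>) * fact (des k \<sigma>) / fact k)) *\<^sub>R
     ordered_integral I \<phi> k (monomial k \<sigma>))"
proof -
  have "mu k = (\<lambda>X :: nat \<Rightarrow> 'a. \<Sum>\<sigma> | \<sigma> permutes {1..k}. ((- 1) ^ des k \<sigma> * (fact (asc k \<sigma>) * fact (des k \<sigma>) / fact k)) *\<^sub>R monomial k \<sigma> X)"
    by (rule ext) (rule mu_def)
  then show ?thesis unfolding mu_R_def by (simp only: ordered_integral_sum_monomials)
qed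

lemma multilinear_form_mu_param: "multilinear_form k (mu_param l k :: (nat \<Rightarrow> 'a) \<Rightarrow> 'a)"
proof -
  have fin: "finite {\<sigma>. \<sigma> permutes {1..k}}" by (rule finite_permutations) simp
  have "mu_param l k = (\<lambda>X :: nat \<Rightarrow> 'a. \<Sum>\<sigma> | \<sigma> permutes {1..k}. (l ^ asc k \<sigma> * (l - 1) ^ des k \<sigma>) *\<^sub>R monomial k \<sigma> X)"
    by (rule ext) (rule mu_param_def)
  then show ?thesis
    by (simp only:) (rule multilinear_form_sum[OF fin], rule multilinear_form_monomial, simp)
qed

lemma kernel_sum_tendsto_of_inj_sum:
  assumes l: "l \<in> {0..1}"
    and lim: "(\<lambda>N. \<Sum>c\<in>inj_tuples (Suc k) N. (l ^ asc (Suc k) c * (l - 1) ^ des (Suc k) c) *\<^sub>R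
       prod_list (map (\<lambda>i. mass N (c i)) [1..<Suc (Suc k)])) \<longlonglongrightarrow> L"
  shows "(\<lambda>N. kernel_sum (mass N) N (of_real l) k) \<longlonglongrightarrow> of_re L"
proof -
  let ?S = "\<lambda>N. \<Sum>c\<in>inj_tuples (Suc k) N. (l ^ asc (Suc k) c * (l - 1) ^ des (Suc k) c) *\<^sub>R
       prod_list (map (\<lambda>i. mass N (c i)) [1..<Suc (Suc k)])"
  have "(\<lambda>N. kernel_sum (mass N) N (of_real l) k - of_re (?S N)) \<longlonglongrightarrow> 0"
  proof (rule Lim_null_comparison)
    show "\<forall>\<^sub>F N in sequentially. norm (kernel_sum (mass N) N (of_real l) k - of_re (?S N))
       \<le> (real N ^ Suc k - real (N - Suc k) ^ Suc k) * (r / real N) ^ Suc k"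
      by (intro always_eventually allI norm_inj_sum_minus_kernel_sum_le l norm_mass_le) (simp_all add: r_nonneg)
  qed (rule noninjective_fraction_tendsto)
  from tendsto_add[OF this bounded_linear.tendsto[OF bounded_linear_of_re lim]] show ?thesis by simp
qed

lemma kernel_sum_1_tendsto: "(\<lambda>N. kernel_sum (mass N) N 1 k) \<longlonglongrightarrow> of_re (P (Suc k))"
proof -
  have "id permutes {1..Suc k}" by (rule permutes_id)
  from inc_sum_tendsto_ordered_integral[OF multilinear_form_monomial[OF this]]
  have "(\<lambda>N. \<Sum>t\<in>inc_tuples (Suc k) N. prod_list (map (\<lambda>i. mass N (t i)) [1..<Suc (Suc k)])) \<longlonglongrightarrow> P (Suc k)"
    by (simp add: P_def del: upt_Suc)
  then have "(\<lambda>N. kernel_sum (mass N) N (of_real 1) k) \<longlonglongrightarrow> of_re (P (Suc k))"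
    unfolding sum_inc_prod_list by (intro kernel_sum_tendsto_of_inj_sum) auto
  then show ?thesis by simp
qed

lemma kernel_sum_tendsto_limit: "(\<lambda>N. kernel_sum (mass N) N z k) \<longlonglongrightarrow> kernel_limit P z (Suc k)"
  by (rule kernel_sum_tendsto[OF _ kernel_sum_1_tendsto]) (simp add: P_def)

lemma kernel_limit_0: "kernel_limit P z 0 = 0"
  by (simp add: kernel_limit.simps[of P z 0] P_def of_re_simps)

text \<open>Both sides are limits of the same kernel sums: one through the recurrence, the other
  through the rearrangement of permuted increasing tuples into injective ones.\<close>

lemma kernel_limit_real:
  assumes l: "l \<in> {0..1}"
  shows "kernel_limit P (of_real l) k = of_re (q l k)"
proof (cases k)
  case 0
  then show ?thesis by (simp add: kernel_limit_0 q_def of_re_simps)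
next
  case (Suc j)
  have "(\<lambda>N. \<Sum>t\<in>inc_tuples (Suc j) N. mu_param l (Suc j) (\<lambda>i. mass N (t i))) \<longlonglongrightarrow> mu_param_R l I \<phi> (Suc j)"
    unfolding mu_param_R_def by (rule inc_sum_tendsto_ordered_integral[OF multilinear_form_mu_param])
  then have "(\<lambda>N. kernel_sum (mass N) N (of_real l) j) \<longlonglongrightarrow> of_re (mu_param_R l I \<phi> (Suc j))"
    unfolding sum_inc_mu_param by (intro kernel_sum_tendsto_of_inj_sum l)
  then have "of_re (mu_param_R l I \<phi> (Suc j)) = kernel_limit P (of_real l) (Suc j)"
    by (rule LIMSEQ_unique[OF _ kernel_sum_tendsto_limit])
  then show ?thesis by (simp add: Suc q_def)
qed

lemma norm_q_le:
  assumes l: "l \<in> {0..1}"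
  shows "norm (q l k) \<le> 4 * exp 2 * exp 2 * (r / 2) ^ k"
proof (cases k)
  case 0
  then show ?thesis by (simp add: q_def)
next
  case (Suc j)
  \<comment> \<open>With k = j + 1 the product \<open>2 * r * (r / 2) ^ j\<close> is
    \<open>4 * (r / 2) ^ k\<close>, whence the constant 4.\<close>
  have "norm (kernel_limit P (of_real l) (Suc j)) \<le> 2 * r * exp 2 * exp 2 * (r / 2) ^ j"
    by (rule kernel_limit_real_bound[OF kernel_sum_tendsto_limit r_nonneg norm_mass_le l])
  then show ?thesis unfolding kernel_limit_real[OF l] Suc by simp
qed

lemma kernel_limit_bound:
  assumes "0 < cmod \<zeta>" "cmod \<zeta> < pi" "r < 2 * sin (cmod \<zeta> / 2)"
  shows "\<exists>D s. 0 \<le> s \<and> s < 1 \<and> (\<forall>k. norm (kernel_limit P (exp \<zeta> / (exp \<zeta> - 1)) k) \<le> D * s ^ k)"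
proof -
  let ?K = "kernel_limit P (exp \<zeta> / (exp \<zeta> - 1))"
  have "\<exists>D s. 0 \<le> s \<and> s < 1 \<and> (\<forall>k. norm (?K (Suc k)) \<le> D * s ^ k)"
    by (rule kernel_limit_circle_bound[OF kernel_sum_tendsto_limit r_nonneg norm_mass_le assms])
  then obtain D s where D: "0 \<le> s" "s < 1" "\<And>k. norm (?K (Suc k)) \<le> D * s ^ k" by blast
  have D0: "0 \<le> D" using order_trans[OF norm_ge_zero D(3)[of 0]] by simp
  \<comment> \<open>The rate s may be 0, and then the shift from j to j + 1 could not be absorbed
    into the constant. A rate of at least 1/2 costs only the factor 2.\<close>
  define u where "u = max s (1 / 2)"
  have u: "0 < u" "u < 1" "s \<le> u" "1 \<le> 2 * u" using D by (auto simp: u_def)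
  have "norm (?K k) \<le> 2 * D * u ^ k" for k
  proof (cases k)
    case 0
    then show ?thesis using D0 by (simp add: kernel_limit_0)
  next
    case (Suc j)
    have "norm (?K (Suc j)) \<le> D * u ^ j"
      by (rule order_trans[OF D(3)]) (intro mult_left_mono power_mono u D D0)
    also have "\<dots> \<le> D * u ^ j * (2 * u)"
      using mult_left_mono[OF u(4), of "D * u ^ j"] D0 u(1) by simp
    finally show ?thesis by (simp add: Suc mult_ac)
  qed
  then show ?thesis using u by (intro exI[of _ "2 * D"] exI[of _ u]) auto
qed

text \<open>Term by term over the permutations this is the Beta integral; ascents and descents
  together number k - 1.\<close>

lemma has_integral_q: "((\<lambda>l. q l k) has_integral m k) {0..1}"
proof (cases "k = 0")
  case False
  let ?O = "\<lambda>\<sigma>. ordered_integral I \<phi> k (monomial k \<sigma>)"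
  have fin: "finite {\<sigma>. \<sigma> permutes {1..k}}" by (rule finite_permutations) simp
  have "((\<lambda>l. \<Sum>\<sigma> | \<sigma> permutes {1..k}. (l ^ asc k \<sigma> * (l - 1) ^ des k \<sigma>) *\<^sub>R ?O \<sigma>) has_integral
     (\<Sum>\<sigma> | \<sigma> permutes {1..k}. ((- 1) ^ des k \<sigma> * (fact (asc k \<sigma>) * fact (des k \<sigma>) / fact k)) *\<^sub>R ?O \<sigma>)) {0..1::real}"
  proof (rule has_integral_sum[OF fin])
    fix \<sigma> assume "\<sigma> \<in> {\<sigma>. \<sigma> permutes {1..k}}"
    then have k: "Suc (asc k \<sigma> + des k \<sigma>) = k" using asc_plus_des[of \<sigma> k] False by simp
    have "((\<lambda>l. l ^ asc k \<sigma> * (l - 1) ^ des k \<sigma>) has_integral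
        ((- 1) ^ des k \<sigma> * (fact (asc k \<sigma>) * fact (des k \<sigma>) / fact k))) {0..1::real}"
      using has_integral_asc_des[of "asc k \<sigma>" "des k \<sigma>"] unfolding k by (simp add: mult.assoc)
    then show "((\<lambda>l. (l ^ asc k \<sigma> * (l - 1) ^ des k \<sigma>) *\<^sub>R ?O \<sigma>) has_integral
        ((- 1) ^ des k \<sigma> * (fact (asc k \<sigma>) * fact (des k \<sigma>) / fact k)) *\<^sub>R ?O \<sigma>) {0..1::real}"
      by (rule has_integral_scaleR_left)
  qed
  then show ?thesis using False by (simp only: q_def m_def if_False mu_param_R_eq mu_R_eq)
qed (simp add: q_def m_def)

lemma magnus_series: "magnus_series P m (kernel_limit P) q r (4 * exp 2 * exp 2)"
proof (rule magnus_series.intro)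
  show "P 0 = 0" by (simp add: P_def)
  then show "kernel_limit P z k = of_re (P k) - of_cx (1 - z) * (\<Sum>j\<le>k. of_re (P j) * kernel_limit P z (k - j))" for z k
    by (rule kernel_limit_recurrence)
qed (fact kernel_limit_real r_nonneg r_less_2 norm_q_le kernel_limit_bound has_integral_q)+

lemma ex_maximum: "\<exists>mx. is_maximum_on (\<lambda>l. norm (mu_param_R l I \<phi> k)) {0..1} mx"
proof -
  have "continuous_on {0..1} (\<lambda>l. norm (mu_param_R l I \<phi> k))"
    unfolding mu_param_R_eq by (intro continuous_intros)
  then obtain l where "l \<in> {0..1}" "\<forall>l'\<in>{0..1}. norm (mu_param_R l' I \<phi> k) \<le> norm (mu_param_R l I \<phi> k)"
    using continuous_attains_sup[of "{0..1::real}" "\<lambda>l. norm (mu_param_R l I \<phi> k)"] by auto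
  then show ?thesis unfolding is_maximum_on_def by blast
qed

theorem magnus_expansion:
  shows "log_exists Real_Scalars (exp_R I \<phi>)"
    and "summable (\<lambda>n. norm (mu_R I \<phi> (Suc n)))"
    and "\<exists>m. (\<forall>n. is_maximum_on (\<lambda>l. norm (mu_param_R l I \<phi> (Suc n))) {0..1} (m n)) \<and> summable m"
    and "((\<lambda>l. \<Sum>n. mu_param_R l I \<phi> (Suc n)) has_integral alg_log (exp_R I \<phi>)) {0..1}"
    and "(\<lambda>n. mu_R I \<phi> (Suc n)) sums alg_log (exp_R I \<phi>)"
    and "alg_spectral_radius Real_Scalars (alg_log (exp_R I \<phi>)) \<le> ennreal (2 * arcsin (r / 2))"
proof -
  interpret ms: magnus_series P m "kernel_limit P" q r "4 * exp 2 * exp 2" by (rule magnus_series)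
  have shift: "(\<Sum>k. f k) = (\<Sum>k. f (Suc k))" if "summable f" "f 0 = 0" for f :: "nat \<Rightarrow> 'a"
    using suminf_split_head[OF that(1)] that(2) by simp
  have A: "exp_R I \<phi> = ms.A"
    unfolding exp_R_def ms.A_def shift[OF summable_norm_cancel[OF ms.summable_p] ms.p0] by (simp add: P_def del: upt_Suc)
  show "log_exists Real_Scalars (exp_R I \<phi>)" unfolding A by (rule ms.log_exists_A)
  show "alg_spectral_radius Real_Scalars (alg_log (exp_R I \<phi>)) \<le> ennreal (2 * arcsin (r / 2))"
    unfolding A by (rule ms.spectral_radius_log_A)
  have mS: "m (Suc n) = mu_R I \<phi> (Suc n)" for n by (simp add: m_def)
  have "summable (\<lambda>n. norm (m n))"
    by (rule summable_comparison_test'[OF ms.summable_geo, of 0]) (simp only: real_norm_def abs_norm_cancel ms.norm_m_le)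
  then show "summable (\<lambda>n. norm (mu_R I \<phi> (Suc n)))"
    unfolding mS[symmetric] by (subst summable_Suc_iff)
  show "(\<lambda>n. mu_R I \<phi> (Suc n)) sums alg_log (exp_R I \<phi>)"
    unfolding A mS[symmetric] using ms.sums_m ms.m0 by (subst sums_Suc_iff) simp
  have "((\<lambda>l. \<Sum>k. q l k) has_integral alg_log (exp_R I \<phi>)) {0..1}" unfolding A by (rule ms.has_integral_series)
  moreover have "(\<Sum>k. q l k) = (\<Sum>n. mu_param_R l I \<phi> (Suc n))" if "l \<in> {0..1}" for l
    using shift[OF summable_norm_cancel[OF ms.summable_q[OF that]] ms.q0[OF that]] by (simp add: q_def)
  ultimately show "((\<lambda>l. \<Sum>n. mu_param_R l I \<phi> (Suc n)) has_integral alg_log (exp_R I \<phi>)) {0..1}"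
    by (rule has_integral_eq[rotated])
  have "\<forall>n. \<exists>mx. is_maximum_on (\<lambda>l. norm (mu_param_R l I \<phi> (Suc n))) {0..1} mx"
    by (intro allI ex_maximum)
  from choice[OF this] obtain M
    where M: "\<forall>n. is_maximum_on (\<lambda>l. norm (mu_param_R l I \<phi> (Suc n))) {0..1} (M n)" ..
  have bound: "norm (M n) \<le> 4 * exp 2 * exp 2 * (r / 2) ^ Suc n" for n
  proof -
    obtain l where l: "l \<in> {0..1}" "norm (mu_param_R l I \<phi> (Suc n)) = M n"
      using spec[OF M, of n] unfolding is_maximum_on_def by blast
    have "q l (Suc n) = mu_param_R l I \<phi> (Suc n)" by (simp add: q_def)
    then have "norm (M n) = norm (q l (Suc n))" using l(2) by (simp flip: l(2))
    then show ?thesis using norm_q_le[OF l(1), of "Suc n"] by (simp only:)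
  qed
  have "summable (\<lambda>n. 4 * exp 2 * exp 2 * (r / 2) ^ Suc n)"
    using ms.summable_geo by (subst summable_Suc_iff)
  from summable_comparison_test'[OF this, of 0 M, OF bound] have "summable M" .
  with M show "\<exists>m. (\<forall>n. is_maximum_on (\<lambda>l. norm (mu_param_R l I \<phi> (Suc n))) {0..1} (m n)) \<and> summable m"
    by (intro exI[of _ M] conjI)
qed

end

theorem theorem2p16:
  fixes S :: "'a::{real_normed_algebra_1,banach} scalars"
    and I :: "real set" and \<phi> :: "real set \<Rightarrow> 'a" and r :: real
  assumes "scalar_structure S"
    and "is_interval I" and "bounded I"
    and "vector_measure_on I \<phi>"
    and "continuous_measure_on I \<phi>"
    and "variation \<phi> I < \<infinity>"
    and "variation \<phi> I < 2"
    and "r = enn2real (variation \<phi> I)"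
  shows "log_exists S (exp_R I \<phi>)
    \<and> summable (\<lambda>n. norm (mu_R I \<phi> (Suc n)))
    \<and> (\<exists>m. (\<forall>n. is_maximum_on (\<lambda>l. norm (mu_param_R l I \<phi> (Suc n))) {0..1} (m n)) \<and> summable m)
    \<and> ((\<lambda>l. \<Sum>n. mu_param_R l I \<phi> (Suc n)) has_integral alg_log (exp_R I \<phi>)) {0..1}
    \<and> (\<lambda>n. mu_R I \<phi> (Suc n)) sums alg_log (exp_R I \<phi>)
    \<and> alg_spectral_radius S (alg_log (exp_R I \<phi>)) \<le> ennreal (2 * arcsin (r / 2))"
proof -
  interpret fv: finite_variation_measure I \<phi> by (rule finite_variation_measure.intro) fact+
  have r: "fv.var I = r" unfolding fv.var_def using assms(8) by simp
  obtain B cell where grid: "interval_grid I \<phi> B r cell" using fv.ex_interval_grid unfolding r by blast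
  have "ennreal r < 2" using assms(6-8) by (simp add: ennreal_enn2real_if)
  then have "r < 2" by (simp add: ennreal_less_iff[of r 2, simplified] assms(8))
  then interpret magnus_grid I \<phi> B r cell
    by (intro magnus_grid.intro grid magnus_grid_axioms.intro)
  \<comment> \<open>Existence of the logarithm and the bound on the radius both restrict where
    spectrum may lie, so they pass from the spectrum in the complexification to any subset of
    it.\<close>
  note sub = alg_spectrum_subset_real[OF assms(1)]
  have "log_exists S (exp_R I \<phi>)"
    using magnus_expansion(1) sub[of "exp_R I \<phi>"] unfolding log_exists_def by blast
  moreover have "alg_spectral_radius S (alg_log (exp_R I \<phi>)) \<le> ennreal (2 * arcsin (r / 2))"
    unfolding alg_spectral_radius_def
    by (rule order_trans[OF SUP_subset_mono[OF sub order_refl]]) (rule magnus_expansion(6)[unfolded alg_spectral_radius_def])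
  ultimately show ?thesis using magnus_expansion(2-5) by blast
qed


end
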